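(* Let $N\ge2$, let $\mathbf k$ be a vector of $N$ positive integers, and let $G$ be a loopless directed graph on $[N]$ with $\mathcal D(G,\mathbf k)>0$. Put $F^*=E^*_{\mathbf k}(E(G))$ and $c^*=c(F^* )$, and let $\widehat\Sigma^*$ be the reduced covariance matrix of $F^*$. Then, as $m\to\infty$, $$\mathcal D(G,m\mathbf k)\sim\frac{\operatorname{cap}_{\mathbf k}(F^* )^m}{(2\pi m)^{(N-c^* )/2}\sqrt{\det\widehat\Sigma^*}}.$$
   Context: Let $[N]=\{1,\dots,N\}$ and $\mathcal E_N=\{(j,i):1\le i,j\le N,\ j\ne i\}$, with $(j,i)$ written $j\to i$; $B_i(G)=\{j:j\to i\in E(G)\}$. Algebraic degree. Player $i$ has pure strategies $S_i=\{0,\ldots,k_i\}$ and payoff table $u_i(s,\alpha)$, $s\in S_i$, $\alpha\in\prod_{q\in B_i(G)}S_q$. With $d=\sum_ik_i$ variables $x_{q,t}$ ($1\le t\le k_q$) and $x_{q,0}=1-\sum_{t\ge1}x_{q,t}$, the indifference system is $f_{i,s}(x)=\sum_\alpha(u_i(s,\alpha)-u_i(0,\alpha))\prod_{q\in B_i(G)}x_{q,\alpha_q}=0$ ($1\le i\le N$, $1\le s\le k_i$). $\mathcal D(G,\mathbf k)$ is the number of isolated solutions in $(\mathbb C^* )^d$, counted with multiplicity, for generic coefficients (a nonempty Zariski-open set of payoff tables). It equals $[z^{\mathbf k}]\prod_{i=1}^N\bigl(\sum_{j\in B_i(G)}z_j\bigr)^{k_i}$, the coefficient of $z_1^{k_1}\cdots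 z_N^{k_N}$. Transportation polytope. For $E\subseteq\mathcal E_N$, $\mathcal T_E(\mathbf k)=\{a\in\mathbb R_{\ge0}^E:\ \sum_{j:j\to i\in E}a_{ji}=k_i\ \forall i,\ \sum_{i:j\to i\in E}a_{ji}=k_j\ \forall j\}$. The essential support is $E^*_{\mathbf k}(E)=\{e\in E: p_e>0\text{ for some }p\in\mathcal T_E(\mathbf k)\}$. $\mathcal B(F)$ is the bipartite graph with left vertices $i_L$ and right vertices $j_R$ ($i,j\in[N]$) and an edge $i_Lj_R$ for each $j\to i\in F$; $c(F)$ is its number of connected components. Capacity: $\operatorname{cap}_{\mathbf k}(F)=\inf_{z\in\mathbb R_{>0}^N}\ \prod_i\bigl(\sum_{j:j\to i\in F}z_j\bigr)^{k_i}\big/\prod_jz_j^{k_j}$. Reduced covariance. For $p\in\mathcal T_{F^*}(\mathbf k)$ put $q_{ji}(p)=p_{ji}/k_i$ and $H(q_i(p))=-\sum_{j:j\to i\in F^*}q_{ji}(p)\log q_{ji}(p)$ with $0\log0=0$. Let $p^*$ be the unique maximizer of $\sum_ik_iH(q_i(p))$ over $\mathcal T_{F^*}(\mathbf k)$. Regard $q_i=q_i(p^* )$ as a vector in $\mathbb R^N$ (extended by zero) and let $\Sigma^*=\sum_ik_i(\operatorname{Diag}(q_i)-q_iq_i^{\mathsf T})$. Choose one right vertex in each connected component of $\mathcal B(F^* )$; $\widehat\Sigma^*$ is the principal submatrix of $\Sigma^*$ obtained by deleting the rows and columns of the chosen indices (any choice; the determinant does not depend on it). The determinant of the empty matrix is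 $1$. *)

theory Defs
  imports
    "HOL-Analysis.Function_Topology"
    "HOL-Analysis.Isolated"
    "HOL-Library.Poly_Mapping"
    "HOL-Library.Extended_Nat"
    "HOL-Library.FuncSet"
    "HOL-Library.Landau_Symbols"
    "Jordan_Normal_Form.Determinant"
    "Jordan_Normal_Form.DL_Submatrix"
begin

section \<open>Polynomials in finitely many variables\<close>

text \<open>A monomial is a finitely supported exponent function. The type has all of \<open>'v\<close>
  as variables; the polynomial ring in the variables \<open>V\<close> is its subset \<open>polys V\<close>.\<close>

type_synonym 'v mpoly = "('v \<Rightarrow>\<^sub>0 nat) \<Rightarrow>\<^sub>0 complex"

definition Cst :: "complex \<Rightarrow> 'v mpoly" where
  "Cst c = Poly_Mapping.single 0 c"

definition Var :: "'v \<Rightarrow> 'v mpoly" where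
  "Var v = Poly_Mapping.single (Poly_Mapping.single v 1) 1"

definition polys :: "'v set \<Rightarrow> 'v mpoly set" where
  "polys V = {P. \<forall>m\<in>Poly_Mapping.keys P. Poly_Mapping.keys m \<subseteq> V}"

definition eval_at :: "('v \<Rightarrow> complex) \<Rightarrow> 'v mpoly \<Rightarrow> complex" where
  "eval_at x P = (\<Sum>m\<in>Poly_Mapping.keys P. Poly_Mapping.lookup P m *
     (\<Prod>v\<in>Poly_Mapping.keys m. x v ^ Poly_Mapping.lookup m v))"

text \<open>Points of the affine space with coordinates \<open>I\<close> are extensional functions on \<open>I\<close>.\<close>

definition zariski_open :: "'v set \<Rightarrow> ('v \<Rightarrow> complex) set \<Rightarrow> bool" where
  "zariski_open I U \<longleftrightarrow>
     (\<exists>S \<subseteq> polys I. U = {x \<in> I \<rightarrow>\<^sub>E UNIV. \<exists>P\<in>S. eval_at x P \<noteq> 0})"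

definition ctorus :: "'v set \<Rightarrow> ('v \<Rightarrow> complex) set" where
  "ctorus V = V \<rightarrow>\<^sub>E (- {0})"

definition ideal_gen :: "'v set \<Rightarrow> 'v mpoly set \<Rightarrow> 'v mpoly set" where
  "ideal_gen V F = {\<Sum>f\<in>F. g f * f | g. \<forall>f\<in>F. g f \<in> polys V}"

text \<open>The contraction to the polynomial ring of the ideal that \<open>F\<close> generates in the local
  ring at \<open>a\<close>, that is, in the ring of fractions whose denominators do not vanish at \<open>a\<close>.\<close>

definition local_ideal :: "'v set \<Rightarrow> 'v mpoly set \<Rightarrow> ('v \<Rightarrow> complex) \<Rightarrow> 'v mpoly set" where
  "local_ideal V F a =
     {g \<in> polys V. \<exists>h\<in>polys V. eval_at a h \<noteq> 0 \<and> h * g \<in> ideal_gen V F}"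

text \<open>The dimension over the complex numbers of the local ring at \<open>a\<close> modulo the ideal
  generated by \<open>F\<close>, as the supremum of the sizes of linearly independent families.
  Families of polynomials suffice: multiplication by a common denominator, a unit of the
  local ring, preserves linear independence in the quotient.\<close>

definition multiplicity_at :: "'v set \<Rightarrow> 'v mpoly set \<Rightarrow> ('v \<Rightarrow> complex) \<Rightarrow> enat" where
  "multiplicity_at V F a = (SUP n \<in> {n. \<exists>b. (\<forall>j<n. b j \<in> polys V) \<and>
     (\<forall>c. (\<Sum>j<n. Cst (c j) * b j) \<in> local_ideal V F a \<longrightarrow> (\<forall>j<n. c j = 0))}. enat n)"


section \<open>The indifference system and the algebraic degree\<close>

text \<open>A directed graph on \<open>{1..N}\<close> is given by its edge set; \<open>(j, i)\<close> is the edge from \<open>j\<close>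
  to \<open>i\<close>.\<close>

definition all_edges :: "nat \<Rightarrow> (nat \<times> nat) set" where
  "all_edges N = {(j, i). i \<in> {1..N} \<and> j \<in> {1..N} \<and> j \<noteq> i}"

definition in_nbrs :: "(nat \<times> nat) set \<Rightarrow> nat \<Rightarrow> nat set" where
  "in_nbrs E i = {j. (j, i) \<in> E}"

definition out_nbrs :: "(nat \<times> nat) set \<Rightarrow> nat \<Rightarrow> nat set" where
  "out_nbrs E j = {i. (j, i) \<in> E}"

definition profiles :: "(nat \<times> nat) set \<Rightarrow> (nat \<Rightarrow> nat) \<Rightarrow> nat \<Rightarrow> (nat \<Rightarrow> nat) set" where
  "profiles G k i = (\<Pi>\<^sub>E q\<in>in_nbrs G i. {0..k q})"

definition table_entries ::
  "nat \<Rightarrow> (nat \<times> nat) set \<Rightarrow> (nat \<Rightarrow> nat) \<Rightarrow> (nat \<times> nat \<times> (nat \<Rightarrow> nat)) set" where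
  "table_entries N G k = {(i, s, \<alpha>). i \<in> {1..N} \<and> s \<in> {0..k i} \<and> \<alpha> \<in> profiles G k i}"

definition strat_vars :: "nat \<Rightarrow> (nat \<Rightarrow> nat) \<Rightarrow> (nat \<times> nat) set" where
  "strat_vars N k = {(q, t). q \<in> {1..N} \<and> t \<in> {1..k q}}"

definition strat_poly :: "(nat \<Rightarrow> nat) \<Rightarrow> nat \<Rightarrow> nat \<Rightarrow> (nat \<times> nat) mpoly" where
  "strat_poly k q t = (if t = 0 then 1 - (\<Sum>r = 1..k q. Var (q, r)) else Var (q, t))"

definition indiff_poly ::
  "(nat \<times> nat) set \<Rightarrow> (nat \<Rightarrow> nat) \<Rightarrow> (nat \<times> nat \<times> (nat \<Rightarrow> nat) \<Rightarrow> complex) \<Rightarrow>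
   nat \<Rightarrow> nat \<Rightarrow> (nat \<times> nat) mpoly" where
  "indiff_poly G k u i s = (\<Sum>\<alpha>\<in>profiles G k i.
     Cst (u (i, s, \<alpha>) - u (i, 0, \<alpha>)) * (\<Prod>q\<in>in_nbrs G i. strat_poly k q (\<alpha> q)))"

definition indiff_system ::
  "nat \<Rightarrow> (nat \<times> nat) set \<Rightarrow> (nat \<Rightarrow> nat) \<Rightarrow> (nat \<times> nat \<times> (nat \<Rightarrow> nat) \<Rightarrow> complex) \<Rightarrow>
   (nat \<times> nat) mpoly set" where
  "indiff_system N G k u = {indiff_poly G k u i s | i s. i \<in> {1..N} \<and> s \<in> {1..k i}}"

definition torus_solutions ::
  "nat \<Rightarrow> (nat \<times> nat) set \<Rightarrow> (nat \<Rightarrow> nat) \<Rightarrow> (nat \<times> nat \<times> (nat \<Rightarrow> nat) \<Rightarrow> complex) \<Rightarrow>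
   (nat \<times> nat \<Rightarrow> complex) set" where
  "torus_solutions N G k u =
     {x \<in> ctorus (strat_vars N k). \<forall>f\<in>indiff_system N G k u. eval_at x f = 0}"

text \<open>The topology used by \<open>isolated_in\<close> is the product topology on functions; on functions
  extensional on the finite set of variables it is the Euclidean one.\<close>

definition isolated_solutions ::
  "nat \<Rightarrow> (nat \<times> nat) set \<Rightarrow> (nat \<Rightarrow> nat) \<Rightarrow> (nat \<times> nat \<times> (nat \<Rightarrow> nat) \<Rightarrow> complex) \<Rightarrow>
   (nat \<times> nat \<Rightarrow> complex) set" where
  "isolated_solutions N G k u =
     {x. x isolated_in torus_solutions N G k u}"

definition has_solution_count ::
  "nat \<Rightarrow> (nat \<times> nat) set \<Rightarrow> (nat \<Rightarrow> nat) \<Rightarrow> (nat \<times> nat \<times> (nat \<Rightarrow> nat) \<Rightarrow> complex) \<Rightarrow>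
   nat \<Rightarrow> bool" where
  "has_solution_count N G k u n \<longleftrightarrow>
     finite (isolated_solutions N G k u) \<and>
     (\<Sum>x\<in>isolated_solutions N G k u.
        multiplicity_at (strat_vars N k) (indiff_system N G k u) x) = enat n"

text \<open>The generic count is unique because two nonempty Zariski-open sets intersect.\<close>

definition algebraic_degree :: "nat \<Rightarrow> (nat \<times> nat) set \<Rightarrow> (nat \<Rightarrow> nat) \<Rightarrow> nat" where
  "algebraic_degree N G k = (THE n. \<exists>U. zariski_open (table_entries N G k) U \<and> U \<noteq> {} \<and>
     (\<forall>u\<in>U. has_solution_count N G k u n))"


section \<open>Transportation polytope, bipartite graph and capacity\<close>

text \<open>Points of the polytope are extended by zero outside \<open>E\<close>.\<close>

definition transport_polytope ::
  "nat \<Rightarrow> (nat \<Rightarrow> nat) \<Rightarrow> (nat \<times> nat) set \<Rightarrow> (nat \<times> nat \<Rightarrow> real) set" where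
  "transport_polytope N k E = {a. (\<forall>e\<in>E. 0 \<le> a e) \<and> (\<forall>e. e \<notin> E \<longrightarrow> a e = 0) \<and>
     (\<forall>i\<in>{1..N}. (\<Sum>j\<in>in_nbrs E i. a (j, i)) = real (k i)) \<and>
     (\<forall>j\<in>{1..N}. (\<Sum>i\<in>out_nbrs E j. a (j, i)) = real (k j))}"

definition essential_support ::
  "nat \<Rightarrow> (nat \<Rightarrow> nat) \<Rightarrow> (nat \<times> nat) set \<Rightarrow> (nat \<times> nat) set" where
  "essential_support N k E = {e \<in> E. \<exists>p\<in>transport_polytope N k E. p e > 0}"

text \<open>\<open>Inl i\<close> is the left vertex and \<open>Inr j\<close> the right vertex of the bipartite graph.\<close>

definition bip_verts :: "nat \<Rightarrow> (nat + nat) set" where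
  "bip_verts N = {1..N} <+> {1..N}"

definition bip_edges :: "(nat \<times> nat) set \<Rightarrow> ((nat + nat) \<times> (nat + nat)) set" where
  "bip_edges F = {(Inl i, Inr j) | i j. (j, i) \<in> F}"

definition bip_components :: "nat \<Rightarrow> (nat \<times> nat) set \<Rightarrow> (nat + nat) set set" where
  "bip_components N F =
     bip_verts N // ((bip_edges F \<union> (bip_edges F)\<inverse>)\<^sup>* \<inter> bip_verts N \<times> bip_verts N)"

definition num_components :: "nat \<Rightarrow> (nat \<times> nat) set \<Rightarrow> nat" where
  "num_components N F = card (bip_components N F)"

definition capacity :: "nat \<Rightarrow> (nat \<Rightarrow> nat) \<Rightarrow> (nat \<times> nat) set \<Rightarrow> real" where
  "capacity N k F = (INF z\<in>{z::nat \<Rightarrow> real. \<forall>i\<in>{1..N}. 0 < z i}.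
     (\<Prod>i = 1..N. (\<Sum>j\<in>in_nbrs F i. z j) ^ k i) / (\<Prod>j = 1..N. z j ^ k j))"


section \<open>Entropy maximizer and reduced covariance\<close>

definition cond_prob :: "(nat \<Rightarrow> nat) \<Rightarrow> (nat \<times> nat \<Rightarrow> real) \<Rightarrow> nat \<Rightarrow> nat \<Rightarrow> real" where
  "cond_prob k p i j = p (j, i) / real (k i)"

text \<open>The convention \<open>0 log 0 = 0\<close> holds whatever value HOL gives to \<open>ln 0\<close>.\<close>

definition weighted_entropy ::
  "nat \<Rightarrow> (nat \<Rightarrow> nat) \<Rightarrow> (nat \<times> nat) set \<Rightarrow> (nat \<times> nat \<Rightarrow> real) \<Rightarrow> real" where
  "weighted_entropy N k F p = (\<Sum>i = 1..N. real (k i) *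
     (- (\<Sum>j\<in>in_nbrs F i. cond_prob k p i j * ln (cond_prob k p i j))))"

definition entropy_maximizer ::
  "nat \<Rightarrow> (nat \<Rightarrow> nat) \<Rightarrow> (nat \<times> nat) set \<Rightarrow> (nat \<times> nat \<Rightarrow> real)" where
  "entropy_maximizer N k F = (THE p. p \<in> transport_polytope N k F \<and>
     (\<forall>p'\<in>transport_polytope N k F. weighted_entropy N k F p' \<le> weighted_entropy N k F p))"

text \<open>Matrix indices start at 0, so that row \<open>a\<close> belongs to the index \<open>Suc a\<close> of \<open>{1..N}\<close>.\<close>

definition covariance :: "nat \<Rightarrow> (nat \<Rightarrow> nat) \<Rightarrow> (nat \<times> nat \<Rightarrow> real) \<Rightarrow> real mat" where
  "covariance N k p = mat N N (\<lambda>(a, b). \<Sum>i = 1..N. real (k i) *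
     ((if a = b then cond_prob k p i (Suc a) else 0) -
      cond_prob k p i (Suc a) * cond_prob k p i (Suc b)))"

definition right_representatives :: "nat \<Rightarrow> (nat \<times> nat) set \<Rightarrow> nat set \<Rightarrow> bool" where
  "right_representatives N F R \<longleftrightarrow> R \<subseteq> {1..N} \<and>
     (\<forall>C\<in>bip_components N F. \<exists>!j. j \<in> R \<and> Inr j \<in> C)"

definition reduced_covariance ::
  "nat \<Rightarrow> (nat \<Rightarrow> nat) \<Rightarrow> (nat \<times> nat) set \<Rightarrow> nat set \<Rightarrow> real mat" where
  "reduced_covariance N k F R =
     submatrix (covariance N k (entropy_maximizer N k F)) {a. Suc a \<notin> R} {a. Suc a \<notin> R}"

end

theory Submission
  imports
    Defs
    "HOL-Computational_Algebra.Fundamental_Theorem_Algebra"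
    "HOL-Probability.Distributions"
    "HOL-Probability.Characteristic_Functions"
begin

text \<open>Encode the strategy of player \<open>q\<close> as a monic polynomial of degree \<open>k q\<close>. There is a special payoff
  table for which the equation \<open>(i, s)\<close> says that the product over the in-neighbours \<open>q\<close> of \<open>i\<close> of these
  polynomials vanishes at a node depending on \<open>(i, s)\<close>. A monic polynomial of degree \<open>k q\<close> has at most
  \<open>k q\<close> of the nodes as roots, so the solutions correspond to the assignments \<open>\<sigma>\<close> of in-neighbours to
  equations that use every \<open>q\<close> exactly \<open>k q\<close> times (the balanced ones). The powers of a linear form that
  separates these solutions span the polynomials of bounded degree modulo the special system. Spanning
  and simplicity of roots persist for generic tables, which therefore have the same number of
  solutions, all simple. Hence the algebraic degree is the number of balanced assignments.

  For the degree vector \<open>m k\<close>, balanced assignments only use edges of the essential support \<open>F\<close>. The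
  capacity is attained at some \<open>z = exp y\<close>, because \<open>F\<close> carries a positive point of the transportation
  polytope, and \<open>q i j = z j / (sum of z over the neighbours of i)\<close> is the rescaled entropy maximizer. If
  every equation of player \<open>i\<close> chooses its neighbour independently with law \<open>q i\<close>, each balanced
  assignment has probability \<open>cap ^ (- m)\<close>, so the number of balanced assignments is \<open>cap ^ m\<close> times
  the probability that the counts hit their mean \<open>m k\<close>. Fourier inversion on the coordinates outside \<open>R\<close>,
  where the covariance is nondegenerate, and dominated convergence evaluate this probability, as in the
  local central limit theorem.\<close>

text \<open>The count must neither grow nor drop when the table leaves the special one. Growth is a
  question of rank. To make it one about a finite matrix, the cofactors in the ideal are bounded in
  the variables of each player, and \<open>vanishing_imp_in_ideal\<close> supplies such bounds at
  the special table. A drop could come from solutions that run off to infinity. It is excluded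
  without continuing solutions: through every special solution pass curves of tables and solutions
  with any prescribed direction of the table (\<open>curve_exists\<close>), so a relation of degree
  below \<open>card S\<close> in the separating form that holds on all solutions of all tables is
  zero. Hence for a generic table every root of the eliminant yields a solution. The counts obey one
  linear relation for each component of the bipartite graph, so their law is degenerate until the
  frequencies on \<open>R\<close> are set to zero. Definiteness of the covariance and decay of the
  characteristic function on the whole cube come from one path estimate, stated for pseudometrics to
  cover angles and points of the unit circle alike.\<close>

section \<open>Evaluation and coefficients of multivariate polynomials\<close>

definition monom_at :: "('v \<Rightarrow> complex) \<Rightarrow> ('v \<Rightarrow>\<^sub>0 nat) \<Rightarrow> complex" where
  "monom_at x m = (\<Prod>v\<in>Poly_Mapping.keys m. x v ^ Poly_Mapping.lookup m v)"

text \<open>A common finite superset of the supports makes additivity in the exponents a termwise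
  fact; the same device recurs for evaluation and for group degrees.\<close>

lemma monom_at_superset:
  assumes "finite K" "Poly_Mapping.keys m \<subseteq> K"
  shows "monom_at x m = (\<Prod>v\<in>K. x v ^ Poly_Mapping.lookup m v)"
  unfolding monom_at_def
  by (rule prod.mono_neutral_left) (use assms in \<open>auto simp: in_keys_iff\<close>)

lemma monom_at_zero [simp]: "monom_at x 0 = 1"
  by (simp add: monom_at_def)

lemma monom_at_add: "monom_at x (m + n) = monom_at x m * monom_at x n"
proof -
  let ?K = "Poly_Mapping.keys m \<union> Poly_Mapping.keys n"
  have "Poly_Mapping.keys (m + n) \<subseteq> ?K"
    by (rule Poly_Mapping.keys_add)
  then show ?thesis
    by (subst (1 2 3) monom_at_superset[of ?K])
       (auto simp: lookup_add power_add prod.distrib)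
qed

lemma eval_at_superset:
  assumes "finite K" "Poly_Mapping.keys P \<subseteq> K"
  shows "eval_at x P = (\<Sum>m\<in>K. Poly_Mapping.lookup P m * monom_at x m)"
  unfolding eval_at_def monom_at_def
  by (rule sum.mono_neutral_left) (use assms in \<open>auto simp: in_keys_iff\<close>)

lemma eval_at_zero [simp]: "eval_at x 0 = 0"
  by (simp add: eval_at_def)

lemma eval_at_add [simp]: "eval_at x (P + Q) = eval_at x P + eval_at x Q"
proof -
  let ?K = "Poly_Mapping.keys P \<union> Poly_Mapping.keys Q"
  have "Poly_Mapping.keys (P + Q) \<subseteq> ?K"
    by (rule Poly_Mapping.keys_add)
  then show ?thesis
    by (subst (1 2 3) eval_at_superset[of ?K])
       (auto simp: lookup_add algebra_simps sum.distrib)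
qed

lemma eval_at_single [simp]: "eval_at x (Poly_Mapping.single m c) = c * monom_at x m"
  by (subst eval_at_superset[of "{m}"]) auto

lemma eval_at_sum [simp]: "eval_at x (sum f A) = (\<Sum>a\<in>A. eval_at x (f a))"
  by (induction A rule: infinite_finite_induct) auto

lemma mpoly_expansion:
  "(P :: 'a \<Rightarrow>\<^sub>0 'b::comm_monoid_add) =
    (\<Sum>m\<in>Poly_Mapping.keys P. Poly_Mapping.single m (Poly_Mapping.lookup P m))"
  by (rule poly_mapping_eqI)
     (auto simp: lookup_sum lookup_single when_def in_keys_iff sum.delta)

lemma eval_at_mult [simp]: "eval_at x (P * Q) = eval_at x P * eval_at x Q"
proof -
  have "eval_at x (P * Q) = eval_at x
     ((\<Sum>m\<in>Poly_Mapping.keys P. Poly_Mapping.single m (Poly_Mapping.lookup P m)) *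
      (\<Sum>m\<in>Poly_Mapping.keys Q. Poly_Mapping.single m (Poly_Mapping.lookup Q m)))"
    using mpoly_expansion[of P] mpoly_expansion[of Q] by simp
  also have "\<dots> = eval_at x P * eval_at x Q"
    by (simp add: sum_product mult_single monom_at_add mult.assoc mult.left_commute
        eval_at_superset[OF _ order_refl])
  finally show ?thesis .
qed

lemma eval_at_Cst [simp]: "eval_at x (Cst c) = c"
  by (simp add: Cst_def)

lemma eval_at_one [simp]: "eval_at x 1 = 1"
  using eval_at_Cst[of x 1] by (simp add: Cst_def)

lemma eval_at_Var [simp]: "eval_at x (Var v) = x v"
  by (simp add: Var_def monom_at_def)

lemma eval_at_uminus [simp]: "eval_at x (- P) = - eval_at x P"
proof -
  have "eval_at x (- P) + eval_at x P = 0"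
    by (simp flip: eval_at_add)
  then show ?thesis by (simp add: add_eq_0_iff)
qed

lemma eval_at_diff [simp]: "eval_at x (P - Q) = eval_at x P - eval_at x Q"
  using eval_at_add[of x P "- Q"] by simp

lemma eval_at_prod [simp]: "eval_at x (prod f A) = (\<Prod>a\<in>A. eval_at x (f a))"
  by (induction A rule: infinite_finite_induct) auto

lemma eval_at_power [simp]: "eval_at x (P ^ n) = eval_at x P ^ n"
  by (induction n) auto

lemma eval_at_cong:
  assumes "P \<in> polys V" "\<And>v. v \<in> V \<Longrightarrow> x v = y v"
  shows "eval_at x P = eval_at y P"
proof -
  have "x v = y v" if "m \<in> Poly_Mapping.keys P" "v \<in> Poly_Mapping.keys m" for m v
    using assms that by (auto simp: polys_def)
  then show ?thesis
    unfolding eval_at_def by (auto intro!: sum.cong prod.cong)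
qed

lemma Cst_add: "Cst (a + b) = Cst a + Cst b"
  by (simp add: Cst_def single_add)

lemma Cst_mult: "Cst (a * b) = Cst a * Cst b"
  by (simp add: Cst_def mult_single)

lemma Cst_zero [simp]: "Cst 0 = 0"
  by (simp add: Cst_def)

lemma Cst_one [simp]: "Cst 1 = 1"
  by (simp add: Cst_def)

lemma Cst_uminus: "Cst (- a) = - Cst a"
  by (simp add: Cst_def single_uminus)

lemma Cst_diff: "Cst (a - b) = Cst a - Cst b"
  by (simp add: Cst_def single_diff)

lemma Cst_sum: "Cst (sum f A) = (\<Sum>a\<in>A. Cst (f a))"
  by (induction A rule: infinite_finite_induct) (auto simp: Cst_add)

lemma Cst_prod: "Cst (prod f A) = (\<Prod>a\<in>A. Cst (f a))"
  by (induction A rule: infinite_finite_induct) (auto simp: Cst_mult)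

lemma single_eq_Cst_mult: "Poly_Mapping.single m c = Cst c * Poly_Mapping.single m 1"
  by (simp add: Cst_def mult_single)

lemma lookup_Cst_mult [simp]: "Poly_Mapping.lookup (Cst c * P) m = c * Poly_Mapping.lookup P m"
proof -
  have "Cst c * P = (\<Sum>n\<in>Poly_Mapping.keys P. Poly_Mapping.single n (c * Poly_Mapping.lookup P n))"
    by (subst mpoly_expansion[of P]) (simp add: Cst_def sum_distrib_left mult_single)
  then show ?thesis
    by (auto simp: lookup_sum lookup_single when_def in_keys_iff sum.delta)
qed

subsection \<open>Degrees in groups of variables\<close>

text \<open>The variables of one player form a group. The equations have degree at most one in each
  group, so degrees are accounted for group by group.\<close>

definition group_degree :: "(nat \<times> nat \<Rightarrow>\<^sub>0 nat) \<Rightarrow> nat \<Rightarrow> nat" where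
  "group_degree m q = (\<Sum>v\<in>{v\<in>Poly_Mapping.keys m. fst v = q}. Poly_Mapping.lookup m v)"

definition monoms_upto :: "(nat \<times> nat) set \<Rightarrow> (nat \<Rightarrow> nat) \<Rightarrow> (nat \<times> nat \<Rightarrow>\<^sub>0 nat) set" where
  "monoms_upto V d = {m. Poly_Mapping.keys m \<subseteq> V \<and> (\<forall>q. group_degree m q \<le> d q)}"

definition polys_upto :: "(nat \<times> nat) set \<Rightarrow> (nat \<Rightarrow> nat) \<Rightarrow> (nat \<times> nat) mpoly set" where
  "polys_upto V d = {P. Poly_Mapping.keys P \<subseteq> monoms_upto V d}"

lemma group_degree_superset:
  assumes "finite K" "Poly_Mapping.keys m \<subseteq> K"
  shows "group_degree m q = (\<Sum>v\<in>{v\<in>K. fst v = q}. Poly_Mapping.lookup m v)"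
  unfolding group_degree_def
  by (rule sum.mono_neutral_left) (use assms in \<open>auto simp: in_keys_iff\<close>)

lemma group_degree_zero [simp]: "group_degree 0 q = 0"
  by (simp add: group_degree_def)

lemma group_degree_add: "group_degree (m + n) q = group_degree m q + group_degree n q"
proof -
  let ?K = "Poly_Mapping.keys m \<union> Poly_Mapping.keys n"
  have "Poly_Mapping.keys (m + n) \<subseteq> ?K"
    by (rule Poly_Mapping.keys_add)
  then show ?thesis
    by (subst (1 2 3) group_degree_superset[of ?K]) (auto simp: lookup_add sum.distrib)
qed

lemma group_degree_single [simp]:
  "group_degree (Poly_Mapping.single v c) q = (if fst v = q then c else 0)"
proof -
  have "{w. w = v \<and> fst w = q} = (if fst v = q then {v} else {})" by auto
  then show ?thesis
    by (subst group_degree_superset[of "{v}"]) auto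
qed

text \<open>Each exponent is at most the bound of its group. The space of polynomials of bounded
  group degree is thus finite-dimensional, which turns spanning into a matrix condition.\<close>

lemma finite_monoms_upto:
  assumes "finite V"
  shows "finite (monoms_upto V d)"
proof -
  let ?B = "Max (d ` fst ` V)"
  have "Poly_Mapping.lookup m \<in> {f. \<forall>v. (v \<in> V \<longrightarrow> f v \<in> {..?B}) \<and> (v \<notin> V \<longrightarrow> f v = 0)}"
    if m: "m \<in> monoms_upto V d" for m
  proof -
    have "Poly_Mapping.lookup m v \<le> ?B" if v: "v \<in> V" for v
    proof -
      have "Poly_Mapping.lookup m v \<le> group_degree m (fst v)"
        using m v assms unfolding monoms_upto_def
        by (subst group_degree_superset[of V]) (auto intro: member_le_sum)
      also have "\<dots> \<le> d (fst v)" using m by (auto simp: monoms_upto_def)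
      also have "\<dots> \<le> ?B" using v assms by (auto intro: Max_ge)
      finally show ?thesis .
    qed
    moreover have "Poly_Mapping.lookup m v = 0" if "v \<notin> V" for v
      using m that by (auto simp: monoms_upto_def in_keys_iff)
    ultimately show ?thesis by auto
  qed
  moreover have "finite {f. \<forall>v. (v \<in> V \<longrightarrow> f v \<in> {..?B}) \<and> (v \<notin> V \<longrightarrow> f v = (0::nat))}"
    by (rule finite_set_of_finite_funs) (use assms in auto)
  ultimately have "finite (Poly_Mapping.lookup ` monoms_upto V d)"
    by (meson finite_subset image_subsetI)
  then show ?thesis
    by (rule finite_imageD) (auto intro: inj_onI poly_mapping_eqI)
qed

lemma monoms_upto_zero [simp]: "0 \<in> monoms_upto V d"
  by (simp add: monoms_upto_def)

lemma monoms_upto_add: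
  assumes "m \<in> monoms_upto V d" "n \<in> monoms_upto V d'" "\<And>q. d q + d' q \<le> d'' q"
  shows "m + n \<in> monoms_upto V d''"
  using assms Poly_Mapping.keys_add[of m n]
  by (fastforce simp: monoms_upto_def group_degree_add intro: order_trans[OF add_mono])

lemma polys_upto_mono:
  assumes "P \<in> polys_upto V d" "\<And>q. d q \<le> d' q"
  shows "P \<in> polys_upto V d'"
proof -
  have "monoms_upto V d \<subseteq> monoms_upto V d'"
    using assms(2) unfolding monoms_upto_def by (auto intro: order_trans)
  then show ?thesis using assms(1) by (auto simp: polys_upto_def)
qed

lemma polys_upto_polys: "P \<in> polys_upto V d \<Longrightarrow> P \<in> polys V"
  by (auto simp: polys_upto_def polys_def monoms_upto_def)

lemma polys_upto_0 [simp]: "0 \<in> polys_upto V d"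
  by (simp add: polys_upto_def)

lemma polys_upto_add: "P \<in> polys_upto V d \<Longrightarrow> Q \<in> polys_upto V d \<Longrightarrow> P + Q \<in> polys_upto V d"
  using Poly_Mapping.keys_add[of P Q] by (auto simp: polys_upto_def)

lemma polys_upto_uminus: "P \<in> polys_upto V d \<Longrightarrow> - P \<in> polys_upto V d"
  by (auto simp: polys_upto_def in_keys_iff subset_iff)

lemma polys_upto_diff: "P \<in> polys_upto V d \<Longrightarrow> Q \<in> polys_upto V d \<Longrightarrow> P - Q \<in> polys_upto V d"
  using polys_upto_add[of P V d "- Q"] polys_upto_uminus[of Q V d] by simp

lemma polys_upto_sum: "(\<And>a. a \<in> A \<Longrightarrow> f a \<in> polys_upto V d) \<Longrightarrow> sum f A \<in> polys_upto V d"
  by (induction A rule: infinite_finite_induct) (auto intro: polys_upto_add)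

lemma polys_upto_mult:
  assumes "P \<in> polys_upto V d" "Q \<in> polys_upto V d'" "\<And>q. d q + d' q \<le> d'' q"
  shows "P * Q \<in> polys_upto V d''"
  unfolding polys_upto_def
proof (clarify)
  fix x assume "x \<in> Poly_Mapping.keys (P * Q)"
  then obtain m n where "x = m + n" "m \<in> Poly_Mapping.keys P" "n \<in> Poly_Mapping.keys Q"
    using Poly_Mapping.keys_mult[of P Q] by blast
  then show "x \<in> monoms_upto V d''"
    using assms by (auto simp: polys_upto_def intro: monoms_upto_add)
qed

lemma polys_upto_single: "m \<in> monoms_upto V d \<Longrightarrow> Poly_Mapping.single m c \<in> polys_upto V d"
  by (auto simp: polys_upto_def)

lemma polys_upto_Cst: "Cst c \<in> polys_upto V d"
  by (auto simp: Cst_def intro: polys_upto_single)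

lemma polys_upto_one: "1 \<in> polys_upto V d"
  using polys_upto_Cst[of 1] by simp

lemma polys_upto_Var: "v \<in> V \<Longrightarrow> (\<And>q. q = fst v \<Longrightarrow> 1 \<le> d q) \<Longrightarrow> Var v \<in> polys_upto V d"
  unfolding Var_def by (rule polys_upto_single) (auto simp: monoms_upto_def)

lemma polys_upto_Cst_mult: "P \<in> polys_upto V d \<Longrightarrow> Cst c * P \<in> polys_upto V d"
  by (rule polys_upto_mult[OF polys_upto_Cst[of _ _ "\<lambda>_. 0"]]) auto

lemma polys_upto_power:
  assumes "P \<in> polys_upto V (\<lambda>q. c)"
  shows "P ^ n \<in> polys_upto V (\<lambda>q. n * c)"
  by (induction n) (auto intro: polys_upto_one polys_upto_mult[OF assms])

lemma polys_upto_prod: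
  assumes "finite A" "\<And>a. a \<in> A \<Longrightarrow> f a \<in> polys_upto V (d a)"
  shows "prod f A \<in> polys_upto V (\<lambda>q. \<Sum>a\<in>A. d a q)"
  using assms
  by (induction A rule: finite_induct) (auto intro: polys_upto_one polys_upto_mult)

section \<open>Closure of the polynomial ring in the variables \<open>V\<close>\<close>

lemma polys_zero [simp]: "0 \<in> polys V"
  by (simp add: polys_def)

lemma polys_Cst [simp]: "Cst c \<in> polys V"
  by (auto simp: polys_def Cst_def)

lemma polys_one [simp]: "1 \<in> polys V"
  using polys_Cst[of 1 V] by (simp del: polys_Cst)

lemma polys_Var: "v \<in> V \<Longrightarrow> Var v \<in> polys V"
  by (auto simp: polys_def Var_def)

lemma polys_add: "P \<in> polys V \<Longrightarrow> Q \<in> polys V \<Longrightarrow> P + Q \<in> polys V"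
  using Poly_Mapping.keys_add[of P Q] by (auto simp: polys_def)

lemma polys_uminus: "P \<in> polys V \<Longrightarrow> - P \<in> polys V"
  by (auto simp: polys_def in_keys_iff)

lemma polys_diff: "P \<in> polys V \<Longrightarrow> Q \<in> polys V \<Longrightarrow> P - Q \<in> polys V"
  using polys_add[of P V "- Q"] polys_uminus[of Q V] by simp

lemma polys_mult:
  assumes "P \<in> polys V" "Q \<in> polys V"
  shows "P * Q \<in> polys V"
  unfolding polys_def
proof (clarify)
  fix x v assume "x \<in> Poly_Mapping.keys (P * Q)" "v \<in> Poly_Mapping.keys x"
  then obtain m n where "x = m + n" "m \<in> Poly_Mapping.keys P" "n \<in> Poly_Mapping.keys Q"
    using Poly_Mapping.keys_mult[of P Q] by blast
  then show "v \<in> V"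
    using assms \<open>v \<in> _\<close> Poly_Mapping.keys_add[of m n] by (fastforce simp: polys_def)
qed

lemma polys_sum: "(\<And>a. a \<in> A \<Longrightarrow> f a \<in> polys V) \<Longrightarrow> sum f A \<in> polys V"
  by (induction A rule: infinite_finite_induct) (auto intro: polys_add)

lemma polys_prod: "(\<And>a. a \<in> A \<Longrightarrow> f a \<in> polys V) \<Longrightarrow> prod f A \<in> polys V"
  by (induction A rule: infinite_finite_induct) (auto intro: polys_mult)

lemma polys_power: "P \<in> polys V \<Longrightarrow> P ^ n \<in> polys V"
  by (induction n) (auto intro: polys_mult)

section \<open>Polynomial functions\<close>

text \<open>As a class of functions closed under sums and products it lets determinants and
  coefficients be shown polynomial in the table by structural rules. Representing polynomials are
  recovered only for Zariski-open sets.\<close>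

inductive polyfun :: "'v set \<Rightarrow> (('v \<Rightarrow> complex) \<Rightarrow> complex) \<Rightarrow> bool" for I where
  polyfun_const: "polyfun I (\<lambda>u. c)"
| polyfun_coord: "v \<in> I \<Longrightarrow> polyfun I (\<lambda>u. u v)"
| polyfun_add: "polyfun I P \<Longrightarrow> polyfun I Q \<Longrightarrow> polyfun I (\<lambda>u. P u + Q u)"
| polyfun_mult: "polyfun I P \<Longrightarrow> polyfun I Q \<Longrightarrow> polyfun I (\<lambda>u. P u * Q u)"

lemma polyfun_uminus: "polyfun I P \<Longrightarrow> polyfun I (\<lambda>u. - P u)"
  using polyfun_mult[OF polyfun_const[of I "-1"], of P] by simp

lemma polyfun_diff: "polyfun I P \<Longrightarrow> polyfun I Q \<Longrightarrow> polyfun I (\<lambda>u. P u - Q u)"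
  using polyfun_add[OF _ polyfun_uminus, of I P Q] by simp

lemma polyfun_sum: "(\<And>a. a \<in> A \<Longrightarrow> polyfun I (f a)) \<Longrightarrow> polyfun I (\<lambda>u. \<Sum>a\<in>A. f a u)"
  by (induction A rule: infinite_finite_induct) (auto intro: polyfun_const polyfun_add)

lemma polyfun_prod: "(\<And>a. a \<in> A \<Longrightarrow> polyfun I (f a)) \<Longrightarrow> polyfun I (\<lambda>u. \<Prod>a\<in>A. f a u)"
  by (induction A rule: infinite_finite_induct) (auto intro: polyfun_const polyfun_mult)

lemma polyfun_power: "polyfun I P \<Longrightarrow> polyfun I (\<lambda>u. P u ^ n)"
  by (induction n) (auto intro: polyfun_const polyfun_mult)

lemma polyfun_if: "(c \<Longrightarrow> polyfun I P) \<Longrightarrow> (\<not> c \<Longrightarrow> polyfun I Q) \<Longrightarrow> polyfun I (\<lambda>u. if c then P u else Q u)"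
  by (cases c) auto

lemmas polyfun_intros =
  polyfun_const polyfun_coord polyfun_add polyfun_mult polyfun_uminus polyfun_diff polyfun_sum
  polyfun_prod polyfun_power

lemma polyfun_eval_at:
  assumes "P \<in> polys I"
  shows "polyfun I (\<lambda>u. eval_at u P)"
  unfolding eval_at_def
  by (intro polyfun_intros) (use assms in \<open>auto simp: polys_def\<close>)

lemma polyfun_imp_eval_at:
  assumes "polyfun I P"
  obtains p where "p \<in> polys I" "\<And>u. P u = eval_at u p"
proof -
  have "\<exists>p\<in>polys I. \<forall>u. P u = eval_at u p"
    using assms
  proof induction
    case (polyfun_const c)
    show ?case by (rule bexI[of _ "Cst c"]) auto
  next
    case (polyfun_coord v)
    then show ?case by (intro bexI[of _ "Var v"]) (auto intro: polys_Var)
  next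
    case (polyfun_add P Q)
    then show ?case by (metis eval_at_add polys_add)
  next
    case (polyfun_mult P Q)
    then show ?case by (metis eval_at_mult polys_mult)
  qed
  then show ?thesis using that by blast
qed

lemma polyfun_cong:
  assumes "polyfun I P" "\<And>v. v \<in> I \<Longrightarrow> u v = w v"
  shows "P u = P w"
  using assms by (induction) auto

lemma polyfun_tendsto:
  assumes "polyfun I P" "\<And>v. v \<in> I \<Longrightarrow> ((\<lambda>t. c t v) \<longlongrightarrow> w v) F"
  shows "((\<lambda>t. P (c t)) \<longlongrightarrow> P w) F"
  using assms by induction (auto intro!: tendsto_intros)

text \<open>The coefficients in \<open>s\<close> are again polynomial in the direction
  \<open>v\<close>, and the degree bound is uniform in \<open>v\<close>; together this allows the
  direction to vary with the parameter in \<open>polyfun_lowest_order\<close>.\<close>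

lemma polyfun_expand:
  assumes "polyfun I P"
  obtains p :: "('v \<Rightarrow> complex) \<Rightarrow> complex poly" and d
  where "\<And>n. polyfun I (\<lambda>v. coeff (p v) n)" "\<And>v. degree (p v) \<le> d"
        "\<And>s v. P (\<lambda>e. u0 e + s * v e) = poly (p v) s"
proof -
  have "\<exists>p d. (\<forall>n. polyfun I (\<lambda>v. coeff (p v) n)) \<and> (\<forall>v. degree (p v) \<le> d) \<and>
          (\<forall>s v. P (\<lambda>e. u0 e + s * v e) = poly (p v) s)"
    using assms
  proof induction
    case (polyfun_const c)
    show ?case
      by (rule exI[of _ "\<lambda>_. [:c:]"], rule exI[of _ 0]) (auto intro: polyfun.intros)
  next
    case (polyfun_coord e)
    have "polyfun I (\<lambda>v. coeff [:u0 e, v e:] n)" for n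
      by (cases n; cases "n - 1") (auto intro: polyfun.intros polyfun_coord)
    then show ?case
      by (intro exI[of _ "\<lambda>v. [:u0 e, v e:]"] exI[of _ 1]) (auto simp: algebra_simps)
  next
    case (polyfun_add P Q)
    then obtain p d q d' where
      "\<And>n. polyfun I (\<lambda>v. coeff (p v) n)" "\<And>v. degree (p v) \<le> d"
      "\<And>s v. P (\<lambda>e. u0 e + s * v e) = poly (p v) s"
      "\<And>n. polyfun I (\<lambda>v. coeff (q v) n)" "\<And>v. degree (q v) \<le> d'"
      "\<And>s v. Q (\<lambda>e. u0 e + s * v e) = poly (q v) s"
      by blast
    then show ?case
      by (intro exI[of _ "\<lambda>v. p v + q v"] exI[of _ "max d d'"])
         (auto intro!: polyfun.intros(3) intro: order_trans[OF degree_add_le_max max.mono])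
  next
    case (polyfun_mult P Q)
    then obtain p d q d' where
      "\<And>n. polyfun I (\<lambda>v. coeff (p v) n)" "\<And>v. degree (p v) \<le> d"
      "\<And>s v. P (\<lambda>e. u0 e + s * v e) = poly (p v) s"
      "\<And>n. polyfun I (\<lambda>v. coeff (q v) n)" "\<And>v. degree (q v) \<le> d'"
      "\<And>s v. Q (\<lambda>e. u0 e + s * v e) = poly (q v) s"
      by blast
    then show ?case
      by (intro exI[of _ "\<lambda>v. p v * q v"] exI[of _ "d + d'"])
         (auto simp: coeff_mult intro!: polyfun_sum polyfun.intros(4)
           intro: order_trans[OF degree_mult_le add_mono])
  qed
  then show ?thesis using that by blast
qed

text \<open>A nonzero polynomial in one variable has finitely many roots; restrict to a line.\<close>

lemma polyfun_nonzero_common: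
  assumes "polyfun I P" "polyfun I Q" "P u \<noteq> 0" "Q w \<noteq> 0"
  obtains v where "P v \<noteq> 0" "Q v \<noteq> 0"
proof -
  obtain p where p: "\<And>s v. P (\<lambda>e. u e + s * v e) = poly (p v) s"
    by (rule polyfun_expand[OF assms(1), of u]) blast
  obtain q where q: "\<And>s v. Q (\<lambda>e. u e + s * v e) = poly (q v) s"
    by (rule polyfun_expand[OF assms(2), of u]) blast
  define v where "v = (\<lambda>e. w e - u e)"
  have "poly (p v) 0 \<noteq> 0" using assms(3) p[of 0 v] by simp
  moreover have "poly (q v) 1 \<noteq> 0" using assms(4) q[of 1 v] by (simp add: v_def)
  ultimately have "p v * q v \<noteq> 0" by auto
  then have "finite {s. poly (p v * q v) s = 0}" by (rule poly_roots_finite)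
  then obtain s where "poly (p v * q v) s \<noteq> 0"
    using ex_new_if_finite[OF infinite_UNIV_char_0[where 'a=complex]] by blast
  then show ?thesis using that[of "\<lambda>e. u e + s * v e"] by (auto simp: p q)
qed

subsection \<open>Interpolation\<close>

lemma degree_less_if_coeff_zero:
  fixes p :: "'a::comm_semiring_1 poly"
  assumes "\<And>n. n \<ge> d \<Longrightarrow> coeff p n = 0" "p \<noteq> 0"
  shows "degree p < d"
proof (rule ccontr)
  assume "\<not> degree p < d"
  then have "coeff p (degree p) = 0" by (intro assms(1)) simp
  then show False using assms(2) by (simp only: leading_coeff_0_iff)
qed

lemma poly_eq_sum_lt:
  fixes p :: "'a::comm_semiring_1 poly"
  assumes "\<And>n. n \<ge> d \<Longrightarrow> coeff p n = 0"
  shows "poly p x = (\<Sum>j<d. coeff p j * x ^ j)"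
proof -
  have "poly p x = (\<Sum>j\<le>degree p. coeff p j * x ^ j)" by (rule poly_altdef)
  also have "\<dots> = (\<Sum>j<d. coeff p j * x ^ j)"
  proof (cases "p = 0")
    case False
    have "degree p < d" by (rule degree_less_if_coeff_zero[OF assms False])
    then show ?thesis by (intro sum.mono_neutral_left) (auto simp: coeff_eq_0)
  next
    case True
    show ?thesis unfolding True by simp
  qed
  finally show ?thesis .
qed

text \<open>The degree bound is stated on coefficients, so that for empty \<open>Z\<close> it forces
  the zero polynomial, which a bound on \<open>degree\<close> cannot express.\<close>

lemma interpolation_poly:
  fixes f :: "'a::field \<Rightarrow> 'a"
  assumes "finite Z"
  obtains p where "\<And>n. n \<ge> card Z \<Longrightarrow> coeff p n = 0" "\<And>z. z \<in> Z \<Longrightarrow> poly p z = f z"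
proof -
  have "\<exists>p. (\<forall>n\<ge>card Z. coeff p n = 0) \<and> (\<forall>z\<in>Z. poly p z = f z)"
    using assms
  proof (induction Z rule: finite_induct)
    case empty
    show ?case by (rule exI[of _ 0]) auto
  next
    case (insert a Z)
    then obtain p where p: "\<And>n. n \<ge> card Z \<Longrightarrow> coeff p n = 0" "\<And>z. z \<in> Z \<Longrightarrow> poly p z = f z"
      by blast
    \<comment> \<open>Newton's step: \<open>w\<close> vanishes on \<open>Z\<close> but not at
      \<open>a\<close>, so a multiple of it corrects the value at \<open>a\<close> alone.\<close>
    define w where "w = (\<Prod>z\<in>Z. [:-z, 1:])"
    have dw: "degree w = card Z"
      unfolding w_def by (subst degree_prod_eq_sum_degree) auto
    have wz: "poly w z = 0" if "z \<in> Z" for z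
      using that insert by (auto simp: w_def poly_prod)
    have wa: "poly w a \<noteq> 0"
      using insert by (auto simp: w_def poly_prod)
    show ?case
      using p insert wz wa dw
      by (intro exI[of _ "p + smult ((f a - poly p a) / poly w a) w"]) (auto simp: coeff_eq_0)
  qed
  then show ?thesis using that by blast
qed

lemma interpolation_sum:
  fixes f :: "'a::field \<Rightarrow> 'a"
  assumes "finite Z"
  obtains c where "\<And>z. z \<in> Z \<Longrightarrow> (\<Sum>j<card Z. c j * z ^ j) = f z"
proof -
  obtain p where p: "\<And>n. n \<ge> card Z \<Longrightarrow> coeff p n = 0" "\<And>z. z \<in> Z \<Longrightarrow> poly p z = f z"
    by (rule interpolation_poly[OF assms, of f]) blast
  show ?thesis
    by (rule that[of "coeff p"]) (simp add: p(2) flip: poly_eq_sum_lt[OF p(1)])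
qed

lemma poly_zero_if_many_roots:
  fixes p :: "'a::idom poly"
  assumes "\<And>n. n \<ge> card Z \<Longrightarrow> coeff p n = 0" "\<And>z. z \<in> Z \<Longrightarrow> poly p z = 0"
  shows "p = 0"
proof (rule ccontr)
  assume nz: "p \<noteq> 0"
  have "degree p < card Z"
    by (rule degree_less_if_coeff_zero[OF assms(1) nz])
  moreover have "card Z \<le> card {z. poly p z = 0}"
    using assms(2) poly_roots_finite[OF nz] by (intro card_mono) auto
  ultimately show False using card_poly_roots_bound[OF nz] by linarith
qed

lemma sum_powers_zero_if_many_roots:
  fixes c :: "nat \<Rightarrow> 'a::idom"
  assumes "\<And>z. z \<in> Z \<Longrightarrow> (\<Sum>j<card Z. c j * z ^ j) = 0" "j < card Z"
  shows "c j = 0"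
proof -
  let ?p = "\<Sum>j<card Z. Polynomial.monom (c j) j"
  have co: "coeff ?p n = (if n < card Z then c n else 0)" for n
    by (simp add: coeff_sum)
  have "?p = 0"
    by (rule poly_zero_if_many_roots[of Z]) (use assms co in \<open>auto simp: poly_sum poly_monom\<close>)
  then show ?thesis using co[of j] assms(2) by simp
qed

text \<open>The evaluations at the points of \<open>Z\<close> form a basis of the dual of the
  polynomials of degree below \<open>card Z\<close>, so reading off a coefficient is a combination
  of them; the weights are coefficients of the Lagrange basis \<open>B\<close>.\<close>

lemma lagrange_coeff:
  assumes "finite Z" "j < card Z"
  obtains l :: "'a::field \<Rightarrow> 'a" where
    "\<And>p. (\<And>n. n \<ge> card Z \<Longrightarrow> coeff p n = 0) \<Longrightarrow> coeff p j = (\<Sum>z\<in>Z. l z * poly p z)"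
proof -
  have "\<exists>B. (\<forall>n\<ge>card Z. coeff B n = 0) \<and> (\<forall>y\<in>Z. poly B y = (if y = z then 1 else 0))" for z
    by (rule interpolation_poly[OF assms(1), of "\<lambda>y. if y = z then 1 else 0"]) blast
  then have "\<forall>z. \<exists>B. (\<forall>n\<ge>card Z. coeff B n = 0) \<and> (\<forall>y\<in>Z. poly B y = (if y = z then 1 else 0))"
    by blast
  from choice[OF this] obtain B where B: "\<And>z n. n \<ge> card Z \<Longrightarrow> coeff (B z) n = 0"
    "\<And>z y. y \<in> Z \<Longrightarrow> poly (B z) y = (if y = z then 1 else 0)" by blast
  show ?thesis
  proof (rule that[of "\<lambda>z. coeff (B z) j"])
    fix p :: "'a poly" assume p: "\<And>n. n \<ge> card Z \<Longrightarrow> coeff p n = 0"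
    have interp: "(\<Sum>x\<in>Z. poly p x * poly (B x) z) = poly p z" if "z \<in> Z" for z
      using assms(1) that by (simp add: B(2) if_distrib[of "times _"] sum.delta cong: if_cong)
    have "p - (\<Sum>z\<in>Z. smult (poly p z) (B z)) = 0"
      by (rule poly_zero_if_many_roots[of Z])
         (auto simp: coeff_sum poly_sum p B(1) interp)
    then have "coeff p j = coeff (\<Sum>z\<in>Z. smult (poly p z) (B z)) j" by simp
    then show "coeff p j = (\<Sum>z\<in>Z. coeff (B z) j * poly p z)"
      by (simp add: coeff_sum mult.commute)
  qed
qed

subsection \<open>Spanning is an open condition\<close>

lemma polyfun_det:
  assumes "\<And>u. A u \<in> carrier_mat n n" "\<And>i j. i < n \<Longrightarrow> j < n \<Longrightarrow> polyfun I (\<lambda>u. A u $$ (i, j))"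
  shows "polyfun I (\<lambda>u. Determinant.det (A u))"
proof -
  have "Determinant.det (A u) =
     (\<Sum>p\<in>{p. p permutes {0..<n}}. signof p * (\<Prod>i=0..<n. A u $$ (i, p i)))" for u
    by (rule det_def'[OF assms(1)])
  moreover have "p i < n" if "p permutes {0..<n}" "i < n" for p i
    using permutes_in_image[OF that(1), of i] that(2) by simp
  ultimately show ?thesis
    by (simp) (intro polyfun_intros assms(2), auto)
qed

text \<open>Cramer's rule with parameters. The combinations that produce the unit vectors at
  \<open>u0\<close> are kept for all \<open>u\<close>; they form a square matrix \<open>A u\<close>
  that is the identity at \<open>u0\<close>, and the adjugate of \<open>A u\<close> produces its
  determinant times each unit vector, with coefficients polynomial in \<open>u\<close>.\<close>

lemma open_spanning:
  fixes e :: "'i \<Rightarrow> ('v \<Rightarrow> complex) \<Rightarrow> 'y \<Rightarrow> complex"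
  assumes Y: "finite Y" and J: "finite J"
    and e: "\<forall>i\<in>J. \<forall>y\<in>Y. polyfun I (\<lambda>u. e i u y)"
    and span: "\<forall>y\<in>Y. \<exists>c. \<forall>y'\<in>Y. (\<Sum>i\<in>J. c i * e i u0 y') = (if y' = y then 1 else 0)"
  shows "\<exists>d c. polyfun I d \<and> d u0 \<noteq> 0 \<and> (\<forall>y\<in>Y. \<forall>i\<in>J. polyfun I (c y i)) \<and>
    (\<forall>u. \<forall>y\<in>Y. \<forall>y'\<in>Y. (\<Sum>i\<in>J. c y i u * e i u y') = (if y' = y then d u else 0))"
proof -
  define n where "n = card Y"
  obtain f where f: "bij_betw f {0..<n} Y"
    using ex_bij_betw_nat_finite[OF Y] n_def by blast
  define g where "g = inv_into {0..<n} f"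
  have g: "g y < n" "f (g y) = y" if "y \<in> Y" for y
    using that f unfolding g_def bij_betw_def
    by (metis inv_into_into atLeastLessThan_iff, metis f_inv_into_f)
  have f': "f a \<in> Y" "g (f a) = a" if "a < n" for a
    using that f unfolding g_def bij_betw_def by auto
  obtain C where C: "\<And>y y'. y \<in> Y \<Longrightarrow> y' \<in> Y \<Longrightarrow>
      (\<Sum>i\<in>J. C y i * e i u0 y') = (if y' = y then 1 else 0)"
    using span by metis
  define A where "A u = mat n n (\<lambda>(a, b). \<Sum>i\<in>J. C (f a) i * e i u (f b))" for u
  have A[simp]: "A u \<in> carrier_mat n n" for u by (simp add: A_def)
  have dimA[simp]: "dim_row (A u) = n" "dim_col (A u) = n" for u by (simp_all add: A_def)
  have A_pf: "polyfun I (\<lambda>u. A u $$ (a, b))" if "a < n" "b < n" for a b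
    using that by (simp add: A_def) (intro polyfun_intros e[rule_format] f', auto)
  have cof: "polyfun I (\<lambda>u. cofactor (A u) a b)" if ab: "a < n" "b < n" for a b
    unfolding cofactor_def
    by (intro polyfun_intros polyfun_det[where n = "n - 1"])
       (use ab in \<open>auto simp: mat_delete_def intro!: A_pf\<close>)
  have "f a = f b \<longleftrightarrow> a = b" if "a < n" "b < n" for a b
    using f'(2) that by metis
  then have "A u0 = 1\<^sub>m n"
    by (intro eq_matI) (auto simp: A_def C f')
  then have d0: "Determinant.det (A u0) \<noteq> 0" by simp
  define c where "c y i u = (\<Sum>b<n. adj_mat (A u) $$ (g y, b) * C (f b) i)" for y i u
  show ?thesis
  proof (rule exI[of _ "\<lambda>u. Determinant.det (A u)"], rule exI[of _ c], intro conjI ballI allI)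
    show "polyfun I (\<lambda>u. Determinant.det (A u))"
      by (rule polyfun_det[of A n]) (auto intro: A_pf)
    show "polyfun I (c y i)" if "y \<in> Y" "i \<in> J" for y i
      unfolding c_def[abs_def] adj_mat_def using g(1)[OF that(1)]
      by (auto intro!: polyfun_intros cof)
    fix u y y' assume y: "y \<in> Y" "y' \<in> Y"
    have "(\<Sum>i\<in>J. c y i u * e i u y') =
        (\<Sum>b<n. adj_mat (A u) $$ (g y, b) * (\<Sum>i\<in>J. C (f b) i * e i u y'))"
      unfolding c_def sum_distrib_left sum_distrib_right
      by (subst sum.swap) (simp add: mult.assoc)
    also have "\<dots> = (\<Sum>b<n. adj_mat (A u) $$ (g y, b) * A u $$ (b, g y'))"
      using g y by (simp add: A_def)
    also have "\<dots> = (adj_mat (A u) * A u) $$ (g y, g y')"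
      using g y carrier_matD[OF adj_mat(1)[OF A]]
      by (subst index_mult_mat) (auto simp: scalar_prod_def lessThan_atLeast0)
    also have "\<dots> = (Determinant.det (A u) \<cdot>\<^sub>m 1\<^sub>m n) $$ (g y, g y')"
      using adj_mat(3)[OF A] by simp
    also have "\<dots> = (if y' = y then Determinant.det (A u) else 0)"
      using g y by (auto dest: arg_cong[of _ _ f])
    finally show "(\<Sum>i\<in>J. c y i u * e i u y') = (if y' = y then Determinant.det (A u) else 0)" .
  qed (use d0 in auto)
qed

subsection \<open>Independence from curves through nondegenerate points\<close>

text \<open>\<open>r\<close> is the lowest power of \<open>t\<close> that occurs in any
  \<open>P j\<close> along any line through \<open>u0\<close>, and \<open>Q j\<close> is the
  coefficient of that power. After division by \<open>t ^ r\<close> the higher terms vanish in the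
  limit, also when the direction depends on \<open>t\<close>.\<close>

lemma polyfun_lowest_order:
  fixes P :: "nat \<Rightarrow> ('v \<Rightarrow> complex) \<Rightarrow> complex"
  assumes P: "\<forall>j<D. polyfun I (P j)" and nz: "j0 < D" "P j0 w0 \<noteq> 0"
  shows "\<exists>r Q j w. j < D \<and> Q j w \<noteq> (0::complex) \<and>
    (\<forall>j v w. j < D \<longrightarrow> (\<forall>e\<in>I. ((\<lambda>t. v t e) \<longlongrightarrow> w e) (at 0)) \<longrightarrow>
       ((\<lambda>t. P j (\<lambda>e. u0 e + t * v t e) / t ^ r) \<longlongrightarrow> Q j w) (at 0))"
proof -
  have "\<exists>p d. (\<forall>n. polyfun I (\<lambda>v. coeff (p v) n)) \<and> (\<forall>v. degree (p v) \<le> d) \<and>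
          (\<forall>s v. P j (\<lambda>e. u0 e + s * v e) = poly (p v) s)" if "j < D" for j
    by (rule polyfun_expand[OF P[rule_format, OF that], of u0]) blast
  then have "\<forall>j. \<exists>p d. j < D \<longrightarrow> (\<forall>n. polyfun I (\<lambda>v. coeff (p v) n)) \<and> (\<forall>v. degree (p v) \<le> d) \<and>
          (\<forall>s v. P j (\<lambda>e. u0 e + s * v e) = poly (p v) s)"
    by blast
  from choice[OF this] obtain p where "\<forall>j. \<exists>d. j < D \<longrightarrow> (\<forall>n. polyfun I (\<lambda>v. coeff (p j v) n)) \<and>
      (\<forall>v. degree (p j v) \<le> d) \<and> (\<forall>s v. P j (\<lambda>e. u0 e + s * v e) = poly (p j v) s)"
    by (elim exE)
  from choice[OF this] obtain d where pd: "\<forall>j. j < D \<longrightarrow> (\<forall>n. polyfun I (\<lambda>v. coeff (p j v) n)) \<and>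
      (\<forall>v. degree (p j v) \<le> d j) \<and> (\<forall>s v. P j (\<lambda>e. u0 e + s * v e) = poly (p j v) s)"
    by (elim exE)
  then obtain p d where p: "\<And>j n. j < D \<Longrightarrow> polyfun I (\<lambda>v. coeff (p j v) n)"
    "\<And>j v. j < D \<Longrightarrow> degree (p j v) \<le> d j"
    "\<And>j s v. j < D \<Longrightarrow> P j (\<lambda>e. u0 e + s * v e) = poly (p j v) s"
    using pd by blast
  \<comment> \<open>If all coefficients vanished, then so would \<open>P j0\<close> on the line from
    \<open>u0\<close> to \<open>w0\<close>, in particular at parameter 1.\<close>
  have "\<exists>r j v. j < D \<and> coeff (p j v) r \<noteq> 0"
  proof (rule ccontr)
    assume "\<not> ?thesis"
    then have "p j0 v = 0" for v using nz(1) by (auto intro: poly_eqI)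
    then have "poly (p j0 (\<lambda>e. w0 e - u0 e)) 1 = 0" by simp
    then show False using nz by (simp flip: p(3))
  qed
  then obtain r where r: "\<exists>j v. j < D \<and> coeff (p j v) r \<noteq> 0"
    and least: "\<And>n. n < r \<Longrightarrow> \<not> (\<exists>j v. j < D \<and> coeff (p j v) n \<noteq> 0)"
    using exists_least_iff[of "\<lambda>r. \<exists>j v. j < D \<and> coeff (p j v) r \<noteq> 0"] by blast
  from r obtain j w where jw: "j < D" "coeff (p j w) r \<noteq> 0" by blast
  show ?thesis
  proof (rule exI[of _ r], rule exI[of _ "\<lambda>j v. coeff (p j v) r"], rule exI[of _ j],
      rule exI[of _ w], intro conjI allI impI)
    fix j and v :: "complex \<Rightarrow> 'v \<Rightarrow> complex" and w
    assume j: "j < D" and v: "\<forall>e\<in>I. ((\<lambda>t. v t e) \<longlongrightarrow> w e) (at 0)"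
    have eq: "poly (p j (v t)) t / t ^ r = (\<Sum>n\<in>{r..r + d j}. coeff (p j (v t)) n * t ^ (n - r))"
      if t: "t \<noteq> 0" for t
    proof -
      have "poly (p j (v t)) t = (\<Sum>n\<le>r + d j. coeff (p j (v t)) n * t ^ n)"
        by (subst poly_altdef) (intro sum.mono_neutral_left,
          use p(2)[OF j, of "v t"] in \<open>auto simp: coeff_eq_0 not_le\<close>)
      also have "\<dots> = (\<Sum>n\<in>{r..r + d j}. coeff (p j (v t)) n * t ^ n)"
        by (intro sum.mono_neutral_right) (use least j in auto)
      also have "\<dots> = (\<Sum>n\<in>{r..r + d j}. coeff (p j (v t)) n * t ^ (n - r)) * t ^ r"
        unfolding sum_distrib_right
        by (intro sum.cong) (auto simp: mult.assoc simp flip: power_add)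
      finally show ?thesis using t by simp
    qed
    have "((\<lambda>t. \<Sum>n\<in>{r..r + d j}. coeff (p j (v t)) n * t ^ (n - r)) \<longlongrightarrow>
        (\<Sum>n\<in>{r..r + d j}. coeff (p j w) n * 0 ^ (n - r))) (at 0)"
      by (intro tendsto_intros polyfun_tendsto[OF p(1)[OF j]] v[rule_format])
    also have "(\<Sum>n\<in>{r..r + d j}. coeff (p j w) n * 0 ^ (n - r)) = coeff (p j w) r"
      by (subst sum.remove[of _ r]) (auto intro!: sum.neutral simp: power_0_left)
    finally have "((\<lambda>t. poly (p j (v t)) t / t ^ r) \<longlongrightarrow> coeff (p j w) r) (at 0)"
      by (rule Lim_transform_eventually) (auto simp: eventually_at_filter eq)
    then show "((\<lambda>t. P j (\<lambda>e. u0 e + t * v t e) / t ^ r) \<longlongrightarrow> coeff (p j w) r) (at 0)"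
      by (simp add: p(3)[OF j])
  qed (use jw in auto)
qed

text \<open>Dividing the relations by the lowest power of \<open>t\<close> leaves one polynomial of
  degree below \<open>card Z\<close> with all of \<open>Z\<close> as roots, hence zero. The
  direction \<open>w\<close> with a nonzero limit coefficient is only known afterwards, so curves
  are required in every direction.\<close>

lemma curves_imp_independent:
  fixes P :: "nat \<Rightarrow> ('v \<Rightarrow> complex) \<Rightarrow> complex"
  assumes P: "\<And>j. j < card Z \<Longrightarrow> polyfun I (P j)"
    and curve: "\<And>z w. z \<in> Z \<Longrightarrow> \<exists>v x. (\<forall>e\<in>I. ((\<lambda>t. v t e) \<longlongrightarrow> w e) (at 0)) \<and>
      (x \<longlongrightarrow> z) (at 0) \<and> (\<forall>t. (\<Sum>j<card Z. P j (\<lambda>e. u0 e + t * v t e) * x t ^ j) = 0)"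
    and j: "j < card Z"
  shows "P j u = 0"
proof (rule ccontr)
  assume nz: "P j u \<noteq> 0"
  have "\<forall>j<card Z. polyfun I (P j)" using P by blast
  note lo = polyfun_lowest_order[where P = P and D = "card Z" and I = I and ?u0.0 = u0 and ?j0.0 = j
      and ?w0.0 = u, OF this j nz]
  obtain r Q i w where i: "i < card Z" "Q i w \<noteq> (0::complex)" and
    Q: "\<forall>j v w. j < card Z \<longrightarrow> (\<forall>e\<in>I. ((\<lambda>t. v t e) \<longlongrightarrow> w e) (at 0)) \<longrightarrow>
       ((\<lambda>t. P j (\<lambda>e. u0 e + t * v t e) / t ^ r) \<longlongrightarrow> Q j w) (at 0)"
    using lo by (elim exE conjE)
  have "(\<Sum>j<card Z. Q j w * z ^ j) = 0" if z: "z \<in> Z" for z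
  proof -
    obtain v x where v: "\<forall>e\<in>I. ((\<lambda>t. v t e) \<longlongrightarrow> w e) (at 0)" and x: "(x \<longlongrightarrow> z) (at 0)"
      and eq: "\<forall>t. (\<Sum>j<card Z. P j (\<lambda>e. u0 e + t * v t e) * x t ^ j) = 0"
      using curve[OF z, of w] by (elim exE conjE)
    have "((\<lambda>t. \<Sum>j<card Z. (P j (\<lambda>e. u0 e + t * v t e) / t ^ r) * x t ^ j) \<longlongrightarrow>
        (\<Sum>j<card Z. Q j w * z ^ j)) (at 0)"
    proof (rule tendsto_sum, rule tendsto_mult)
      fix j assume "j \<in> {..<card Z}"
      then show "((\<lambda>t. P j (\<lambda>e. u0 e + t * v t e) / t ^ r) \<longlongrightarrow> Q j w) (at 0)"
        using Q v by simp
      show "((\<lambda>t. x t ^ j) \<longlongrightarrow> z ^ j) (at 0)"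
        by (rule tendsto_power[OF x])
    qed
    moreover have "(\<Sum>j<card Z. (P j (\<lambda>e. u0 e + t * v t e) / t ^ r) * x t ^ j) = 0" for t
      using arg_cong[OF eq[rule_format, of t], of "\<lambda>s. s / t ^ r"] by (simp add: sum_divide_distrib)
    ultimately show ?thesis
      by (simp add: tendsto_const_iff)
  qed
  then have "Q i w = 0"
    using sum_powers_zero_if_many_roots[of Z "\<lambda>j. Q j w" i] i(1) by simp
  then show False using i by simp
qed

section \<open>Products of linear forms\<close>

text \<open>Negative integers: a monic polynomial with such roots has positive integer coefficients,
  which puts the special solutions into the torus.\<close>

definition node :: "nat \<times> nat \<Rightarrow> complex" where
  "node e = - of_nat (Suc (prod_encode e))"

lemma node_eq_iff [simp]: "node e = node e' \<longleftrightarrow> e = e'"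
  unfolding node_def by (simp only: neg_equal_iff_equal of_nat_eq_iff) (simp add: prod_encode_eq)

lemma inj_node: "inj_on node A"
  by (auto intro: inj_onI)

text \<open>The value at \<open>c\<close> of the monic polynomial of degree \<open>k q\<close> whose
  lower coefficients are the variables of player \<open>q\<close>; the variable
  \<open>(q, t)\<close> belongs to the power \<open>k q - t\<close>.\<close>

definition lin :: "(nat \<Rightarrow> nat) \<Rightarrow> nat \<Rightarrow> complex \<Rightarrow> (nat \<times> nat) mpoly" where
  "lin k q c = Cst (c ^ k q) + (\<Sum>t = 1..k q. Cst (c ^ (k q - t)) * Var (q, t))"

definition point_poly :: "(nat \<Rightarrow> nat) \<Rightarrow> (nat \<times> nat \<Rightarrow> complex) \<Rightarrow> nat \<Rightarrow> complex poly" where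
  "point_poly k x q = Polynomial.monom 1 (k q) + (\<Sum>t = 1..k q. Polynomial.monom (x (q, t)) (k q - t))"

lemma eval_lin: "eval_at x (lin k q c) = poly (point_poly k x q) c"
  by (simp add: lin_def point_poly_def poly_sum poly_monom mult.commute)

lemma lin_comb:
  "(\<Sum>e\<in>C. Cst (l e) * lin k q (c e)) = Cst (\<Sum>e\<in>C. l e * c e ^ k q) +
     (\<Sum>t = 1..k q. Cst (\<Sum>e\<in>C. l e * c e ^ (k q - t)) * Var (q, t))"
  unfolding lin_def
  by (simp add: ring_distribs sum.distrib sum_distrib_left sum_distrib_right Cst_sum Cst_mult mult.assoc)
     (rule sum.swap)

lemma finite_strat_vars [simp]: "finite (strat_vars N k)"
proof -
  have "strat_vars N k = (SIGMA q:{1..N}. {1..k q})" by (auto simp: strat_vars_def)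
  then show ?thesis by simp
qed

lemma card_strat_vars: "card (strat_vars N k) = (\<Sum>q = 1..N. k q)"
proof -
  have "strat_vars N k = (SIGMA q:{1..N}. {1..k q})" by (auto simp: strat_vars_def)
  then show ?thesis by simp
qed

lemma lin_upto:
  assumes "q \<in> {1..N}"
  shows "lin k q c \<in> polys_upto (strat_vars N k) (\<lambda>q'. if q' = q then 1 else 0)"
  unfolding lin_def
  by (intro polys_upto_add polys_upto_Cst polys_upto_sum polys_upto_Cst_mult polys_upto_Var)
     (use assms in \<open>auto simp: strat_vars_def\<close>)

definition sol_poly :: "(nat \<times> nat) set \<Rightarrow> (nat \<times> nat \<Rightarrow> nat) \<Rightarrow> nat \<Rightarrow> complex poly" where
  "sol_poly V \<sigma> q = (\<Prod>e\<in>{e\<in>V. \<sigma> e = q}. [:- node e, 1:])"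

definition sol :: "nat \<Rightarrow> (nat \<Rightarrow> nat) \<Rightarrow> (nat \<times> nat \<Rightarrow> nat) \<Rightarrow> nat \<times> nat \<Rightarrow> complex" where
  "sol N k \<sigma> = restrict (\<lambda>(q, t). coeff (sol_poly (strat_vars N k) \<sigma> q) (k q - t)) (strat_vars N k)"

text \<open>\<open>strat_vars\<close> also indexes the equations: player \<open>i\<close> has one
  for each \<open>s\<close> in \<open>{1..k i}\<close>. If \<open>A (i, s)\<close> is the set of
  in-neighbours of \<open>i\<close>, the number of balanced assignments is the coefficient of z^k in
  the product over \<open>i\<close> of the \<open>k i\<close>-th powers of the in-neighbour
  sums.\<close>

definition balanced :: "nat \<Rightarrow> (nat \<Rightarrow> nat) \<Rightarrow> (nat \<times> nat \<Rightarrow> nat set) \<Rightarrow> (nat \<times> nat \<Rightarrow> nat) set" where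
  "balanced N k A = {\<sigma> \<in> PiE (strat_vars N k) A.
     \<forall>q\<in>{1..N}. card {e \<in> strat_vars N k. \<sigma> e = q} = k q}"

lemma sol_poly_monic:
  assumes "finite V"
  shows "degree (sol_poly V \<sigma> q) = card {e\<in>V. \<sigma> e = q}"
    "coeff (sol_poly V \<sigma> q) (card {e\<in>V. \<sigma> e = q}) = 1"
proof -
  show d: "degree (sol_poly V \<sigma> q) = card {e\<in>V. \<sigma> e = q}"
    unfolding sol_poly_def by (subst degree_prod_eq_sum_degree) auto
  have "lead_coeff (sol_poly V \<sigma> q) = 1"
    unfolding sol_poly_def by (subst lead_coeff_prod) auto
  then show "coeff (sol_poly V \<sigma> q) (card {e\<in>V. \<sigma> e = q}) = 1" by (simp add: d)
qed

lemma poly_sol_poly_zero_iff: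
  assumes "finite V"
  shows "poly (sol_poly V \<sigma> q) (node e) = 0 \<longleftrightarrow> e \<in> V \<and> \<sigma> e = q"
proof -
  have "poly (sol_poly V \<sigma> q) (node e) = (\<Prod>e'\<in>{e\<in>V. \<sigma> e = q}. node e - node e')"
    by (simp add: sol_poly_def poly_prod)
  then show ?thesis using assms by auto
qed

lemma monic_poly_expansion:
  fixes p :: "'a::comm_ring_1 poly"
  assumes "degree p = n" "coeff p n = 1"
  shows "p = Polynomial.monom 1 n + (\<Sum>t = 1..n. Polynomial.monom (coeff p (n - t)) (n - t))"
proof (rule poly_eqI)
  fix i
  show "coeff p i = coeff (Polynomial.monom 1 n + (\<Sum>t = 1..n. Polynomial.monom (coeff p (n - t)) (n - t))) i"
  proof (cases "i < n")
    case True
    have "(\<Sum>t = 1..n. if n - t = i then coeff p (n - t) else 0) = (\<Sum>t\<in>{n - i}. coeff p (n - t))"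
      by (intro sum.mono_neutral_cong_right) (use True in auto)
    then show ?thesis using True by (simp add: coeff_sum)
  next
    case False
    then have "(\<Sum>t = 1..n. if n - t = i then coeff p (n - t) else 0) = 0"
      by (intro sum.neutral) auto
    then show ?thesis using False assms by (cases "i = n") (auto simp: coeff_sum coeff_eq_0)
  qed
qed

lemma point_poly_sol:
  assumes "q \<in> {1..N}" "card {e\<in>strat_vars N k. \<sigma> e = q} = k q"
  shows "point_poly k (sol N k \<sigma>) q = sol_poly (strat_vars N k) \<sigma> q"
proof -
  let ?p = "sol_poly (strat_vars N k) \<sigma> q"
  have "?p = Polynomial.monom 1 (k q) + (\<Sum>t = 1..k q. Polynomial.monom (coeff ?p (k q - t)) (k q - t))"
    using sol_poly_monic[of "strat_vars N k" \<sigma> q] assms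
    by (intro monic_poly_expansion) auto
  also have "\<dots> = point_poly k (sol N k \<sigma>) q"
    unfolding point_poly_def sol_def
    by (intro arg_cong2[of _ _ _ _ "(+)"] refl sum.cong) (use assms in \<open>auto simp: strat_vars_def\<close>)
  finally show ?thesis ..
qed

text \<open>A monic polynomial with \<open>k q\<close> prescribed nodes as roots has no further
  root, so a solution remembers which equations were assigned to \<open>q\<close>.\<close>

lemma eval_lin_sol:
  assumes "\<sigma> \<in> balanced N k A" "q \<in> {1..N}"
  shows "eval_at (sol N k \<sigma>) (lin k q (node e)) = 0 \<longleftrightarrow> e \<in> strat_vars N k \<and> \<sigma> e = q"
  using assms by (simp add: eval_lin point_poly_sol balanced_def poly_sol_poly_zero_iff)

subsection \<open>The ideal of products of linear forms in bounded degree\<close>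

definition lin_prod :: "(nat \<Rightarrow> nat) \<Rightarrow> (nat \<times> nat \<Rightarrow> nat set) \<Rightarrow> nat \<times> nat \<Rightarrow> (nat \<times> nat) mpoly" where
  "lin_prod k A e = (\<Prod>q\<in>A e. lin k q (node e))"

definition lower :: "(nat \<Rightarrow> nat) \<Rightarrow> nat set \<Rightarrow> nat \<Rightarrow> nat" where
  "lower d A q = d q - (if q \<in> A then 1 else 0)"

text \<open>Cofactors are bounded so that each product \<open>h e * f e\<close> stays within degree
  \<open>d\<close>: a generator of degree one in the groups of \<open>A e\<close> leaves room for
  \<open>d\<close> less one there.\<close>

definition bounded_ideal ::
  "(nat \<times> nat) set \<Rightarrow> (nat \<times> nat \<Rightarrow> nat set) \<Rightarrow> (nat \<times> nat \<Rightarrow> (nat \<times> nat) mpoly) \<Rightarrow> (nat \<Rightarrow> nat) \<Rightarrow>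
   (nat \<times> nat) mpoly set" where
  "bounded_ideal V A f d = {\<Sum>e\<in>V. h e * f e | h. \<forall>e\<in>V. h e \<in> polys_upto V (lower d (A e))}"

lemma bounded_ideal_add:
  assumes "P \<in> bounded_ideal V A f d" "Q \<in> bounded_ideal V A f d"
  shows "P + Q \<in> bounded_ideal V A f d"
proof -
  obtain h where h: "P = (\<Sum>e\<in>V. h e * f e)" "\<forall>e\<in>V. h e \<in> polys_upto V (lower d (A e))"
    using assms(1) unfolding bounded_ideal_def by blast
  obtain h' where h': "Q = (\<Sum>e\<in>V. h' e * f e)" "\<forall>e\<in>V. h' e \<in> polys_upto V (lower d (A e))"
    using assms(2) unfolding bounded_ideal_def by blast
  show ?thesis
    unfolding bounded_ideal_def
    by (rule CollectI, rule exI[of _ "\<lambda>e. h e + h' e"])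
       (use h h' in \<open>auto simp: ring_distribs sum.distrib intro: polys_upto_add\<close>)
qed

lemma bounded_ideal_zero: "0 \<in> bounded_ideal V A f d"
  unfolding bounded_ideal_def by (rule CollectI, rule exI[of _ "\<lambda>e. 0"]) auto

lemma bounded_ideal_Cst_mult:
  assumes "P \<in> bounded_ideal V A f d"
  shows "Cst c * P \<in> bounded_ideal V A f d"
proof -
  obtain h where h: "P = (\<Sum>e\<in>V. h e * f e)" "\<forall>e\<in>V. h e \<in> polys_upto V (lower d (A e))"
    using assms unfolding bounded_ideal_def by blast
  show ?thesis
    unfolding bounded_ideal_def
    by (rule CollectI, rule exI[of _ "\<lambda>e. Cst c * h e"])
       (use h in \<open>auto simp: sum_distrib_left mult.assoc intro: polys_upto_Cst_mult\<close>)
qed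

lemma bounded_ideal_sum:
  "(\<And>a. a \<in> S \<Longrightarrow> P a \<in> bounded_ideal V A f d) \<Longrightarrow> sum P S \<in> bounded_ideal V A f d"
  by (induction S rule: infinite_finite_induct) (auto intro: bounded_ideal_add bounded_ideal_zero)

lemma bounded_ideal_generator:
  assumes "finite V" "e \<in> V" "h \<in> polys_upto V (lower d (A e))"
  shows "h * f e \<in> bounded_ideal V A f d"
proof -
  have "(\<Sum>e'\<in>V. (if e' = e then h else 0) * f e') = h * f e"
    using assms by (subst sum.remove[of _ e]) (auto intro!: sum.neutral)
  then show ?thesis
    unfolding bounded_ideal_def
    by (intro CollectI exI[of _ "\<lambda>e'. if e' = e then h else 0"]) (use assms in auto)
qed

lemma sum_Cst_Var_select:
  fixes t n :: nat
  assumes "t \<in> {1..n}" "\<And>t'. t' \<in> {1..n} \<Longrightarrow> c t' = (if n - t' = n - t then 1 else 0)"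
  shows "(\<Sum>t' = 1..n. Cst (c t') * Var (q, t')) = Var (q, t)"
proof -
  have "(\<Sum>t' = 1..n. Cst (c t') * Var (q, t')) = (\<Sum>t' = 1..n. if t' = t then Var (q, t) else 0)"
    by (intro sum.cong refl) (use assms in auto)
  then show ?thesis using assms(1) by simp
qed

text \<open>With more than \<open>k q\<close> nodes the values determine all coefficients of a
  polynomial of degree at most \<open>k q\<close>, the leading one included. For the monic
  polynomial of player \<open>q\<close> that coefficient is 1, so the forms generate the constants
  and have no common zero.\<close>

lemma all_lin_coeffs:
  assumes "finite C" "k q < card C"
  shows "\<exists>l. (\<Sum>e\<in>C. Cst (l e) * lin k q (node e)) = 1"
    and "\<And>t. t \<in> {1..k q} \<Longrightarrow> \<exists>l. (\<Sum>e\<in>C. Cst (l e) * lin k q (node e)) = Var (q, t)"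
proof -
  let ?Z = "node ` C"
  have cZ: "card ?Z = card C" by (rule card_image[OF inj_node])
  have *: "\<exists>l. \<forall>i\<le>k q. (\<Sum>e\<in>C. l e * node e ^ i) = (if i = j then 1 else 0)" if j: "j \<le> k q" for j
  proof -
    obtain l where l: "\<And>p. (\<And>n. n \<ge> card ?Z \<Longrightarrow> coeff p n = 0) \<Longrightarrow> coeff p j = (\<Sum>z\<in>?Z. l z * poly p z)"
      using j assms by (rule_tac lagrange_coeff[of ?Z j]) (auto simp: cZ)
    have "(\<Sum>e\<in>C. l (node e) * node e ^ i) = (if i = j then 1 else 0)" if "i \<le> k q" for i
    proof -
      have "(if i = j then 1 else 0) = coeff (Polynomial.monom (1::complex) i) j" by simp
      also have "\<dots> = (\<Sum>z\<in>?Z. l z * z ^ i)"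
        by (subst l) (use that assms in \<open>auto simp: cZ poly_monom\<close>)
      finally show ?thesis by (simp add: sum.reindex[OF inj_node] o_def)
    qed
    then show ?thesis by (intro exI[of _ "\<lambda>e. l (node e)"]) blast
  qed
  show "\<exists>l. (\<Sum>e\<in>C. Cst (l e) * lin k q (node e)) = Var (q, t)" if t: "t \<in> {1..k q}" for t
  proof -
    from *[of "k q - t"] obtain l where l: "\<forall>i\<le>k q. (\<Sum>e\<in>C. l e * node e ^ i) = (if i = k q - t then 1 else 0)"
      by auto
    have "(\<Sum>t'=1..k q. Cst (\<Sum>e\<in>C. l e * node e ^ (k q - t')) * Var (q, t')) = Var (q, t)"
      using t l by (intro sum_Cst_Var_select) auto
    moreover have "k q \<noteq> k q - t" using t by auto
    ultimately have "(\<Sum>e\<in>C. Cst (l e) * lin k q (node e)) = Var (q, t)"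
      unfolding lin_comb using l by simp
    then show ?thesis by blast
  qed
  from *[of "k q"] obtain l where l: "\<forall>i\<le>k q. (\<Sum>e\<in>C. l e * node e ^ i) = (if i = k q then 1 else 0)"
    by auto
  have "(\<Sum>e\<in>C. Cst (l e) * lin k q (node e)) = 1"
    unfolding lin_comb using l by (auto intro!: sum.neutral)
  then show "\<exists>l. (\<Sum>e\<in>C. Cst (l e) * lin k q (node e)) = 1" by blast
qed

text \<open>With exactly \<open>k q\<close> nodes the leading coefficient cannot be read off. But
  the variable monic polynomial minus \<open>sol_poly\<close> has degree below \<open>k q\<close>,
  and its values at the nodes are the forms, so its coefficients are combinations of them.\<close>

lemma lin_coeffs:
  assumes "finite V" "C = {e\<in>V. \<sigma> e = q}" "k q = card C" "t \<in> {1..k q}"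
  shows "\<exists>l. (\<Sum>e\<in>C. Cst (l e) * lin k q (node e)) =
    Var (q, t) - Cst (coeff (sol_poly V \<sigma> q) (k q - t))"
proof -
  let ?Z = "node ` C" and ?w = "sol_poly V \<sigma> q"
  have fin: "finite C" using assms by auto
  have cZ: "card ?Z = k q" using card_image[OF inj_node, of C] assms by simp
  obtain l where l: "\<And>p. (\<And>n. n \<ge> card ?Z \<Longrightarrow> coeff p n = 0) \<Longrightarrow> coeff p (k q - t) = (\<Sum>z\<in>?Z. l z * poly p z)"
    using fin assms(4) by (rule_tac lagrange_coeff[of ?Z "k q - t"]) (auto simp: cZ)
  have 1: "(\<Sum>e\<in>C. l (node e) * node e ^ i) = (if i = k q - t then 1 else 0)" if "i < k q" for i
  proof -
    have "(if i = k q - t then 1 else 0) = coeff (Polynomial.monom (1::complex) i) (k q - t)" by simp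
    also have "\<dots> = (\<Sum>z\<in>?Z. l z * z ^ i)"
      by (subst l) (use that in \<open>auto simp: cZ poly_monom\<close>)
    finally show ?thesis by (simp add: sum.reindex[OF inj_node] o_def)
  qed
  \<comment> \<open>The weights are applied to the power \<open>k q\<close> minus \<open>?w\<close>,
    which has degree below \<open>k q\<close> and agrees with that power at the nodes.\<close>
  have 2: "(\<Sum>e\<in>C. l (node e) * node e ^ k q) = - coeff ?w (k q - t)"
  proof -
    let ?p = "Polynomial.monom 1 (k q) - ?w"
    have "coeff ?p n = 0" if "n \<ge> k q" for n
      using that sol_poly_monic[OF assms(1), of \<sigma> q] assms
      by (cases "n = k q") (auto simp: coeff_eq_0)
    then have "coeff ?p (k q - t) = (\<Sum>z\<in>?Z. l z * poly ?p z)"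
      by (intro l) (auto simp: cZ)
    also have "\<dots> = (\<Sum>z\<in>?Z. l z * z ^ k q)"
    proof (intro sum.cong refl)
      fix z assume "z \<in> ?Z"
      then have "poly ?w z = 0"
        using poly_sol_poly_zero_iff[OF assms(1), of \<sigma> q] assms(2) by auto
      then show "l z * poly ?p z = l z * z ^ k q" by (simp add: poly_monom)
    qed
    finally show ?thesis
      using assms(4) by (simp add: sum.reindex[OF inj_node] o_def split: if_splits)
  qed
  have "(\<Sum>t'=1..k q. Cst (\<Sum>e\<in>C. l (node e) * node e ^ (k q - t')) * Var (q, t')) = Var (q, t)"
    using assms(4) 1 by (intro sum_Cst_Var_select) auto
  then have "(\<Sum>e\<in>C. Cst (l (node e)) * lin k q (node e)) = Var (q, t) - Cst (coeff ?w (k q - t))"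
    unfolding lin_comb using 2 by (simp add: Cst_uminus)
  then show ?thesis by (rule exI[of _ "\<lambda>e. l (node e)"])
qed

lemma finite_balanced: "(\<And>e. e \<in> strat_vars N k \<Longrightarrow> finite (A e)) \<Longrightarrow> finite (balanced N k A)"
  unfolding balanced_def by (rule finite_subset[OF _ finite_PiE[of "strat_vars N k" A]]) auto

text \<open>One variable v with value c is split off at a time: m' v - c' c = m' (v - c) + c (m' -
  c'). The first summand is admissible because m' has lost one degree in the group of v.\<close>

lemma monom_minus_value_in_ideal:
  assumes V: "V = strat_vars N k" and m: "m \<in> monoms_upto V d" and d: "\<And>q. 1 \<le> d q"
    and gen: "\<And>h q t. (q, t) \<in> V \<Longrightarrow> h \<in> polys_upto V (lower d {q}) \<Longrightarrow>
       h * (Var (q, t) - Cst (p (q, t))) \<in> bounded_ideal V A f d"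
  shows "Poly_Mapping.single m 1 - Cst (monom_at p m) \<in> bounded_ideal V A f d"
  using m
proof (induction "sum (Poly_Mapping.lookup m) V" arbitrary: m)
  case 0
  have "m = 0"
  proof (rule poly_mapping_eqI)
    fix v show "Poly_Mapping.lookup m v = Poly_Mapping.lookup 0 v"
      using 0 V by (cases "v \<in> V") (auto simp: monoms_upto_def in_keys_iff)
  qed
  then show ?case by (simp add: bounded_ideal_zero)
next
  case (Suc n)
  have "\<not> (\<forall>v\<in>V. Poly_Mapping.lookup m v = 0)"
  proof
    assume "\<forall>v\<in>V. Poly_Mapping.lookup m v = 0"
    then have "sum (Poly_Mapping.lookup m) V = 0" by (simp add: sum.neutral)
    then show False using Suc.hyps(2) by simp
  qed
  then obtain v where v: "v \<in> V" "Poly_Mapping.lookup m v \<noteq> 0"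
    by auto
  define s where "s = Poly_Mapping.single v (1::nat)"
  define m' where "m' = m - s"
  have m: "m = m' + s"
    by (rule poly_mapping_eqI) (use v in \<open>auto simp: m'_def s_def lookup_add lookup_minus lookup_single when_def\<close>)
  have m': "m' \<in> monoms_upto V (lower d {fst v})"
    unfolding monoms_upto_def
  proof (intro CollectI conjI allI)
    have "Poly_Mapping.keys m' \<subseteq> Poly_Mapping.keys m"
      by (auto simp: in_keys_iff m lookup_add)
    then show "Poly_Mapping.keys m' \<subseteq> V" using Suc.prems by (auto simp: monoms_upto_def)
    fix q
    have "group_degree m q \<le> d q" using Suc.prems by (auto simp: monoms_upto_def)
    then show "group_degree m' q \<le> lower d {fst v} q"
      by (auto simp: m group_degree_add s_def lower_def split: if_splits)
  qed
  have "sum (Poly_Mapping.lookup m) V = sum (Poly_Mapping.lookup m') V + sum (Poly_Mapping.lookup s) V"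
    by (simp add: m lookup_add sum.distrib)
  also have "sum (Poly_Mapping.lookup s) V = 1"
    using v V by (simp add: s_def lookup_single when_def)
  finally have "n = sum (Poly_Mapping.lookup m') V" using Suc.hyps(2) by simp
  moreover have "m' \<in> monoms_upto V d"
    using m' unfolding monoms_upto_def lower_def by (force split: if_splits)
  ultimately have IH: "Poly_Mapping.single m' 1 - Cst (monom_at p m') \<in> bounded_ideal V A f d"
    using Suc.hyps(1) by blast
  obtain q t where qt: "v = (q, t)" by (cases v)
  have "Poly_Mapping.single m 1 - Cst (monom_at p m) =
    Poly_Mapping.single m' 1 * (Var (q, t) - Cst (p (q, t))) +
    Cst (p (q, t)) * (Poly_Mapping.single m' 1 - Cst (monom_at p m'))"
  proof -
    have "Poly_Mapping.single m (1::complex) = Poly_Mapping.single m' 1 * Var v"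
      by (simp add: m Var_def mult_single s_def)
    moreover have "monom_at p m = monom_at p m' * p v"
      by (simp add: m monom_at_add s_def) (simp add: monom_at_def)
    ultimately show ?thesis by (simp add: qt Cst_mult algebra_simps)
  qed
  also have "\<dots> \<in> bounded_ideal V A f d"
    using gen[of q t "Poly_Mapping.single m' 1"] v m' qt IH
    by (intro bounded_ideal_add bounded_ideal_Cst_mult) (auto intro: polys_upto_single)
  finally show ?case .
qed

lemma in_ideal_if_monoms:
  assumes "P \<in> polys_upto V d"
    "\<And>m. m \<in> monoms_upto V d \<Longrightarrow> Poly_Mapping.single m 1 \<in> bounded_ideal V A f d"
  shows "P \<in> bounded_ideal V A f d"
proof -
  have "P = (\<Sum>m\<in>Poly_Mapping.keys P. Cst (Poly_Mapping.lookup P m) * Poly_Mapping.single m 1)"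
    by (subst mpoly_expansion[of P]) (simp flip: single_eq_Cst_mult)
  also have "\<dots> \<in> bounded_ideal V A f d"
    by (intro bounded_ideal_sum bounded_ideal_Cst_mult assms(2)) (use assms(1) in \<open>auto simp: polys_upto_def\<close>)
  finally show ?thesis .
qed

lemma bounded_ideal_const_diff:
  assumes "P \<in> polys_upto V d"
    "\<And>m. m \<in> monoms_upto V d \<Longrightarrow>
       Poly_Mapping.single m 1 - Cst (monom_at p m) \<in> bounded_ideal V A f d"
  shows "P - Cst (eval_at p P) \<in> bounded_ideal V A f d"
proof -
  have "P - Cst (eval_at p P) = (\<Sum>m\<in>Poly_Mapping.keys P. Cst (Poly_Mapping.lookup P m) *
      (Poly_Mapping.single m 1 - Cst (monom_at p m)))"
    by (subst (1) mpoly_expansion[of P])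
       (simp add: eval_at_superset[OF _ order_refl] right_diff_distrib sum_subtractf Cst_sum Cst_mult
         flip: single_eq_Cst_mult)
  also have "\<dots> \<in> bounded_ideal V A f d"
    by (intro bounded_ideal_sum bounded_ideal_Cst_mult assms(2)) (use assms(1) in \<open>auto simp: polys_upto_def\<close>)
  finally show ?thesis .
qed

text \<open>The base of the induction below: every generator is a single linear form, so that the
  linear forms either have one common zero or span all linear forms of some group.\<close>

lemma singletons_in_ideal:
  assumes V: "V = strat_vars N k" and A: "\<And>e. e \<in> V \<Longrightarrow> A e = {\<sigma> e}"
    and \<sigma>: "\<sigma> \<in> extensional V" "\<And>e. e \<in> V \<Longrightarrow> \<sigma> e \<in> {1..N}"
    and d: "\<And>q. 1 \<le> d q" and P: "P \<in> polys_upto V d"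
    and zero: "\<And>\<tau>. \<tau> \<in> balanced N k A \<Longrightarrow> eval_at (sol N k \<tau>) P = 0"
  shows "P \<in> bounded_ideal V A (lin_prod k A) d"
proof -
  let ?C = "\<lambda>q. {e\<in>V. \<sigma> e = q}"
  let ?I = "bounded_ideal V A (lin_prod k A) d"
  have fin: "finite V" by (simp add: V)
  have comb: "h * (\<Sum>e\<in>?C q. Cst (l e) * lin k q (node e)) \<in> ?I"
    if h: "h \<in> polys_upto V (lower d {q})" for h q l
  proof -
    have "Cst (l e) * h * lin_prod k A e \<in> ?I" if "e \<in> ?C q" for e
      by (rule bounded_ideal_generator) (use fin h that A in \<open>auto intro: polys_upto_Cst_mult\<close>)
    then have "(\<Sum>e\<in>?C q. Cst (l e) * h * lin_prod k A e) \<in> ?I"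
      by (rule bounded_ideal_sum)
    also have "(\<Sum>e\<in>?C q. Cst (l e) * h * lin_prod k A e) = h * (\<Sum>e\<in>?C q. Cst (l e) * lin k q (node e))"
      by (auto simp: sum_distrib_left lin_prod_def A mult_ac intro!: sum.cong)
    finally show ?thesis .
  qed
  show ?thesis
  proof (cases "\<forall>q\<in>{1..N}. card (?C q) = k q")
    \<comment> \<open>There is exactly one balanced assignment, and modulo the ideal every variable
      equals its coordinate at that solution.\<close>
    case True
    have bal: "\<sigma> \<in> balanced N k A"
      using True \<sigma> A by (auto simp: balanced_def V PiE_def)
    have "h * (Var (q, t) - Cst (sol N k \<sigma> (q, t))) \<in> ?I"
      if qt: "(q, t) \<in> V" and h: "h \<in> polys_upto V (lower d {q})" for h q t
    proof -
      have "q \<in> {1..N}" "t \<in> {1..k q}" using qt V by (auto simp: strat_vars_def)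
      moreover from this True have "k q = card (?C q)" by simp
      ultimately obtain l where "(\<Sum>e\<in>?C q. Cst (l e) * lin k q (node e)) =
          Var (q, t) - Cst (coeff (sol_poly V \<sigma> q) (k q - t))"
        using lin_coeffs[OF fin refl, of k q \<sigma> t] by auto
      moreover have "sol N k \<sigma> (q, t) = coeff (sol_poly V \<sigma> q) (k q - t)"
        using qt V by (simp add: sol_def)
      ultimately show ?thesis using comb[OF h, of l] by simp
    qed
    then have "P - Cst (eval_at (sol N k \<sigma>) P) \<in> ?I"
      by (intro bounded_ideal_const_diff P monom_minus_value_in_ideal[OF V] d)
    then show ?thesis using zero[OF bal] by simp
  next
    case False
    \<comment> \<open>There are as many equations as variables, so if the counts differ from
      \<open>k\<close>, some player receives too many equations.\<close>
    have "\<exists>q\<in>{1..N}. k q < card (?C q)"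
    proof (rule ccontr)
      assume "\<not> ?thesis"
      then have le: "\<And>q. q \<in> {1..N} \<Longrightarrow> card (?C q) \<le> k q" by force
      with False obtain q0 where q0: "q0 \<in> {1..N}" "card (?C q0) < k q0"
        using le by force
      have "(\<Sum>q\<in>{1..N}. card (?C q)) < (\<Sum>q\<in>{1..N}. k q)"
        by (rule sum_strict_mono_ex1) (use le q0 in auto)
      moreover have "card V = (\<Sum>q\<in>{1..N}. card (?C q))"
        by (subst card_eq_sum, subst sum.group[symmetric, of V "{1..N}" \<sigma>]) (use fin \<sigma> in auto)
      ultimately show False using card_strat_vars[of N k] V by simp
    qed
    then obtain q where q: "q \<in> {1..N}" "k q < card (?C q)" by blast
    show ?thesis
    proof (rule in_ideal_if_monoms[OF P])
      fix m assume m: "m \<in> monoms_upto V d"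
      have finC: "finite (?C q)" using fin by auto
      obtain l where l: "(\<Sum>e\<in>?C q. Cst (l e) * lin k q (node e)) = 1"
        and lV: "\<And>t. t \<in> {1..k q} \<Longrightarrow> \<exists>l. (\<Sum>e\<in>?C q. Cst (l e) * lin k q (node e)) = Var (q, t)"
        using all_lin_coeffs[where C = "?C q" and k = k and q = q, OF finC q(2)] by blast
      show "Poly_Mapping.single m 1 \<in> ?I"
      \<comment> \<open>A cofactor must leave one degree of group \<open>q\<close> free. A monomial
        without variables of this group does so and is paired with the relation for 1; otherwise one
        such variable is split off and produced by its own relation.\<close>
      proof (cases "group_degree m q = 0")
        case True
        then have "m \<in> monoms_upto V (lower d {q})"
          using m by (auto simp: monoms_upto_def lower_def)
        then show ?thesis
          using comb[OF polys_upto_single, of m q 1 l] l by simp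
      next
        case False
        then obtain v where v: "v \<in> Poly_Mapping.keys m" "fst v = q"
          unfolding group_degree_def by (auto simp: in_keys_iff)
        then have "v \<in> V" using m by (auto simp: monoms_upto_def)
        then obtain t where t: "v = (q, t)" "t \<in> {1..k q}"
          using v V by (cases v) (auto simp: strat_vars_def)
        define s where "s = Poly_Mapping.single v (1::nat)"
        define m' where "m' = m - s"
        have mm': "m = m' + s"
          by (rule poly_mapping_eqI)
             (use v in \<open>auto simp: m'_def s_def lookup_add lookup_minus lookup_single when_def in_keys_iff\<close>)
        have "m' \<in> monoms_upto V (lower d {q})"
          unfolding monoms_upto_def
        proof (intro CollectI conjI allI)
          have "Poly_Mapping.keys m' \<subseteq> Poly_Mapping.keys m"
            by (auto simp: in_keys_iff mm' lookup_add)
          then show "Poly_Mapping.keys m' \<subseteq> V" using m by (auto simp: monoms_upto_def)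
          fix q'
          have "group_degree m q' \<le> d q'" using m by (auto simp: monoms_upto_def)
          then show "group_degree m' q' \<le> lower d {q} q'"
            using v by (auto simp: mm' group_degree_add s_def lower_def split: if_splits)
        qed
        moreover obtain lt where lt: "(\<Sum>e\<in>?C q. Cst (lt e) * lin k q (node e)) = Var (q, t)"
          using lV[OF t(2)] by blast
        ultimately have "Poly_Mapping.single m' 1 * Var (q, t) \<in> ?I"
          using comb[OF polys_upto_single, of m' q 1 lt] lt by simp
        then show ?thesis by (simp add: mm' Var_def mult_single s_def t)
      qed
    qed
  qed
qed

text \<open>Induction that splits one factor off one generator. If \<open>A e0\<close> consists of
  \<open>q\<close> and \<open>A'\<close>, the solutions are those for \<open>{q}\<close> and those
  for \<open>A'\<close>. The first ideal expresses \<open>P\<close> with a cofactor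
  \<open>h e0\<close> of the form for \<open>q\<close>; this form vanishes at no solution of the
  second kind, so \<open>h e0\<close> vanishes there and the induction applies to it. Each split
  costs at most one degree, which the sizes of the sets in the bound on \<open>d\<close> pay
  for.\<close>

lemma vanishing_imp_in_ideal:
  assumes V: "V = strat_vars N k" and A: "\<And>e. e \<in> V \<Longrightarrow> A e \<subseteq> {1..N}"
    and d: "\<And>q. 1 + (\<Sum>e\<in>V. card (A e)) \<le> d q" and P: "P \<in> polys_upto V d"
    and zero: "\<And>\<tau>. \<tau> \<in> balanced N k A \<Longrightarrow> eval_at (sol N k \<tau>) P = 0"
  shows "P \<in> bounded_ideal V A (lin_prod k A) d"
  using A d P zero
proof (induction "\<Sum>e\<in>V. card (A e)" arbitrary: A d P rule: less_induct)
  case less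
  have fin: "finite V" by (simp add: V)
  have finA: "finite (A e)" if "e \<in> V" for e using less.prems(1)[OF that] by (rule finite_subset) simp
  show ?case
  proof (cases "\<exists>e\<in>V. A e = {}")
    \<comment> \<open>The generator is an empty product, hence 1.\<close>
    case True
    then obtain e where e: "e \<in> V" "A e = {}" by blast
    then have "P * lin_prod k A e \<in> bounded_ideal V A (lin_prod k A) d"
      using fin less.prems(3) by (intro bounded_ideal_generator) (auto simp: lower_def[abs_def])
    then show ?thesis using e by (simp add: lin_prod_def)
  next
    case nonempty: False
    show ?thesis
    proof (cases "\<forall>e\<in>V. \<exists>q. A e = {q}")
      case True
      define \<sigma> where "\<sigma> = restrict (\<lambda>e. SOME q. A e = {q}) V"
      have \<sigma>: "A e = {\<sigma> e}" if "e \<in> V" for e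
        using True that someI_ex[of "\<lambda>q. A e = {q}"] by (auto simp: \<sigma>_def)
      have d1: "1 \<le> d q" for q using less.prems(2)[of q] by simp
      show ?thesis
      proof (rule singletons_in_ideal[OF V \<sigma> _ _ d1 less.prems(3,4)])
        show "\<sigma> \<in> extensional V" by (simp add: \<sigma>_def)
        show "\<sigma> e \<in> {1..N}" if "e \<in> V" for e
          using less.prems(1)[OF that] \<sigma>[OF that] by simp
      qed auto
    next
      case False
      then obtain e0 where e0: "e0 \<in> V" "\<nexists>q. A e0 = {q}" by blast
      with nonempty obtain q where q: "q \<in> A e0" by blast
      define A' where "A' = A e0 - {q}"
      have A': "A e0 = insert q A'" "q \<notin> A'" "A' \<noteq> {}"
        using e0(2) q by (auto simp: A'_def)
      have finA': "finite A'" using finA[OF e0(1)] by (simp add: A'_def)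
      have cardA: "card (A e0) = Suc (card A')" using A' finA' by simp
      have cardA'1: "card A' \<ge> 1" using A' finA' by (simp add: Suc_leI card_gt_0_iff)
      let ?A1 = "A(e0 := {q})" and ?A2 = "A(e0 := A')"
      have split: "(\<Sum>e\<in>V. card (B e)) = card (B e0) + (\<Sum>e\<in>V - {e0}. card (B e))"
        for B :: "nat \<times> nat \<Rightarrow> nat set"
        using e0(1) fin by (simp add: sum.remove)
      have rest: "(\<Sum>e\<in>V - {e0}. card ((A(e0 := X)) e)) = (\<Sum>e\<in>V - {e0}. card (A e))" for X
        by (intro sum.cong) auto
      have sums: "(\<Sum>e\<in>V. card (?A1 e)) = 1 + (\<Sum>e\<in>V - {e0}. card (A e))"
        "(\<Sum>e\<in>V. card (?A2 e)) = card A' + (\<Sum>e\<in>V - {e0}. card (A e))"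
        "(\<Sum>e\<in>V. card (A e)) = Suc (card A') + (\<Sum>e\<in>V - {e0}. card (A e))"
        unfolding split[of ?A1] split[of ?A2] split[of A] rest by (simp_all add: cardA)
      have sum1: "(\<Sum>e\<in>V. card (?A1 e)) < (\<Sum>e\<in>V. card (A e))"
        and sum2: "(\<Sum>e\<in>V. card (?A2 e)) < (\<Sum>e\<in>V. card (A e))"
        and sum3: "2 \<le> (\<Sum>e\<in>V. card (A e))"
        using cardA'1 unfolding sums by linarith+
      have q1N: "q \<in> {1..N}" and A'N: "A' \<subseteq> {1..N}"
        using less.prems(1)[OF e0(1)] A'(1) by auto
      have "P \<in> bounded_ideal V ?A1 (lin_prod k ?A1) d"
      proof (rule less.hyps[OF sum1 _ _ less.prems(3)])
        show "?A1 e \<subseteq> {1..N}" if "e \<in> V" for e using less.prems(1)[OF that] q1N by auto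
        show "1 + (\<Sum>e\<in>V. card (?A1 e)) \<le> d q" for q
          using less.prems(2)[of q] sum1 by linarith
        show "eval_at (sol N k \<tau>) P = 0" if "\<tau> \<in> balanced N k ?A1" for \<tau>
        proof (rule less.prems(4))
          show "\<tau> \<in> balanced N k A"
            using that e0(1) q unfolding balanced_def V PiE_def Pi_def by (auto split: if_splits)
        qed
      qed
      then obtain h where h: "P = (\<Sum>e\<in>V. h e * lin_prod k ?A1 e)"
        "\<forall>e\<in>V. h e \<in> polys_upto V (lower d (?A1 e))"
        unfolding bounded_ideal_def by blast
      have other: "lin_prod k (A(e0 := X)) e = lin_prod k A e" if "e \<noteq> e0" for e X
        using that by (simp add: lin_prod_def)
      have P_eq: "P = h e0 * lin k q (node e0) + (\<Sum>e\<in>V - {e0}. h e * lin_prod k A e)"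
        unfolding h(1) using e0(1) fin
        by (subst sum.remove[of _ e0]) (auto simp: lin_prod_def)
      have "h e0 \<in> bounded_ideal V ?A2 (lin_prod k ?A2) (lower d {q})"
      proof (rule less.hyps[OF sum2])
        show "?A2 e \<subseteq> {1..N}" if "e \<in> V" for e using less.prems(1)[OF that] A'N by auto
        show "1 + (\<Sum>e\<in>V. card (?A2 e)) \<le> lower d {q} q'" for q'
        proof -
          have "d q' \<le> lower d {q} q' + 1" by (auto simp: lower_def)
          then show ?thesis using less.prems(2)[of q'] sum2 by linarith
        qed
        show "h e0 \<in> polys_upto V (lower d {q})"
          using h(2) e0(1) by auto
        fix \<tau> assume \<tau>: "\<tau> \<in> balanced N k ?A2"
        have \<tau>A: "\<tau> e \<in> ?A2 e" if "e \<in> V" for e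
          using \<tau> that unfolding balanced_def V by (blast intro: PiE_mem)
        have balA: "\<tau> \<in> balanced N k A"
          using \<tau> e0(1) A'(1) unfolding balanced_def V PiE_def Pi_def by (auto split: if_splits)
        have "eval_at (sol N k \<tau>) (lin_prod k A e) = 0" if e: "e \<in> V - {e0}" for e
        proof -
          have "\<tau> e \<in> A e" "\<tau> e \<in> {1..N}"
            using \<tau>A[of e] e less.prems(1)[of e] by auto
          then have "eval_at (sol N k \<tau>) (lin k (\<tau> e) (node e)) = 0"
            using eval_lin_sol[OF \<tau>, of "\<tau> e" e] e V by simp
          then show ?thesis
            unfolding lin_prod_def eval_at_prod
            using finA[of e] e \<open>\<tau> e \<in> A e\<close> by (intro prod_zero) auto
        qed
        \<comment> \<open>At a solution for \<open>A'\<close> all generators except the one at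
          \<open>e0\<close> vanish, so only the term of \<open>h e0\<close> survives.\<close>
        then have "eval_at (sol N k \<tau>) P = eval_at (sol N k \<tau>) (h e0) * eval_at (sol N k \<tau>) (lin k q (node e0))"
          unfolding P_eq by simp
        moreover have "eval_at (sol N k \<tau>) (lin k q (node e0)) \<noteq> 0"
          using eval_lin_sol[OF \<tau> q1N, of e0] \<tau>A[OF e0(1)] A'(2) by auto
        ultimately show "eval_at (sol N k \<tau>) (h e0) = 0"
          using less.prems(4)[OF balA] by simp
      qed
      then obtain h' where h': "h e0 = (\<Sum>e\<in>V. h' e * lin_prod k ?A2 e)"
        "\<forall>e\<in>V. h' e \<in> polys_upto V (lower (lower d {q}) (?A2 e))"
        unfolding bounded_ideal_def by blast
      have h'_eq: "h e0 = h' e0 * (\<Prod>q\<in>A'. lin k q (node e0)) + (\<Sum>e\<in>V - {e0}. h' e * lin_prod k A e)"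
        unfolding h'(1) using e0(1) fin
        by (subst sum.remove[of _ e0]) (auto simp: lin_prod_def)
      \<comment> \<open>The second expression is substituted into the first: at \<open>e0\<close>
        the two factors recombine to the full generator, and the other cofactors gain a form of
        degree one in group \<open>q\<close>.\<close>
      define g where "g e = (if e = e0 then h' e0 else h e + h' e * lin k q (node e0))" for e
      have "P = (\<Sum>e\<in>V. g e * lin_prod k A e)"
      proof -
        have "(\<Sum>e\<in>V. g e * lin_prod k A e) = h' e0 * lin_prod k A e0 +
            (\<Sum>e\<in>V - {e0}. (h e + h' e * lin k q (node e0)) * lin_prod k A e)"
          using e0(1) fin by (subst sum.remove[of _ e0]) (auto simp: g_def)
        also have "lin_prod k A e0 = (\<Prod>q\<in>A'. lin k q (node e0)) * lin k q (node e0)"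
          using A' finA' by (simp add: lin_prod_def mult.commute)
        finally show ?thesis
          unfolding P_eq h'_eq
          by (simp add: ring_distribs sum.distrib sum_distrib_left sum_distrib_right mult_ac)
      qed
      moreover have "g e \<in> polys_upto V (lower d (A e))" if e: "e \<in> V" for e
      proof (cases "e = e0")
        case True
        have "h' e0 \<in> polys_upto V (lower (lower d {q}) A')"
          using h'(2) e0(1) by auto
        then show ?thesis
          using True A' by (auto simp: g_def lower_def elim!: polys_upto_mono split: if_splits)
      next
        case False
        have 1: "h e \<in> polys_upto V (lower d (A e))"
          using h(2) e False by auto
        have 2: "h' e \<in> polys_upto V (lower (lower d {q}) (A e))"
          using h'(2) e False by auto
        have "h' e * lin k q (node e0) \<in> polys_upto V (lower d (A e))"
          using 2 lin_upto[OF q1N, of k "node e0"] unfolding V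
        proof (rule polys_upto_mult)
          fix q'
          have "3 \<le> d q'" using sum3 less.prems(2)[of q'] by linarith
          then show "lower (lower d {q}) (A e) q' + (if q' = q then 1 else 0) \<le> lower d (A e) q'"
            by (auto simp: lower_def)
        qed
        then show ?thesis using False 1 by (auto simp: g_def intro: polys_upto_add)
      qed
      ultimately show ?thesis unfolding bounded_ideal_def by blast
    qed
  qed
qed

section \<open>The special table\<close>

lemma polyfun_prod_nonzero:
  assumes "finite A" "\<And>a. a \<in> A \<Longrightarrow> polyfun I (f a)" "\<And>a. a \<in> A \<Longrightarrow> \<exists>u. f a u \<noteq> 0"
  shows "\<exists>u. \<forall>a\<in>A. f a u \<noteq> 0"
  using assms
proof (induction A rule: finite_induct)
  case (insert a A)
  then obtain u where u: "\<forall>a\<in>A. f a u \<noteq> 0" by auto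
  obtain w where w: "f a w \<noteq> 0" using insert.prems by auto
  have pf: "polyfun I (\<lambda>u. \<Prod>a\<in>A. f a u)" using insert.prems by (intro polyfun_prod) auto
  have "\<exists>v. (\<Prod>a\<in>A. f a v) \<noteq> 0 \<and> f a v \<noteq> 0"
    by (rule polyfun_nonzero_common[OF pf insert.prems(1)[of a], of u w]) (use u w insert.hyps in auto)
  then show ?case using insert.hyps by auto
qed auto

text \<open>Each pair of distinct points excludes the zeros of one nonzero linear function of
  \<open>l\<close>, and finitely many nonzero polynomial functions have a common nonzero.\<close>

lemma separating_functional:
  fixes X :: "('v \<Rightarrow> complex) set"
  assumes "finite X" "finite V" "\<And>x y. x \<in> X \<Longrightarrow> y \<in> X \<Longrightarrow> (\<forall>v\<in>V. x v = y v) \<Longrightarrow> x = y"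
  obtains l where "inj_on (\<lambda>x. \<Sum>v\<in>V. l v * x v) X"
proof -
  let ?A = "{(x, y). x \<in> X \<and> y \<in> X \<and> x \<noteq> y}"
  have "\<exists>l. \<forall>a\<in>?A. (\<lambda>(x, y) l. \<Sum>v\<in>V. l v * (x v - y v)) a l \<noteq> 0"
  proof (rule polyfun_prod_nonzero[where I = V])
    show "finite ?A" by (rule finite_subset[of _ "X \<times> X"]) (use assms(1) in auto)
    show "polyfun V ((\<lambda>(x, y) l. \<Sum>v\<in>V. l v * (x v - y v)) a)" if "a \<in> ?A" for a
      by (cases a) (auto intro!: polyfun_sum polyfun.intros)
    fix a assume "a \<in> ?A"
    then obtain x y where a: "a = (x, y)" "x \<in> X" "y \<in> X" "x \<noteq> y" by auto
    then obtain v where v: "v \<in> V" "x v \<noteq> y v" using assms(3) by blast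
    have "(\<Sum>v'\<in>V. (if v' = v then 1 else 0) * (x v' - y v')) = x v - y v"
      using v assms(2) by (subst sum.remove[of _ v]) (auto intro!: sum.neutral)
    then show "\<exists>l. (\<lambda>(x, y) l. \<Sum>v\<in>V. l v * (x v - y v)) a l \<noteq> 0"
      using v a by (intro exI[of _ "\<lambda>v'. if v' = v then 1 else 0"]) auto
  qed
  then obtain l where l: "\<forall>a\<in>?A. (\<lambda>(x, y) l. \<Sum>v\<in>V. l v * (x v - y v)) a l \<noteq> 0" ..
  show ?thesis
  proof (rule that[of l], rule inj_onI, rule ccontr)
    fix x y assume xy: "x \<in> X" "y \<in> X" "(\<Sum>v\<in>V. l v * x v) = (\<Sum>v\<in>V. l v * y v)" "x \<noteq> y"
    then have "(\<Sum>v\<in>V. l v * (x v - y v)) \<noteq> 0"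
      using l[rule_format, of "(x, y)"] by simp
    then show False using xy(3) by (simp add: right_diff_distrib sum_subtractf)
  qed
qed

section \<open>The indifference system as a family over payoff tables\<close>

locale network =
  fixes N :: nat and G :: "(nat \<times> nat) set" and k :: "nat \<Rightarrow> nat"
  assumes G: "G \<subseteq> all_edges N"
begin

abbreviation "V \<equiv> strat_vars N k"
abbreviation "I \<equiv> table_entries N G k"

definition B :: "nat \<times> nat \<Rightarrow> nat set" where
  "B e = in_nbrs G (fst e)"

text \<open>A family indexed by pairs, since equal equations collapse in the set
  \<open>indiff_system\<close>.\<close>

definition f :: "(nat \<times> nat \<times> (nat \<Rightarrow> nat) \<Rightarrow> complex) \<Rightarrow> nat \<times> nat \<Rightarrow> (nat \<times> nat) mpoly" where
  "f u e = indiff_poly G k u (fst e) (snd e)"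

abbreviation "S \<equiv> balanced N k B"

lemma B_subset: "B e \<subseteq> {1..N}"
  using G by (auto simp: B_def in_nbrs_def all_edges_def)

lemma finite_B [simp]: "finite (B e)"
  by (rule finite_subset[OF B_subset]) simp

lemma system_eq: "indiff_system N G k u = f u ` V"
proof (intro subset_antisym subsetI)
  fix p assume "p \<in> indiff_system N G k u"
  then obtain i s where "p = indiff_poly G k u i s" "i \<in> {1..N}" "s \<in> {1..k i}"
    by (auto simp: indiff_system_def)
  then show "p \<in> f u ` V"
    by (intro image_eqI[of _ _ "(i, s)"]) (auto simp: f_def strat_vars_def)
next
  fix p assume "p \<in> f u ` V"
  then obtain i s where "(i, s) \<in> V" "p = f u (i, s)" by auto
  then show "p \<in> indiff_system N G k u"
    unfolding indiff_system_def strat_vars_def f_def by (intro CollectI exI[of _ i] exI[of _ s]) auto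
qed

definition y :: "(nat \<times> nat \<Rightarrow> complex) \<Rightarrow> nat \<Rightarrow> nat \<Rightarrow> complex" where
  "y x q t = (if t = 0 then 1 - (\<Sum>r = 1..k q. x (q, r)) else x (q, t))"

lemma eval_strat_poly: "eval_at x (strat_poly k q t) = y x q t"
  by (simp add: strat_poly_def y_def)

lemma eval_f: "eval_at x (f u (i, s)) =
    (\<Sum>\<alpha>\<in>profiles G k i. (u (i, s, \<alpha>) - u (i, 0, \<alpha>)) * (\<Prod>q\<in>in_nbrs G i. y x q (\<alpha> q)))"
  by (simp add: f_def indiff_poly_def eval_strat_poly)

lemma sum_y: "(\<Sum>t = 0..k q. y x q t) = 1"
  by (simp add: sum.atLeast_Suc_atMost[of 0] y_def)

lemma sum_profiles: "(\<Sum>\<alpha>\<in>profiles G k i. \<Prod>q\<in>in_nbrs G i. y x q (\<alpha> q)) = 1"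
proof -
  have "finite (in_nbrs G i)" using finite_B[of "(i, 0)"] by (simp add: B_def)
  then show ?thesis
    unfolding profiles_def by (subst prod_sum_PiE[symmetric]) (auto simp: sum_y)
qed

lemma eval_f_line:
  "eval_at x (f (\<lambda>e. u e + t * v e) e) = eval_at x (f u e) + t * eval_at x (f v e)"
  by (cases e) (simp add: eval_f sum_distrib_left flip: sum.distrib, simp add: algebra_simps)

text \<open>The products of probabilities over all profiles sum to 1, so lowering a whole row of the
  table by a constant lowers the equation by that constant at every point. Any residual at a point
  can thus be absorbed into the table.\<close>

lemma eval_f_shift:
  assumes "e \<in> V"
  shows "eval_at x (f (\<lambda>(i, s, \<alpha>). w (i, s, \<alpha>) - (if s = 0 then 0 else r (i, s))) e) = eval_at x (f w e) - r e"
proof -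
  obtain i s where e: "e = (i, s)" "s \<noteq> 0" using assms by (cases e) (auto simp: strat_vars_def)
  have "r e = r e * (\<Sum>\<alpha>\<in>profiles G k i. \<Prod>q\<in>in_nbrs G i. y x q (\<alpha> q))"
    by (simp add: sum_profiles)
  then show ?thesis
    using e(2) unfolding e(1)
    by (simp add: eval_f sum_distrib_left left_diff_distrib sum_subtractf)
qed

lemma strat_poly_upto:
  assumes "q \<in> {1..N}" "t \<le> k q"
  shows "strat_poly k q t \<in> polys_upto V (\<lambda>q'. if q' = q then 1 else 0)"
  unfolding strat_poly_def
  by (cases "t = 0")
     (use assms in \<open>auto intro!: polys_upto_diff polys_upto_sum polys_upto_Var polys_upto_one
       simp: strat_vars_def\<close>)

lemma f_upto: "f u e \<in> polys_upto V (\<lambda>q. if q \<in> B e then 1 else 0)"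
  unfolding f_def indiff_poly_def
proof (rule polys_upto_sum, rule polys_upto_Cst_mult)
  fix \<alpha> assume \<alpha>: "\<alpha> \<in> profiles G k (fst e)"
  have "(\<Prod>q\<in>B e. strat_poly k q (\<alpha> q)) \<in>
      polys_upto V (\<lambda>q'. \<Sum>q\<in>B e. if q' = q then 1 else 0)"
    by (rule polys_upto_prod[OF finite_B])
       (use \<alpha> B_subset[of e] in \<open>auto simp: profiles_def B_def PiE_iff intro!: strat_poly_upto\<close>)
  then show "(\<Prod>q\<in>in_nbrs G (fst e). strat_poly k q (\<alpha> q)) \<in> polys_upto V (\<lambda>q. if q \<in> B e then 1 else 0)"
    by (simp add: B_def[symmetric])
qed

lemma f_polys: "f u e \<in> polys V"
  using f_upto by (rule polys_upto_polys)

lemma lookup_f: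
  assumes "e \<in> V"
  shows "polyfun I (\<lambda>u. Poly_Mapping.lookup (f u e) m)"
proof -
  have "(i, s, \<alpha>) \<in> I" "(i, 0, \<alpha>) \<in> I" if "e = (i, s)" "\<alpha> \<in> profiles G k i" for i s \<alpha>
    using assms that by (auto simp: table_entries_def strat_vars_def)
  then show ?thesis
    unfolding f_def indiff_poly_def lookup_sum lookup_Cst_mult
    by (intro polyfun_intros) (auto simp: prod_eq_iff)
qed

text \<open>Since the probabilities of a player sum to 1, the constant term of \<open>lin\<close> at
  the node c can be spread over all strategies: strategy 0 gets the weight c^(k q), and strategy t >
  0 gets c^(k q - t) + c^(k q). Row \<open>s\<close> is the product of these weights over the
  in-neighbours, and row 0 is zero.\<close>

definition u0 :: "nat \<times> nat \<times> (nat \<Rightarrow> nat) \<Rightarrow> complex" where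
  "u0 = (\<lambda>(i, s, \<alpha>). if s = 0 then 0 else
     \<Prod>q\<in>in_nbrs G i. (if \<alpha> q = 0 then 0 else node (i, s) ^ (k q - \<alpha> q)) + node (i, s) ^ k q)"

lemma lin_eq_sum_strat:
  "lin k q c = (\<Sum>t = 0..k q. Cst ((if t = 0 then 0 else c ^ (k q - t)) + c ^ k q) * strat_poly k q t)"
proof -
  have "(\<Sum>t = 0..k q. Cst ((if t = 0 then 0 else c ^ (k q - t)) + c ^ k q) * strat_poly k q t) =
    Cst (c ^ k q) * (1 - (\<Sum>r = 1..k q. Var (q, r))) +
    (\<Sum>t = 1..k q. Cst (c ^ (k q - t) + c ^ k q) * Var (q, t))"
    by (subst sum.atLeast_Suc_atMost) (auto simp: strat_poly_def intro!: sum.cong)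
  then show ?thesis
    by (simp add: lin_def Cst_add ring_distribs sum.distrib sum_distrib_left)
qed

lemma f_u0: 
  assumes "e \<in> V"
  shows "f u0 e = lin_prod k B e"
proof -
  obtain i s where e: "e = (i, s)" "s \<noteq> 0" using assms by (cases e) (auto simp: strat_vars_def)
  let ?a = "\<lambda>q t. (if t = 0 then 0 else node (i, s) ^ (k q - t)) + node (i, s) ^ k q"
  have fin: "finite (in_nbrs G i)" using finite_B[of "(i, 0)"] by (simp add: B_def)
  have "lin_prod k B e = (\<Prod>q\<in>in_nbrs G i. \<Sum>t = 0..k q. Cst (?a q t) * strat_poly k q t)"
    unfolding lin_prod_def B_def e fst_conv lin_eq_sum_strat ..
  also have "\<dots> = (\<Sum>\<alpha>\<in>profiles G k i. \<Prod>q\<in>in_nbrs G i. Cst (?a q (\<alpha> q)) * strat_poly k q (\<alpha> q))"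
    unfolding profiles_def by (rule prod_sum_PiE) (use fin in auto)
  also have "\<dots> = f u0 e"
    using e(2) by (simp add: f_def indiff_poly_def e(1) u0_def prod.distrib Cst_prod)
  finally show ?thesis ..
qed

lemma sol_node_unique:
  assumes "\<sigma> \<in> S" "\<tau> \<in> S" "\<And>v. v \<in> V \<Longrightarrow> sol N k \<sigma> v = sol N k \<tau> v"
  shows "\<sigma> = \<tau>"
proof (rule PiE_ext)
  show "\<sigma> \<in> PiE V B" "\<tau> \<in> PiE V B" using assms by (auto simp: balanced_def)
  fix e assume e: "e \<in> V"
  have q: "\<sigma> e \<in> {1..N}"
    using PiE_mem[OF \<open>\<sigma> \<in> PiE V B\<close> e] B_subset[of e] by blast
  have "eval_at (sol N k \<tau>) (lin k (\<sigma> e) (node e)) = eval_at (sol N k \<sigma>) (lin k (\<sigma> e) (node e))"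
    by (rule eval_at_cong[of _ V]) (use assms(3) polys_upto_polys[OF lin_upto[OF q]] in auto)
  then show "\<sigma> e = \<tau> e"
    using eval_lin_sol[OF assms(1) q] eval_lin_sol[OF assms(2) q] e by metis
qed

lemma finite_S [simp]: "finite S"
  by (rule finite_balanced) simp

subsection \<open>Independence\<close>

definition Lf :: "(nat \<times> nat \<Rightarrow> complex) \<Rightarrow> (nat \<times> nat \<Rightarrow> complex) \<Rightarrow> complex" where
  "Lf l x = (\<Sum>v\<in>V. l v * x v)"

text \<open>This is the invertibility of the Jacobian at a special solution. In equation
  \<open>e\<close> only the factor for \<open>\<sigma> e\<close> matters to first order, and the
  \<open>k q\<close> equations assigned to \<open>q\<close> have distinct nodes, so prescribed
  first-order values are met by interpolation.\<close>

lemma direction_exists: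
  assumes "\<sigma> \<in> S"
  shows "\<exists>h. \<forall>e\<in>V. (\<Sum>t = 1..k (\<sigma> e). h (\<sigma> e, t) * node e ^ (k (\<sigma> e) - t)) = r e"
proof -
  have \<sigma>: "\<sigma> e \<in> {1..N}" if "e \<in> V" for e
    using assms that B_subset[of e] by (auto simp: balanced_def dest: PiE_mem)
  have "\<exists>c. \<forall>e\<in>V. \<sigma> e = q \<longrightarrow> (\<Sum>j<k q. c j * node e ^ j) = r e" if q: "q \<in> {1..N}" for q
  proof -
    let ?Z = "node ` {e\<in>V. \<sigma> e = q}"
    have "card ?Z = k q"
      using assms q by (subst card_image[OF inj_node]) (auto simp: balanced_def)
    then obtain c where c: "\<And>z. z \<in> ?Z \<Longrightarrow> (\<Sum>j<k q. c j * z ^ j) = r (inv_into UNIV node z)"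
      using interpolation_sum[of ?Z "\<lambda>z. r (inv_into UNIV node z)"] by auto
    then show ?thesis
      by (intro exI[of _ c]) (auto simp: inv_into_f_f[OF inj_node])
  qed
  then have "\<forall>q. \<exists>c. q \<in> {1..N} \<longrightarrow> (\<forall>e\<in>V. \<sigma> e = q \<longrightarrow> (\<Sum>j<k q. c j * node e ^ j) = r e)"
    by blast
  from choice[OF this] obtain c where c: "\<And>q e. q \<in> {1..N} \<Longrightarrow> e \<in> V \<Longrightarrow> \<sigma> e = q \<Longrightarrow>
      (\<Sum>j<k q. c q j * node e ^ j) = r e" by blast
  have "(\<Sum>t = 1..k q. c q (k q - t) * z ^ (k q - t)) = (\<Sum>j<k q. c q j * z ^ j)" for q z
    by (rule sum.reindex_bij_witness[of _ "\<lambda>j. k q - j" "\<lambda>t. k q - t"]) auto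
  then show ?thesis
    by (intro exI[of _ "\<lambda>(q, t). c q (k q - t)"]) (use c \<sigma> in auto)
qed

lemma eval_lin_line:
  "eval_at (\<lambda>v. x v + t * h v) (lin k q c) =
     eval_at x (lin k q c) + t * (\<Sum>s = 1..k q. h (q, s) * c ^ (k q - s))"
  by (simp add: lin_def ring_distribs sum.distrib sum_distrib_left mult_ac)

lemma eval_at_tendsto:
  assumes "\<And>v. ((\<lambda>t. x t v) \<longlongrightarrow> a v) F"
  shows "((\<lambda>t. eval_at (x t) P) \<longlongrightarrow> eval_at a P) F"
  unfolding eval_at_def by (intro tendsto_intros assms)

text \<open>Instead of solving for points over a given curve of tables, the points run along a
  straight line and the table is corrected to fit. The direction \<open>h\<close> of the line is
  chosen such that the correction \<open>r t\<close> tends to 0, which leaves \<open>w\<close> as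
  the limiting direction of the table.\<close>

lemma curve_exists:
  assumes \<sigma>: "\<sigma> \<in> S"
  shows "\<exists>v x. (\<forall>e\<in>I. ((\<lambda>t. v t e) \<longlongrightarrow> w e) (at 0)) \<and> (\<forall>v. ((\<lambda>t. x t v) \<longlongrightarrow> sol N k \<sigma> v) (at 0)) \<and>
    (\<forall>t. \<forall>e\<in>V. eval_at (x t) (f (\<lambda>e. u0 e + t * v t e) e) = 0)"
proof -
  define a where "a e = (\<Prod>q\<in>B e - {\<sigma> e}. eval_at (sol N k \<sigma>) (lin k q (node e)))" for e
  \<comment> \<open>The first-order condition for equation \<open>e\<close>:
    \<open>r0 e * a e\<close> cancels the value of \<open>f w e\<close> at the solution, where
    \<open>a e\<close> collects the factors that do not vanish.\<close>
  define r0 where "r0 e = - eval_at (sol N k \<sigma>) (f w e) / a e" for e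
  obtain h where h: "\<And>e. e \<in> V \<Longrightarrow>
      (\<Sum>t = 1..k (\<sigma> e). h (\<sigma> e, t) * node e ^ (k (\<sigma> e) - t)) = r0 e"
    using direction_exists[OF \<sigma>, of r0] by blast
  define x where "x t v = sol N k \<sigma> v + t * h v" for t v
  \<comment> \<open>For the table moving in direction \<open>w\<close>, this is the value of
    equation \<open>e\<close> at \<open>x t\<close> divided by \<open>t\<close>: the factor for
    \<open>\<sigma> e\<close> has the value \<open>t * r0 e\<close> there.\<close>
  define r where "r t e = r0 e * (\<Prod>q\<in>B e - {\<sigma> e}. eval_at (x t) (lin k q (node e))) +
    eval_at (x t) (f w e)" for t e
  define v where "v t = (\<lambda>(i, s, \<alpha>). w (i, s, \<alpha>) - (if s = 0 then 0 else r t (i, s)))"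
    for t :: complex
  have \<sigma>B: "\<sigma> e \<in> B e" if "e \<in> V" for e
    using \<sigma> that by (auto simp: balanced_def dest: PiE_mem)
  have xlim: "((\<lambda>t. x t v) \<longlongrightarrow> sol N k \<sigma> v) (at 0)" for v
    unfolding x_def by (auto intro!: tendsto_eq_intros)
  have a0: "a e \<noteq> 0" if "e \<in> V" for e
  proof -
    have "eval_at (sol N k \<sigma>) (lin k q (node e)) \<noteq> 0" if "q \<in> B e - {\<sigma> e}" for q
      using eval_lin_sol[OF \<sigma>, of q e] that B_subset[of e] by auto
    then show ?thesis unfolding a_def by simp
  qed
  have rlim: "((\<lambda>t. r t e) \<longlongrightarrow> 0) (at 0)" if e: "e \<in> V" for e
  proof -
    have "((\<lambda>t. r t e) \<longlongrightarrow> r0 e * a e + eval_at (sol N k \<sigma>) (f w e)) (at 0)"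
      unfolding r_def a_def by (intro tendsto_intros eval_at_tendsto xlim)
    then show ?thesis using a0[OF e] by (simp add: r0_def)
  qed
  have "((\<lambda>t. v t e) \<longlongrightarrow> w e) (at 0)" if "e \<in> I" for e
  proof -
    obtain i s \<alpha> where e: "e = (i, s, \<alpha>)" by (cases e)
    show ?thesis
    proof (cases "s = 0")
      case False
      then have "(i, s) \<in> V" using that by (auto simp: e table_entries_def strat_vars_def)
      then have "((\<lambda>t. w (i, s, \<alpha>) - r t (i, s)) \<longlongrightarrow> w (i, s, \<alpha>) - 0) (at 0)"
        by (intro tendsto_intros rlim)
      then show ?thesis using False by (simp add: v_def e)
    qed (simp add: v_def e)
  qed
  moreover have "eval_at (x t) (f (\<lambda>e. u0 e + t * v t e) e) = 0" if e: "e \<in> V" for t e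
  proof -
    have "eval_at (x t) (f (\<lambda>e. u0 e + t * v t e) e) =
        eval_at (x t) (lin_prod k B e) + t * (eval_at (x t) (f w e) - r t e)"
      unfolding eval_f_line f_u0[OF e] v_def eval_f_shift[OF e] ..
    also have "eval_at (x t) (lin_prod k B e) = eval_at (x t) (lin k (\<sigma> e) (node e)) *
        (\<Prod>q\<in>B e - {\<sigma> e}. eval_at (x t) (lin k q (node e)))"
      unfolding lin_prod_def eval_at_prod using \<sigma>B[OF e] by (simp add: prod.remove)
    also have "eval_at (x t) (lin k (\<sigma> e) (node e)) = t * r0 e"
      using eval_lin_sol[OF \<sigma>, of "\<sigma> e" e] e \<sigma>B[OF e] B_subset[of e] h[OF e]
      unfolding x_def[abs_def] eval_lin_line by auto
    finally show ?thesis by (simp add: r_def algebra_simps)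
  qed
  ultimately show ?thesis using xlim by blast
qed

text \<open>The relation holds along all curves through the \<open>card S\<close> special solutions,
  at which the separating form takes distinct values; its degree is too small for that many
  roots.\<close>

lemma incidence_independent:
  assumes inj: "inj_on (\<lambda>\<sigma>. Lf l (sol N k \<sigma>)) S"
    and P: "\<And>j. j < card S \<Longrightarrow> polyfun I (P j)"
    and zero: "\<And>u x. (\<forall>e\<in>V. eval_at x (f u e) = 0) \<Longrightarrow> (\<Sum>j<card S. P j u * Lf l x ^ j) = 0"
    and j: "j < card S"
  shows "P j u = 0"
proof -
  let ?Z = "(\<lambda>\<sigma>. Lf l (sol N k \<sigma>)) ` S"
  have cZ: "card ?Z = card S" by (rule card_image[OF inj])
  show ?thesis
  proof (rule curves_imp_independent[where Z = ?Z and I = I and P = P and ?u0.0 = u0])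
    show "polyfun I (P j)" if "j < card ?Z" for j using P that cZ by simp
    show "j < card ?Z" using j cZ by simp
    fix z w assume "z \<in> ?Z"
    then obtain \<sigma> where \<sigma>: "\<sigma> \<in> S" "z = Lf l (sol N k \<sigma>)" by blast
    obtain v x where vx: "\<forall>e\<in>I. ((\<lambda>t. v t e) \<longlongrightarrow> w e) (at 0)"
      "\<forall>v. ((\<lambda>t. x t v) \<longlongrightarrow> sol N k \<sigma> v) (at 0)"
      "\<forall>t. \<forall>e\<in>V. eval_at (x t) (f (\<lambda>e. u0 e + t * v t e) e) = 0"
      using curve_exists[OF \<sigma>(1), of w] by (elim exE conjE)
    have "((\<lambda>t. Lf l (x t)) \<longlongrightarrow> z) (at 0)"
      unfolding \<sigma>(2) Lf_def by (intro tendsto_intros vx(2)[rule_format])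
    moreover have "\<forall>t. (\<Sum>j<card ?Z. P j (\<lambda>e. u0 e + t * v t e) * Lf l (x t) ^ j) = 0"
      unfolding cZ by (intro allI zero) (use vx(3) in blast)
    ultimately show "\<exists>v x. (\<forall>e\<in>I. ((\<lambda>t. v t e) \<longlongrightarrow> w e) (at 0)) \<and> (x \<longlongrightarrow> z) (at 0) \<and>
        (\<forall>t. (\<Sum>j<card ?Z. P j (\<lambda>e. u0 e + t * v t e) * x t ^ j) = 0)"
      using vx(1) by (intro exI[of _ v] exI[of _ "\<lambda>t. Lf l (x t)"]) auto
  qed
qed

end

section \<open>Ideals and multiplicity\<close>

lemma ideal_gen_add:
  assumes "P \<in> ideal_gen V F" "Q \<in> ideal_gen V F"
  shows "P + Q \<in> ideal_gen V F"
proof -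
  obtain g where g: "P = (\<Sum>f\<in>F. g f * f)" "\<forall>f\<in>F. g f \<in> polys V"
    using assms(1) unfolding ideal_gen_def by blast
  obtain h where h: "Q = (\<Sum>f\<in>F. h f * f)" "\<forall>f\<in>F. h f \<in> polys V"
    using assms(2) unfolding ideal_gen_def by blast
  show ?thesis unfolding ideal_gen_def
    by (rule CollectI, rule exI[of _ "\<lambda>f. g f + h f"])
       (use g h in \<open>auto simp: ring_distribs sum.distrib intro: polys_add\<close>)
qed

lemma ideal_gen_mult:
  assumes "P \<in> ideal_gen V F" "Q \<in> polys V"
  shows "Q * P \<in> ideal_gen V F"
proof -
  obtain g where g: "P = (\<Sum>f\<in>F. g f * f)" "\<forall>f\<in>F. g f \<in> polys V"
    using assms(1) unfolding ideal_gen_def by blast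
  show ?thesis unfolding ideal_gen_def
    by (rule CollectI, rule exI[of _ "\<lambda>f. Q * g f"])
       (use g assms(2) in \<open>auto simp: sum_distrib_left mult.assoc intro: polys_mult\<close>)
qed

lemma ideal_gen_zero: "0 \<in> ideal_gen V F"
  unfolding ideal_gen_def by (rule CollectI, rule exI[of _ "\<lambda>f. 0"]) auto

lemma ideal_gen_sum: "(\<And>a. a \<in> A \<Longrightarrow> P a \<in> ideal_gen V F) \<Longrightarrow> sum P A \<in> ideal_gen V F"
  by (induction A rule: infinite_finite_induct) (auto intro: ideal_gen_add ideal_gen_zero)

lemma ideal_gen_generator:
  assumes "finite F" "f \<in> F"
  shows "f \<in> ideal_gen V F"
proof -
  have "(\<Sum>f'\<in>F. (if f' = f then 1 else 0) * f') = f"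
    using assms by (subst sum.remove[of _ f]) (auto intro!: sum.neutral)
  then show ?thesis unfolding ideal_gen_def
    by (intro CollectI exI[of _ "\<lambda>f'. if f' = f then 1 else 0"]) auto
qed

lemma eval_at_ideal_gen:
  assumes "P \<in> ideal_gen V F" "\<And>f. f \<in> F \<Longrightarrow> eval_at x f = 0"
  shows "eval_at x P = 0"
  using assms unfolding ideal_gen_def by auto

lemma monom_at_mpoly: "Poly_Mapping.single m 1 = (\<Prod>v\<in>Poly_Mapping.keys m. Var v ^ Poly_Mapping.lookup m v)"
proof -
  have V: "Var v ^ n = Poly_Mapping.single (Poly_Mapping.single v n) 1" for v :: 'a and n
    by (induction n) (auto simp: Var_def mult_single simp flip: single_add)
  have "(\<Prod>v\<in>A. Var v ^ Poly_Mapping.lookup m v) =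
      Poly_Mapping.single (\<Sum>v\<in>A. Poly_Mapping.single v (Poly_Mapping.lookup m v)) 1" for A
    by (induction A rule: infinite_finite_induct) (auto simp: V mult_single)
  then show ?thesis by (simp flip: mpoly_expansion)
qed

text \<open>If every coordinate function minus its value lies in the local ideal, then so does every
  polynomial vanishing at the point, and the local quotient is the base field.\<close>

lemma multiplicity_one:
  assumes fin: "finite V" and F: "F \<subseteq> polys V" and a: "\<And>f. f \<in> F \<Longrightarrow> eval_at a f = 0"
    and h: "h \<in> polys V" "eval_at a h \<noteq> 0"
    and vars: "\<And>v. v \<in> V \<Longrightarrow> h * (Var v - Cst (a v)) \<in> ideal_gen V F"
  shows "multiplicity_at V F a = 1"
proof -
  \<comment> \<open>\<open>h\<close> is a denominator that is a unit at \<open>a\<close>, so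
    \<open>J\<close> lies in the local ideal, and it is closed under sums and multiplication by
    polynomials.\<close>
  define J where "J = {P \<in> polys V. h * P \<in> ideal_gen V F}"
  have J_add: "P + Q \<in> J" if "P \<in> J" "Q \<in> J" for P Q
    using that by (auto simp: J_def ring_distribs intro: ideal_gen_add polys_add)
  have J_mult: "Q * P \<in> J" if "P \<in> J" "Q \<in> polys V" for P Q
    using that ideal_gen_mult[of "h * P" V F Q] by (auto simp: J_def mult_ac intro: polys_mult)
  have J_zero: "0 \<in> J" by (simp add: J_def ideal_gen_zero)
  have J_sum: "sum P A \<in> J" if "\<And>x. x \<in> A \<Longrightarrow> P x \<in> J" for P and A :: "('a \<Rightarrow>\<^sub>0 nat) set"
    using that by (induction A rule: infinite_finite_induct) (auto intro: J_add J_zero)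
  have J_pow: "Var v ^ n - Cst (a v ^ n) \<in> J" if v: "v \<in> V" for v n
  proof (induction n)
    case (Suc n)
    have "Var v ^ Suc n - Cst (a v ^ Suc n) =
      Var v ^ n * (Var v - Cst (a v)) + Cst (a v) * (Var v ^ n - Cst (a v ^ n))"
      by (simp add: algebra_simps Cst_mult)
    moreover have "Var v - Cst (a v) \<in> J"
      using v vars by (auto simp: J_def intro: polys_diff polys_Var)
    ultimately show ?case using Suc v
      by (simp only:) (intro J_add J_mult polys_power polys_Var polys_Cst)
  qed (simp add: J_zero)
  have J_prod: "(\<Prod>v\<in>A. Var v ^ n v) - Cst (\<Prod>v\<in>A. a v ^ n v) \<in> J" if "finite A" "A \<subseteq> V" for n A
    using that
  proof (induction A rule: finite_induct)
    case (insert v A)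
    have "(\<Prod>v\<in>insert v A. Var v ^ n v) - Cst (\<Prod>v\<in>insert v A. a v ^ n v) =
      (\<Prod>v\<in>A. Var v ^ n v) * (Var v ^ n v - Cst (a v ^ n v)) +
      Cst (a v ^ n v) * ((\<Prod>v\<in>A. Var v ^ n v) - Cst (\<Prod>v\<in>A. a v ^ n v))"
      using insert by (simp add: algebra_simps Cst_mult)
    then show ?case using insert
      by (simp only:) (intro J_add J_mult J_pow polys_prod polys_power polys_Var polys_Cst; auto)
  qed (simp add: J_zero)
  have J_val: "P - Cst (eval_at a P) \<in> J" if P: "P \<in> polys V" for P
  proof -
    have "P - Cst (eval_at a P) = (\<Sum>m\<in>Poly_Mapping.keys P. Cst (Poly_Mapping.lookup P m) *
        (Poly_Mapping.single m 1 - Cst (monom_at a m)))"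
      by (subst (1) mpoly_expansion[of P])
         (simp add: eval_at_superset[OF _ order_refl] right_diff_distrib sum_subtractf Cst_sum Cst_mult
           flip: single_eq_Cst_mult)
    also have "\<dots> \<in> J"
      by (intro J_sum J_mult polys_Cst, unfold monom_at_mpoly monom_at_def, intro J_prod)
         (use P in \<open>auto simp: polys_def\<close>)
    finally show ?thesis .
  qed
  have local: "g \<in> local_ideal V F a \<longleftrightarrow> eval_at a g = 0" if g: "g \<in> polys V" for g
  proof
    assume "g \<in> local_ideal V F a"
    then obtain h' where "eval_at a h' \<noteq> 0" "h' * g \<in> ideal_gen V F"
      by (auto simp: local_ideal_def)
    then show "eval_at a g = 0" using eval_at_ideal_gen[of "h' * g" V F a] a by simp
  next
    assume "eval_at a g = 0"
    then have "g \<in> J" using J_val[OF g] by simp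
    then show "g \<in> local_ideal V F a" using h by (auto simp: local_ideal_def J_def)
  qed
  define X :: "nat set" where "X = {n. \<exists>b. (\<forall>j<n. b j \<in> polys V) \<and>
     (\<forall>c. (\<Sum>j<n. Cst (c j) * b j) \<in> local_ideal V F a \<longrightarrow> (\<forall>j<n. c j = 0))}"
  have "n \<le> 1" if nX: "n \<in> X" for n
  proof (rule ccontr)
    assume n: "\<not> n \<le> 1"
    obtain b where b: "\<forall>j<n. b j \<in> polys V"
      "\<forall>c. (\<Sum>j<n. Cst (c j) * b j) \<in> local_ideal V F a \<longrightarrow> (\<forall>j<n. c j = 0)"
      using nX unfolding X_def by (elim CollectE exE conjE)
    have in_loc: "(\<Sum>j<n. Cst (c j) * b j) \<in> local_ideal V F a \<longleftrightarrow> (\<Sum>j<n. c j * eval_at a (b j)) = 0" for c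
      by (subst local) (auto intro!: polys_sum polys_mult polys_Cst b(1)[rule_format])
    \<comment> \<open>Two polynomials are dependent modulo those vanishing at \<open>a\<close>:
      either \<open>b 0\<close> vanishes there, or \<open>b 0\<close> and \<open>b 1\<close>, each
      weighted by the value of the other, cancel.\<close>
    define c where "c = (if eval_at a (b 0) = 0 then (\<lambda>j. if j = 0 then 1 else 0)
      else (\<lambda>j::nat. if j = 0 then eval_at a (b 1) else if j = 1 then - eval_at a (b 0) else 0))"
    have "(\<Sum>j<n. c j * eval_at a (b j)) = (\<Sum>j\<in>{0, 1}. c j * eval_at a (b j))"
      by (rule sum.mono_neutral_right) (use n in \<open>auto simp: c_def\<close>)
    also have "\<dots> = 0" by (simp add: c_def)
    finally have "\<forall>j<n. c j = 0"
      using b(2)[rule_format, of c] in_loc[of c] by blast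
    then have "c 0 = 0" "c 1 = 0" using n by simp_all
    then show False by (simp add: c_def split: if_splits)
  qed
  moreover have "1 \<in> X"
    unfolding X_def
    by (rule CollectI, rule exI[of _ "\<lambda>_. 1"]) (auto simp: local)
  ultimately have "(SUP n\<in>X. enat n) = enat 1"
    by (intro antisym SUP_least SUP_upper) auto
  then show ?thesis
    unfolding multiplicity_at_def X_def by (simp add: one_enat_def)
qed

text \<open>A multiple root \<open>z\<close> would remain a root after division by the linear factor
  of \<open>z\<close>; the quotient would have \<open>card Z\<close> roots and smaller
  degree.\<close>

lemma distinct_roots_pderiv:
  fixes p :: "complex poly"
  assumes "\<And>n. n > card Z \<Longrightarrow> coeff p n = 0" "p \<noteq> 0" "\<And>z. z \<in> Z \<Longrightarrow> poly p z = 0" "z \<in> Z" "finite Z"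
  shows "poly (pderiv p) z \<noteq> 0"
proof
  assume 0: "poly (pderiv p) z = 0"
  obtain q where q: "p = [:-z, 1:] * q"
    using assms(3)[OF assms(4)] by (auto simp: poly_eq_0_iff_dvd)
  have "poly (pderiv p) z = poly q z"
    unfolding q pderiv_mult by (simp add: pderiv_pCons)
  with 0 have qz: "poly q z = 0" by simp
  have "q = 0"
  proof (rule poly_zero_if_many_roots[of Z])
    show "poly q w = 0" if "w \<in> Z" for w
      using assms(3)[OF that] qz by (cases "w = z") (auto simp: q)
    have "degree p \<le> card Z" using assms(1) by (intro degree_le) auto
    moreover have "degree p = Suc (degree q)"
      using assms(2) degree_mult_eq[of "[:-z, 1:]" q] unfolding q by (cases "q = 0") auto
    ultimately show "coeff q n = 0" if "n \<ge> card Z" for n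
      using that by (intro coeff_eq_0) auto
  qed
  then show False using assms(2) q by simp
qed

lemma simple_roots_card:
  fixes p :: "complex poly"
  assumes "\<And>z. poly p z = 0 \<Longrightarrow> poly (pderiv p) z \<noteq> 0"
  shows "card {z. poly p z = 0} = degree p"
proof -
  have "rsquarefree p" using assms by (auto simp: rsquarefree_roots)
  from complex_poly_decompose_rsquarefree[OF this]
  have "degree p = degree (smult (lead_coeff p) (\<Prod>z|poly p z = 0. [:-z, 1:]))" by simp
  also have "\<dots> = card {z. poly p z = 0}"
    using \<open>rsquarefree p\<close> by (subst degree_smult_eq, subst degree_prod_eq_sum_degree) (auto simp: rsquarefree_def)
  finally show ?thesis ..
qed

section \<open>Linear algebra modulo the ideal of the system\<close>

context network
begin

definition Lp :: "(nat \<times> nat \<Rightarrow> complex) \<Rightarrow> (nat \<times> nat) mpoly" where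
  "Lp l = (\<Sum>v\<in>V. Cst (l v) * Var v)"

lemma eval_Lp [simp]: "eval_at x (Lp l) = Lf l x"
  by (simp add: Lp_def Lf_def)

lemma Lp_upto: "Lp l \<in> polys_upto V (\<lambda>_. 1)"
  unfolding Lp_def by (intro polys_upto_sum polys_upto_Cst_mult polys_upto_Var) auto

lemma Lp_power_upto: "Lp l ^ j \<in> polys_upto V (\<lambda>_. j)"
  using polys_upto_power[OF Lp_upto, of l j] by simp

lemma Lp_polys: "Lp l \<in> polys V"
  using Lp_upto by (rule polys_upto_polys)

text \<open>The keys of \<open>Q u\<close> may vary with \<open>u\<close>; the uniform finite set
  \<open>K\<close> keeps the product a fixed finite sum.\<close>

lemma polyfun_lookup_mult:
  fixes Q :: "_ \<Rightarrow> 'v mpoly"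
  assumes "finite K" "\<And>u. Poly_Mapping.keys (Q u) \<subseteq> K"
    and "\<And>m. polyfun J (\<lambda>u. Poly_Mapping.lookup (Q u) m)"
  shows "polyfun J (\<lambda>u. Poly_Mapping.lookup (P * Q u) m)"
proof -
  have "P * Q u = (\<Sum>n\<in>K. Cst (Poly_Mapping.lookup (Q u) n) * (P * Poly_Mapping.single n 1))" for u
  proof -
    have "Q u = (\<Sum>n\<in>Poly_Mapping.keys (Q u). Poly_Mapping.single n (Poly_Mapping.lookup (Q u) n))"
      by (rule mpoly_expansion)
    also have "\<dots> = (\<Sum>n\<in>K. Poly_Mapping.single n (Poly_Mapping.lookup (Q u) n))"
      by (rule sum.mono_neutral_left) (use assms in \<open>auto simp: in_keys_iff\<close>)
    finally have "P * Q u = P * (\<Sum>n\<in>K. Poly_Mapping.single n (Poly_Mapping.lookup (Q u) n))"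
      by simp
    then show ?thesis
      by (simp add: sum_distrib_left single_eq_Cst_mult[of _ "Poly_Mapping.lookup _ _"] mult_ac)
  qed
  then show ?thesis
    by (simp add: lookup_sum) (intro polyfun_intros assms(3))
qed

text \<open>At the special table \<open>u0\<close> this is interpolation at the points \<open>sol N k \<sigma>\<close>, and spanning is an open
  condition on the table; \<open>\<delta>\<close> is a determinant that does not vanish at \<open>u0\<close>.\<close>

lemma spanning:
  assumes inj: "inj_on (\<lambda>\<sigma>. Lf l (sol N k \<sigma>)) S"
    and H: "\<And>u. H u \<in> polys_upto V (\<lambda>_. h)" "\<And>m. polyfun I (\<lambda>u. Poly_Mapping.lookup (H u) m)"
    and nz: "\<And>\<sigma>. \<sigma> \<in> S \<Longrightarrow> eval_at (sol N k \<sigma>) (H u0) \<noteq> 0"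
    and bound: "1 + (\<Sum>e\<in>V. card (B e)) + h + card S \<le> d"
  shows "\<exists>\<delta>. polyfun I \<delta> \<and> \<delta> u0 \<noteq> 0 \<and> (\<forall>P\<in>polys_upto V (\<lambda>_. d). \<exists>c. (\<forall>j<card S. polyfun I (c j)) \<and>
    (\<forall>u. Cst (\<delta> u) * P - (\<Sum>j<card S. Cst (c j u) * (Lp l ^ j * H u)) \<in> ideal_gen V (indiff_system N G k u)))"
proof -
  let ?D = "card S" and ?d = "\<lambda>_::nat. d"
  let ?Y = "monoms_upto V ?d"
  let ?K = "SIGMA e:V. monoms_upto V (lower ?d (B e))"
  \<comment> \<open>Candidates for spanning degree \<open>d\<close>: powers of the separating form
    times \<open>H\<close>, and the admissible monomial multiples of the equations.\<close>
  define g where "g = case_sum (\<lambda>j u. Lp l ^ j * H u) (\<lambda>(e, m) u. Poly_Mapping.single m 1 * f u e)"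
  let ?J = "{..<?D} <+> ?K"
  have finK: "finite ?K" by (rule finite_SigmaI) (auto intro: finite_monoms_upto)
  have finJ: "finite ?J" using finK by simp
  have g_upto: "g i u \<in> polys_upto V ?d" if "i \<in> ?J" for i u
    using that
  proof (elim PlusE)
    fix j assume j: "j \<in> {..<?D}" "i = Inl j"
    then show ?thesis
      using bound by (auto simp: g_def intro!: polys_upto_mult[OF Lp_power_upto H(1)])
  next
    fix em assume em: "em \<in> ?K" "i = Inr em"
    then show ?thesis
      using bound by (auto simp: g_def lower_def intro!: polys_upto_mult[OF polys_upto_single f_upto])
  qed
  have fin_upto: "finite (monoms_upto V d')" for d' by (rule finite_monoms_upto) simp
  have pf: "polyfun I (\<lambda>u. Poly_Mapping.lookup (g i u) m)" if "i \<in> ?J" for i m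
    using that
  proof (elim PlusE)
    fix j assume j: "j \<in> {..<?D}" "i = Inl j"
    have "polyfun I (\<lambda>u. Poly_Mapping.lookup (Lp l ^ j * H u) m)"
      by (rule polyfun_lookup_mult[OF fin_upto _ H(2)]) (use H(1) in \<open>auto simp: polys_upto_def\<close>)
    then show ?thesis by (simp add: g_def j)
  next
    fix em assume em: "em \<in> ?K" "i = Inr em"
    obtain e n where en: "em = (e, n)" by (cases em)
    have "polyfun I (\<lambda>u. Poly_Mapping.lookup (Poly_Mapping.single n 1 * f u e) m)"
      by (rule polyfun_lookup_mult[OF fin_upto[of "\<lambda>q. if q \<in> B e then 1 else 0"] _ lookup_f])
         (use em en f_upto[of _ e] in \<open>auto simp: polys_upto_def\<close>)
    then show ?thesis by (simp add: g_def em en)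
  qed
  have span0: "\<exists>c. P = (\<Sum>i\<in>?J. Cst (c i) * g i u0)" if P: "P \<in> polys_upto V ?d" for P
  proof -
    let ?\<mu> = "\<lambda>\<sigma>. Lf l (sol N k \<sigma>)"
    \<comment> \<open>The quotient of \<open>P\<close> by \<open>H u0\<close> at the special
      solutions, as a function of the separating form. Interpolation needs only powers below
      \<open>card S\<close>, and the remainder vanishes at all special solutions.\<close>
    define val where "val z = (let \<sigma> = inv_into S ?\<mu> z in
        eval_at (sol N k \<sigma>) P / eval_at (sol N k \<sigma>) (H u0))" for z
    have "card (?\<mu> ` S) = ?D" by (rule card_image[OF inj])
    then obtain a where a: "\<And>z. z \<in> ?\<mu> ` S \<Longrightarrow> (\<Sum>j<?D. a j * z ^ j) = val z"
      using interpolation_sum[of "?\<mu> ` S" val] by auto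
    define R where "R = P - (\<Sum>j<?D. Cst (a j) * (Lp l ^ j * H u0))"
    have "R \<in> bounded_ideal V B (lin_prod k B) ?d"
    proof (rule vanishing_imp_in_ideal[OF refl B_subset])
      show "1 + (\<Sum>e\<in>V. card (B e)) \<le> d" using bound by simp
      have "Lp l ^ j * H u0 \<in> polys_upto V ?d" if "j < ?D" for j
        using that bound by (auto intro!: polys_upto_mult[OF Lp_power_upto H(1)])
      then show "R \<in> polys_upto V ?d"
        unfolding R_def by (intro polys_upto_diff P polys_upto_sum polys_upto_Cst_mult) auto
      fix \<sigma> assume \<sigma>: "\<sigma> \<in> S"
      have "eval_at (sol N k \<sigma>) R = eval_at (sol N k \<sigma>) P -
          (\<Sum>j<?D. a j * ?\<mu> \<sigma> ^ j) * eval_at (sol N k \<sigma>) (H u0)"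
        by (simp add: R_def sum_distrib_right mult.assoc)
      also have "(\<Sum>j<?D. a j * ?\<mu> \<sigma> ^ j) = val (?\<mu> \<sigma>)" using \<sigma> by (intro a) auto
      also have "val (?\<mu> \<sigma>) = eval_at (sol N k \<sigma>) P / eval_at (sol N k \<sigma>) (H u0)"
        using inv_into_f_f[OF inj \<sigma>] by (simp add: val_def)
      finally show "eval_at (sol N k \<sigma>) R = 0" using nz[OF \<sigma>] by simp
    qed
    then obtain b where b: "R = (\<Sum>e\<in>V. b e * lin_prod k B e)" "\<forall>e\<in>V. b e \<in> polys_upto V (lower ?d (B e))"
      unfolding bounded_ideal_def by blast
    have "R = (\<Sum>e\<in>V. b e * f u0 e)" unfolding b(1) by (simp add: f_u0)
    also have "\<dots> = (\<Sum>e\<in>V. \<Sum>m\<in>monoms_upto V (lower ?d (B e)).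
        Cst (Poly_Mapping.lookup (b e) m) * (Poly_Mapping.single m 1 * f u0 e))"
    proof (intro sum.cong refl)
      fix e assume e: "e \<in> V"
      have "b e = (\<Sum>m\<in>Poly_Mapping.keys (b e). Poly_Mapping.single m (Poly_Mapping.lookup (b e) m))"
        by (rule mpoly_expansion)
      also have "\<dots> = (\<Sum>m\<in>monoms_upto V (lower ?d (B e)). Poly_Mapping.single m (Poly_Mapping.lookup (b e) m))"
        by (rule sum.mono_neutral_left)
           (use b(2) e finite_monoms_upto[OF finite_strat_vars] in \<open>auto simp: in_keys_iff polys_upto_def\<close>)
      finally have "b e * f u0 e = (\<Sum>m\<in>monoms_upto V (lower ?d (B e)).
          Poly_Mapping.single m (Poly_Mapping.lookup (b e) m)) * f u0 e" by simp
      then show "b e * f u0 e = (\<Sum>m\<in>monoms_upto V (lower ?d (B e)).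
          Cst (Poly_Mapping.lookup (b e) m) * (Poly_Mapping.single m 1 * f u0 e))"
        by (simp add: sum_distrib_right single_eq_Cst_mult[of _ "Poly_Mapping.lookup _ _"] mult.assoc)
    qed
    also have "\<dots> = (\<Sum>(e, m)\<in>?K. Cst (Poly_Mapping.lookup (b e) m) * (Poly_Mapping.single m 1 * f u0 e))"
      by (rule sum.Sigma) (auto intro: finite_monoms_upto)
    finally have R: "R = \<dots>" .
    have "P = (\<Sum>j<?D. Cst (a j) * (Lp l ^ j * H u0)) + R" by (simp add: R_def)
    also have "\<dots> = (\<Sum>i\<in>?J. Cst (case_sum a (\<lambda>(e, m). Poly_Mapping.lookup (b e) m) i) * g i u0)"
      unfolding R by (subst sum.Plus) (auto simp: finK g_def case_prod_unfold)
    finally show ?thesis by blast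
  qed
  have "\<exists>c. \<forall>y'\<in>?Y. (\<Sum>i\<in>?J. c i * Poly_Mapping.lookup (g i u0) y') = (if y' = m then 1 else 0)"
    if m: "m \<in> ?Y" for m
  proof -
    obtain c where c: "Poly_Mapping.single m 1 = (\<Sum>i\<in>?J. Cst (c i) * g i u0)"
      using span0[OF polys_upto_single[OF m]] by blast
    have "(\<Sum>i\<in>?J. c i * Poly_Mapping.lookup (g i u0) y') = (if y' = m then 1 else 0)" for y'
      using arg_cong[OF c, of "\<lambda>P. Poly_Mapping.lookup P y'"]
      by (simp add: lookup_sum lookup_single when_def split: if_splits)
    then show ?thesis by blast
  qed
  then have span_all: "\<forall>m\<in>?Y. \<exists>c. \<forall>y'\<in>?Y.
      (\<Sum>i\<in>?J. c i * Poly_Mapping.lookup (g i u0) y') = (if y' = m then 1 else 0)" by blast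
  have pf_all: "\<forall>i\<in>?J. \<forall>m\<in>?Y. polyfun I (\<lambda>u. Poly_Mapping.lookup (g i u) m)" using pf by blast
  from open_spanning[where e = "\<lambda>i u m. Poly_Mapping.lookup (g i u) m" and Y = ?Y and J = ?J and I = I
      and ?u0.0 = u0, OF fin_upto finJ pf_all span_all]
  obtain \<delta> c where \<delta>: "polyfun I \<delta>" "\<delta> u0 \<noteq> 0"
    "\<forall>m\<in>?Y. \<forall>i\<in>?J. polyfun I (c m i)"
    "\<forall>u. \<forall>m\<in>?Y. \<forall>m'\<in>?Y.
       (\<Sum>i\<in>?J. c m i u * Poly_Mapping.lookup (g i u) m') = (if m' = m then \<delta> u else 0)"
    by (elim exE conjE)
  have single: "Cst (\<delta> u) * Poly_Mapping.single m 1 = (\<Sum>i\<in>?J. Cst (c m i u) * g i u)" if m: "m \<in> ?Y" for m u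
  proof (rule poly_mapping_eqI)
    fix m'
    show "Poly_Mapping.lookup (Cst (\<delta> u) * Poly_Mapping.single m 1) m' =
        Poly_Mapping.lookup (\<Sum>i\<in>?J. Cst (c m i u) * g i u) m'"
    proof (cases "m' \<in> ?Y")
      case True
      then show ?thesis using \<delta>(4) m by (auto simp: lookup_sum lookup_single when_def)
    next
      case False
      \<comment> \<open>Monomials beyond degree \<open>d\<close> occur on neither side.\<close>
      then have "Poly_Mapping.lookup (g i u) m' = 0" if "i \<in> ?J" for i
        using g_upto[OF that, of u] by (auto simp: polys_upto_def in_keys_iff)
      then show ?thesis using False m by (auto simp: lookup_sum lookup_single when_def)
    qed
  qed
  have "\<exists>c. (\<forall>j<card S. polyfun I (c j)) \<and>
    (\<forall>u. Cst (\<delta> u) * P - (\<Sum>j<card S. Cst (c j u) * (Lp l ^ j * H u)) \<in> ideal_gen V (indiff_system N G k u))"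
    if P: "P \<in> polys_upto V ?d" for P
  proof -
    define a where "a i u = (\<Sum>m\<in>Poly_Mapping.keys P. Poly_Mapping.lookup P m * c m i u)" for i u
    have keys: "Poly_Mapping.keys P \<subseteq> ?Y" using P by (simp add: polys_upto_def)
    have "Cst (\<delta> u) * P - (\<Sum>j<card S. Cst (a (Inl j) u) * (Lp l ^ j * H u)) \<in>
        ideal_gen V (indiff_system N G k u)" for u
    proof -
      have "Cst (\<delta> u) * P = (\<Sum>m\<in>Poly_Mapping.keys P. Cst (Poly_Mapping.lookup P m) *
          (Cst (\<delta> u) * Poly_Mapping.single m 1))"
        by (subst mpoly_expansion[of P])
           (simp add: sum_distrib_left single_eq_Cst_mult[of _ "Poly_Mapping.lookup _ _"] mult_ac)
      also have "\<dots> = (\<Sum>m\<in>Poly_Mapping.keys P. Cst (Poly_Mapping.lookup P m) * (\<Sum>i\<in>?J. Cst (c m i u) * g i u))"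
        by (intro sum.cong refl) (use keys single in auto)
      also have "\<dots> = (\<Sum>i\<in>?J. Cst (a i u) * g i u)"
        unfolding a_def Cst_sum sum_distrib_left sum_distrib_right
        by (subst sum.swap) (simp add: Cst_mult mult.assoc)
      also have "\<dots> = (\<Sum>j<card S. Cst (a (Inl j) u) * (Lp l ^ j * H u)) +
          (\<Sum>(e, m)\<in>?K. Cst (a (Inr (e, m)) u) * (Poly_Mapping.single m 1 * f u e))"
        by (subst sum.Plus) (auto simp: finK g_def case_prod_unfold)
      finally have "Cst (\<delta> u) * P - (\<Sum>j<card S. Cst (a (Inl j) u) * (Lp l ^ j * H u)) =
          (\<Sum>(e, m)\<in>?K. Cst (a (Inr (e, m)) u) * (Poly_Mapping.single m 1 * f u e))" by simp
      also have "\<dots> \<in> ideal_gen V (indiff_system N G k u)"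
      proof (rule ideal_gen_sum)
        fix em assume "em \<in> ?K"
        then obtain e m where em: "em = (e, m)" "e \<in> V" "m \<in> monoms_upto V (lower ?d (B e))" by auto
        have "f u e \<in> ideal_gen V (indiff_system N G k u)"
          using em(2) by (intro ideal_gen_generator) (auto simp: system_eq)
        then have "(Cst (a (Inr (e, m)) u) * Poly_Mapping.single m 1) * f u e \<in> ideal_gen V (indiff_system N G k u)"
          by (rule ideal_gen_mult)
             (use em(3) in \<open>auto intro!: polys_mult polys_upto_polys[OF polys_upto_single]\<close>)
        then show "(case em of (e, m) \<Rightarrow> Cst (a (Inr (e, m)) u) * (Poly_Mapping.single m 1 * f u e)) \<in>
            ideal_gen V (indiff_system N G k u)"
          by (simp add: em(1) mult.assoc)
      qed
      finally show ?thesis .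
    qed
    moreover have "\<forall>j<card S. polyfun I (a (Inl j))"
      unfolding a_def using \<delta>(3) keys by (auto intro!: polyfun_intros)
    ultimately show ?thesis by (intro exI[of _ "\<lambda>j. a (Inl j)"]) auto
  qed
  then show ?thesis by (intro exI[of _ \<delta>] conjI ballI \<delta>(1,2))
qed

end

section \<open>Pseudo-reduction modulo a family of univariate polynomials\<close>

text \<open>Polynomials in \<open>z\<close> whose coefficients are polynomial functions of the
  table, again as a class of functions.\<close>

inductive upolyfun :: "'v set \<Rightarrow> (('v \<Rightarrow> complex) \<Rightarrow> complex \<Rightarrow> complex) \<Rightarrow> bool" for I where
  upolyfun_coeff: "polyfun I P \<Longrightarrow> upolyfun I (\<lambda>u z. P u)"
| upolyfun_var: "upolyfun I (\<lambda>u z. z)"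
| upolyfun_add: "upolyfun I P \<Longrightarrow> upolyfun I Q \<Longrightarrow> upolyfun I (\<lambda>u z. P u z + Q u z)"
| upolyfun_mult: "upolyfun I P \<Longrightarrow> upolyfun I Q \<Longrightarrow> upolyfun I (\<lambda>u z. P u z * Q u z)"

lemma upolyfun_sum:
  "(\<And>a. a \<in> A \<Longrightarrow> upolyfun I (P a)) \<Longrightarrow> upolyfun I (\<lambda>u z. \<Sum>a\<in>A. P a u z)"
  by (induction A rule: infinite_finite_induct)
     (auto intro: upolyfun_add upolyfun_coeff[OF polyfun_const])

lemma upolyfun_prod:
  "(\<And>a. a \<in> A \<Longrightarrow> upolyfun I (P a)) \<Longrightarrow> upolyfun I (\<lambda>u z. \<Prod>a\<in>A. P a u z)"
  by (induction A rule: infinite_finite_induct)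
     (auto intro: upolyfun_mult upolyfun_coeff[OF polyfun_const])

lemma upolyfun_diff:
  assumes "upolyfun I P" "upolyfun I Q"
  shows "upolyfun I (\<lambda>u z. P u z - Q u z)"
  using upolyfun_add[OF assms(1) upolyfun_mult[OF upolyfun_coeff[OF polyfun_const[of I "-1"]] assms(2)]]
  by simp

lemma upolyfun_power: "upolyfun I P \<Longrightarrow> upolyfun I (\<lambda>u z. P u z ^ n)"
  by (induction n) (auto intro: upolyfun_mult upolyfun_coeff[OF polyfun_const])

text \<open>Division with remainder by a polynomial in \<open>z\<close> with leading coefficient
  \<open>\<delta> u\<close>, which is not inverted: a power of it clears the denominators. Only
  pairs \<open>(u, z)\<close> on the zero set of the divisor matter.\<close>

definition reducible_mod ::
  "'v set \<Rightarrow> nat \<Rightarrow> (('v \<Rightarrow> complex) \<Rightarrow> complex) \<Rightarrow> (nat \<Rightarrow> ('v \<Rightarrow> complex) \<Rightarrow> complex) \<Rightarrow>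
   (('v \<Rightarrow> complex) \<Rightarrow> complex \<Rightarrow> complex) \<Rightarrow> bool" where
  "reducible_mod I D \<delta> p P \<longleftrightarrow> (\<exists>M s. (\<forall>j<D. polyfun I (s j)) \<and>
    (\<forall>u z. \<delta> u * z ^ D = (\<Sum>j<D. p j u * z ^ j) \<longrightarrow> \<delta> u ^ M * P u z = (\<Sum>j<D. s j u * z ^ j)))"

context
  fixes I :: "'v set" and D \<delta> and p :: "nat \<Rightarrow> ('v \<Rightarrow> complex) \<Rightarrow> complex"
  assumes \<delta>: "polyfun I \<delta>" and p: "\<forall>j<D. polyfun I (p j)"
begin

lemma reducible_mod_add:
  assumes "reducible_mod I D \<delta> p P" "reducible_mod I D \<delta> p Q"
  shows "reducible_mod I D \<delta> p (\<lambda>u z. P u z + Q u z)"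
proof -
  obtain M s where s: "\<forall>j<D. polyfun I (s j)"
    "\<forall>u z. \<delta> u * z ^ D = (\<Sum>j<D. p j u * z ^ j) \<longrightarrow> \<delta> u ^ M * P u z = (\<Sum>j<D. s j u * z ^ j)"
    using assms(1) unfolding reducible_mod_def by (elim exE conjE)
  obtain M' s' where s': "\<forall>j<D. polyfun I (s' j)"
    "\<forall>u z. \<delta> u * z ^ D = (\<Sum>j<D. p j u * z ^ j) \<longrightarrow> \<delta> u ^ M' * Q u z = (\<Sum>j<D. s' j u * z ^ j)"
    using assms(2) unfolding reducible_mod_def by (elim exE conjE)
  have "\<delta> u ^ (M + M') * (P u z + Q u z) = (\<Sum>j<D. (\<delta> u ^ M' * s j u + \<delta> u ^ M * s' j u) * z ^ j)"
    if "\<delta> u * z ^ D = (\<Sum>j<D. p j u * z ^ j)" for u z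
  proof -
    have "\<delta> u ^ (M + M') * (P u z + Q u z) = \<delta> u ^ M' * (\<delta> u ^ M * P u z) + \<delta> u ^ M * (\<delta> u ^ M' * Q u z)"
      by (simp add: power_add algebra_simps)
    also have "\<dots> = \<delta> u ^ M' * (\<Sum>j<D. s j u * z ^ j) + \<delta> u ^ M * (\<Sum>j<D. s' j u * z ^ j)"
      using s(2) s'(2) that by simp
    finally show ?thesis by (simp add: ring_distribs sum.distrib sum_distrib_left mult.assoc)
  qed
  moreover have "\<forall>j<D. polyfun I (\<lambda>u. \<delta> u ^ M' * s j u + \<delta> u ^ M * s' j u)"
    using s(1) s'(1) \<delta> by (auto intro!: polyfun_intros)
  ultimately show ?thesis
    unfolding reducible_mod_def
    by (intro exI[of _ "M + M'"] exI[of _ "\<lambda>j u. \<delta> u ^ M' * s j u + \<delta> u ^ M * s' j u"]) auto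
qed

lemma reducible_mod_coeff_mult:
  assumes "reducible_mod I D \<delta> p P" "polyfun I c"
  shows "reducible_mod I D \<delta> p (\<lambda>u z. c u * P u z)"
proof -
  obtain M s where s: "\<forall>j<D. polyfun I (s j)"
    "\<forall>u z. \<delta> u * z ^ D = (\<Sum>j<D. p j u * z ^ j) \<longrightarrow> \<delta> u ^ M * P u z = (\<Sum>j<D. s j u * z ^ j)"
    using assms(1) unfolding reducible_mod_def by (elim exE conjE)
  have "\<delta> u ^ M * (c u * P u z) = (\<Sum>j<D. (c u * s j u) * z ^ j)"
    if "\<delta> u * z ^ D = (\<Sum>j<D. p j u * z ^ j)" for u z
  proof -
    have "\<delta> u ^ M * (c u * P u z) = c u * (\<delta> u ^ M * P u z)" by simp
    also have "\<dots> = c u * (\<Sum>j<D. s j u * z ^ j)" using s(2) that by simp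
    finally show ?thesis by (simp add: sum_distrib_left mult.assoc)
  qed
  moreover have "\<forall>j<D. polyfun I (\<lambda>u. c u * s j u)"
    using s(1) assms(2) by (auto intro!: polyfun_intros)
  ultimately show ?thesis
    unfolding reducible_mod_def
    by (intro exI[of _ M] exI[of _ "\<lambda>j u. c u * s j u"]) auto
qed

text \<open>Multiplication by \<open>z\<close> shifts the remainder; the overflowing top term is
  rewritten by the relation, at the price of one factor \<open>\<delta> u\<close>.\<close>

lemma reducible_mod_var_mult:
  assumes "reducible_mod I D \<delta> p P"
  shows "reducible_mod I D \<delta> p (\<lambda>u z. z * P u z)"
proof -
  obtain M s where s: "\<forall>j<D. polyfun I (s j)"
    "\<forall>u z. \<delta> u * z ^ D = (\<Sum>j<D. p j u * z ^ j) \<longrightarrow> \<delta> u ^ M * P u z = (\<Sum>j<D. s j u * z ^ j)"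
    using assms unfolding reducible_mod_def by (elim exE conjE)
  define s' where "s' j u = (if j = 0 then 0 else \<delta> u * s (j - 1) u) + s (D - 1) u * p j u" for j u
  have "\<delta> u ^ Suc M * (z * P u z) = (\<Sum>j<D. s' j u * z ^ j)"
    if root: "\<delta> u * z ^ D = (\<Sum>j<D. p j u * z ^ j)" for u z
  proof (cases D)
    \<comment> \<open>For \<open>D = 0\<close> the relation itself says
      \<open>\<delta> u = 0\<close>.\<close>
    case 0
    then show ?thesis using root by simp
  next
    case (Suc d)
    have "\<delta> u ^ Suc M * (z * P u z) = \<delta> u * z * (\<delta> u ^ M * P u z)" by simp
    also have "\<dots> = \<delta> u * z * (\<Sum>j<Suc d. s j u * z ^ j)" using s(2) root Suc by simp
    also have "\<dots> = (\<Sum>j<d. \<delta> u * s j u * z ^ Suc j) + s d u * (\<delta> u * z ^ D)"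
      by (simp add: Suc ring_distribs sum_distrib_left mult_ac)
    also have "(\<Sum>j<d. \<delta> u * s j u * z ^ Suc j) = (\<Sum>j<D. (if j = 0 then 0 else \<delta> u * s (j - 1) u) * z ^ j)"
      unfolding Suc by (subst sum.lessThan_Suc_shift) simp
    also have "s d u * (\<delta> u * z ^ D) = (\<Sum>j<D. s (D - 1) u * p j u * z ^ j)"
      using root Suc by (simp add: sum_distrib_left mult.assoc del: sum.lessThan_Suc)
    finally show ?thesis by (simp add: s'_def ring_distribs sum.distrib)
  qed
  moreover have "\<forall>j<D. polyfun I (s' j)"
    unfolding s'_def[abs_def] using s(1) p \<delta> by (auto intro!: polyfun_intros polyfun_if)
  ultimately show ?thesis
    unfolding reducible_mod_def by (intro exI[of _ "Suc M"] exI[of _ s']) auto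
qed

text \<open>The exponent 1, rather than 0, serves the degenerate case \<open>D = 0\<close>: the
  remainder is then an empty sum, and the relation makes the factor \<open>\<delta> u\<close>
  vanish.\<close>

lemma reducible_mod_one: "reducible_mod I D \<delta> p (\<lambda>u z. 1)"
  unfolding reducible_mod_def
proof (rule exI[of _ 1], rule exI[of _ "\<lambda>j u. if j = 0 then \<delta> u else 0"], intro conjI allI impI)
  fix u z assume "\<delta> u * z ^ D = (\<Sum>j<D. p j u * z ^ j)"
  then show "\<delta> u ^ 1 * 1 = (\<Sum>j<D. (if j = 0 then \<delta> u else 0) * z ^ j)"
    by (cases D) (auto simp: sum.lessThan_Suc_shift simp del: sum.lessThan_Suc)
qed (use \<delta> in \<open>auto intro!: polyfun_intros polyfun_if\<close>)

lemma upolyfun_reducible: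
  assumes "upolyfun I P"
  shows "reducible_mod I D \<delta> p P"
proof -
  have "\<exists>n c. (\<forall>i<n. polyfun I (c i)) \<and> (\<forall>u z. P u z = (\<Sum>i<n. c i u * z ^ i))"
    using assms
  proof induction
    case (upolyfun_coeff P)
    then show ?case by (intro exI[of _ 1] exI[of _ "\<lambda>_. P"]) auto
  next
    case upolyfun_var
    show ?case
      by (intro exI[of _ 2] exI[of _ "\<lambda>i u. if i = 1 then 1 else 0"])
         (auto simp: numeral_2_eq_2 intro: polyfun_const)
  next
    case (upolyfun_add P Q)
    then obtain n c n' c' where c: "\<forall>i<n. polyfun I (c i)" "\<forall>u z. P u z = (\<Sum>i<n. c i u * z ^ i)"
      "\<forall>i<n'. polyfun I (c' i)" "\<forall>u z. Q u z = (\<Sum>i<n'. c' i u * z ^ i)" by (elim exE conjE)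
    define a where "a i u = (if i < n then c i u else 0) + (if i < n' then c' i u else 0)" for i u
    have "P u z + Q u z = (\<Sum>i<max n n'. a i u * z ^ i)" for u z
    proof -
      have "P u z = (\<Sum>i<max n n'. (if i < n then c i u else 0) * z ^ i)"
        unfolding c(2)[rule_format] by (intro sum.mono_neutral_cong_left) auto
      moreover have "Q u z = (\<Sum>i<max n n'. (if i < n' then c' i u else 0) * z ^ i)"
        unfolding c(4)[rule_format] by (intro sum.mono_neutral_cong_left) auto
      ultimately show ?thesis by (simp add: a_def ring_distribs sum.distrib)
    qed
    moreover have "\<forall>i<max n n'. polyfun I (a i)"
      unfolding a_def[abs_def] using c by (auto intro!: polyfun_intros polyfun_if)
    ultimately show ?case by (intro exI[of _ "max n n'"] exI[of _ a]) auto
  next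
    case (upolyfun_mult P Q)
    then obtain n c n' c' where c: "\<forall>i<n. polyfun I (c i)" "\<forall>u z. P u z = (\<Sum>i<n. c i u * z ^ i)"
      "\<forall>i<n'. polyfun I (c' i)" "\<forall>u z. Q u z = (\<Sum>i<n'. c' i u * z ^ i)" by (elim exE conjE)
    define a where "a m u = (\<Sum>ij\<in>{ij\<in>{..<n} \<times> {..<n'}. fst ij + snd ij = m}. c (fst ij) u * c' (snd ij) u)" for m u
    have "P u z * Q u z = (\<Sum>m<n + n'. a m u * z ^ m)" for u z
    proof -
      have "P u z * Q u z = (\<Sum>ij\<in>{..<n} \<times> {..<n'}. c (fst ij) u * c' (snd ij) u * z ^ (fst ij + snd ij))"
        unfolding c(2)[rule_format] c(4)[rule_format] sum_product sum.cartesian_product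
        by (intro sum.cong) (auto simp: power_add mult_ac)
      also have "\<dots> = (\<Sum>m<n + n'. \<Sum>ij\<in>{ij\<in>{..<n} \<times> {..<n'}. fst ij + snd ij = m}.
          c (fst ij) u * c' (snd ij) u * z ^ (fst ij + snd ij))"
        by (rule sum.group[symmetric]) auto
      also have "\<dots> = (\<Sum>m<n + n'. a m u * z ^ m)"
        unfolding a_def sum_distrib_right by (intro sum.cong) auto
      finally show ?thesis .
    qed
    moreover have "\<forall>m<n + n'. polyfun I (a m)"
      unfolding a_def[abs_def] using c by (auto intro!: polyfun_intros)
    ultimately show ?case by (intro exI[of _ "n + n'"] exI[of _ a]) auto
  qed
  then obtain n c where c: "\<forall>i<n. polyfun I (c i)" "\<forall>u z. P u z = (\<Sum>i<n. c i u * z ^ i)"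
    by (elim exE conjE)
  have pow: "reducible_mod I D \<delta> p (\<lambda>u z. z ^ i)" for i
    by (induction i) (use reducible_mod_one reducible_mod_var_mult in auto)
  have "reducible_mod I D \<delta> p (\<lambda>u z. \<Sum>i<m. c i u * z ^ i)" if "m \<le> n" for m
    using that
  proof (induction m)
    case 0
    show ?case using reducible_mod_coeff_mult[OF reducible_mod_one polyfun_const[of I 0]] by simp
  next
    case (Suc m)
    then show ?case using c(1) by (auto intro!: reducible_mod_add reducible_mod_coeff_mult pow)
  qed
  then show ?thesis using c(2) by (auto simp: fun_eq_iff[symmetric] reducible_mod_def)
qed

end

text \<open>The summation bound \<open>n\<close> may exceed the degree because the induction step
  uses the statement for \<open>n\<close> and for its predecessor.\<close>

lemma sum_coeff_prod_linear:
  fixes L :: "'v mpoly"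
  assumes "finite M" "card M \<le> n"
  shows "(\<Sum>i\<le>n. Cst (coeff (\<Prod>z\<in>M. [:-z, 1:]) i) * L ^ i) = (\<Prod>z\<in>M. (L - Cst z))"
  using assms
proof (induction M arbitrary: n rule: finite_induct)
  case empty
  have "(\<Sum>i\<le>n. Cst (coeff 1 i) * L ^ i) = (\<Sum>i\<in>{0}. Cst (coeff 1 i) * L ^ i)"
    by (rule sum.mono_neutral_right) auto
  then show ?case by simp
next
  case (insert z M)
  define q where "q = (\<Prod>z\<in>M. [:-z, 1:])"
  obtain n' where n: "n = Suc n'" "card M \<le> n'" using insert by (cases n) auto
  have "(\<Sum>i\<le>n. Cst (coeff ([:-z, 1:] * q) i) * L ^ i) =
      (\<Sum>i\<le>n. Cst (coeff (pCons 0 q) i) * L ^ i) - Cst z * (\<Sum>i\<le>n. Cst (coeff q i) * L ^ i)"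
    by (simp add: Cst_diff Cst_mult left_diff_distrib sum_subtractf sum_distrib_left mult.assoc)
  also have "(\<Sum>i\<le>n. Cst (coeff (pCons 0 q) i) * L ^ i) = L * (\<Sum>i\<le>n'. Cst (coeff q i) * L ^ i)"
    unfolding n by (subst sum.atMost_Suc_shift) (simp add: sum_distrib_left mult_ac)
  also have "(\<Sum>i\<le>n'. Cst (coeff q i) * L ^ i) = (\<Prod>z\<in>M. (L - Cst z))"
    unfolding q_def by (rule insert.IH[OF n(2)])
  also have "(\<Sum>i\<le>n. Cst (coeff q i) * L ^ i) = (\<Prod>z\<in>M. (L - Cst z))"
    unfolding q_def by (rule insert.IH) (use n in auto)
  finally show ?case using insert by (simp add: q_def algebra_simps)
qed

lemma finite_imp_isolated_in:
  fixes X :: "('a \<Rightarrow> 'b::t1_space) set"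
  assumes "finite X"
  shows "x isolated_in X \<longleftrightarrow> x \<in> X"
proof
  assume x: "x \<in> X"
  have "\<forall>y\<in>X - {x}. \<exists>v. x v \<noteq> y v" by (auto simp: fun_eq_iff)
  from bchoice[OF this] obtain v where v: "\<forall>y\<in>X - {x}. x (v y) \<noteq> y (v y)" by (elim exE)
  let ?T = "\<Inter>y\<in>X - {x}. (\<lambda>w. w (v y)) -` (- {y (v y)})"
  have op: "open ((\<lambda>w::'a \<Rightarrow> 'b. w i) -` (- {c}))" for i c
    by (rule open_vimage[OF _ continuous_on_product_coordinates]) auto
  have "open ?T"
    by (rule open_INT) (use assms op in auto)
  moreover have "?T \<inter> X = {x}"
  proof (intro subset_antisym subsetI)
    fix w assume w: "w \<in> ?T \<inter> X"
    then have "w \<notin> X - {x}" by auto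
    then show "w \<in> {x}" using w by auto
  qed (use v x in auto)
  ultimately show "x isolated_in X" using x by (auto simp: isolated_in_def)
qed (simp add: isolated_in_def)

text \<open>Elementary symmetric functions of positive integers are positive integers; the form
  \<open>of_nat (Suc r)\<close> expresses this inside the complex numbers.\<close>

lemma coeff_prod_positive_roots:
  fixes V :: "'a set"
  assumes "finite V" "i \<le> card V"
  shows "\<exists>r. coeff (\<Prod>e\<in>V. [:of_nat (Suc (a e)), 1:]) i = (of_nat (Suc r) :: complex)"
  using assms
proof (induction V arbitrary: i rule: finite_induct)
  case empty
  then show ?case by (intro exI[of _ 0]) simp
next
  case (insert e V)
  let ?q = "\<Prod>e\<in>V. [:of_nat (Suc (a e)), 1:] :: complex poly"
  have deg: "degree ?q = card V" by (subst degree_prod_eq_sum_degree) auto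
  have co: "coeff ([:of_nat (Suc (a e)), 1:] * ?q) i = of_nat (Suc (a e)) * coeff ?q i + (case i of 0 \<Rightarrow> 0 | Suc j \<Rightarrow> coeff ?q j)"
    by (simp add: coeff_pCons del: of_nat_Suc)
  have 1: "\<exists>r. of_nat (Suc (a e)) * coeff ?q i = (of_nat (Suc r) :: complex)" if i: "i \<le> card V"
  proof -
    obtain r where "coeff ?q i = of_nat (Suc r)" using insert.IH[OF i] by blast
    then have "of_nat (Suc (a e)) * coeff ?q i = (of_nat (Suc (a e) * Suc r) :: complex)"
      by (simp only: of_nat_mult)
    also have "Suc (a e) * Suc r = Suc (a e * Suc r + r)" by simp
    finally show ?thesis by blast
  qed
  show ?case
  proof (cases i)
    case 0
    then show ?thesis using 1 co insert.hyps by simp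
  next
    case (Suc j)
    then have j: "j \<le> card V" using insert by simp
    obtain r where r: "coeff ?q j = of_nat (Suc r)" using insert.IH[OF j] by blast
    show ?thesis
    proof (cases "i \<le> card V")
      case True
      obtain r' where "of_nat (Suc (a e)) * coeff ?q i = (of_nat (Suc r') :: complex)"
        using 1[OF True] by blast
      then have "coeff ([:of_nat (Suc (a e)), 1:] * ?q) i = of_nat (Suc r' + Suc r)"
        using co r Suc by (simp only: of_nat_add nat.case)
      also have "Suc r' + Suc r = Suc (r' + Suc r)" by simp
      finally show ?thesis using insert.hyps by (auto simp del: of_nat_Suc mult_pCons_left)
    next
      case False
      then have "coeff ?q i = 0" using deg by (intro coeff_eq_0) auto
      then have "coeff ([:of_nat (Suc (a e)), 1:] * ?q) i = of_nat (Suc r)"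
        using co r Suc by simp
      then show ?thesis using insert.hyps by (auto simp del: of_nat_Suc mult_pCons_left)
    qed
  qed
qed

section \<open>Solutions of the system from roots of the eliminant\<close>

context network
begin

lemma sol_nonzero:
  assumes "\<sigma> \<in> S" "v \<in> V"
  shows "sol N k \<sigma> v \<noteq> 0"
proof -
  obtain q t where v: "v = (q, t)" "q \<in> {1..N}" "t \<in> {1..k q}"
    using assms(2) by (cases v) (auto simp: strat_vars_def)
  let ?C = "{e\<in>V. \<sigma> e = q}"
  have card: "card ?C = k q" using assms(1) v by (auto simp: balanced_def)
  have "\<exists>r. coeff (\<Prod>e\<in>?C. [:of_nat (Suc (prod_encode e)), 1:]) (k q - t) = (of_nat (Suc r) :: complex)"
    by (rule coeff_prod_positive_roots) (use card in auto)
  then obtain r where "coeff (\<Prod>e\<in>?C. [:of_nat (Suc (prod_encode e)), 1:]) (k q - t) = (of_nat (Suc r) :: complex)" ..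
  moreover have "sol N k \<sigma> v = coeff (\<Prod>e\<in>?C. [:of_nat (Suc (prod_encode e)), 1:]) (k q - t)"
    using assms(2) v by (simp add: sol_def sol_poly_def node_def del: of_nat_Suc)
  ultimately show ?thesis by (simp del: of_nat_Suc)
qed

lemma sol_solution:
  assumes "\<sigma> \<in> S" "e \<in> V"
  shows "eval_at (sol N k \<sigma>) (f u0 e) = 0"
proof -
  have "\<sigma> e \<in> B e" using assms by (auto simp: balanced_def dest: PiE_mem)
  moreover from this have "eval_at (sol N k \<sigma>) (lin k (\<sigma> e) (node e)) = 0"
    using eval_lin_sol[OF assms(1), of "\<sigma> e" e] B_subset[of e] assms(2) by auto
  ultimately show ?thesis
    unfolding f_u0[OF assms(2)] lin_prod_def eval_at_prod by (intro prod_zero) auto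
qed

lemma solution_iff: "(\<forall>p\<in>indiff_system N G k u. eval_at x p = 0) \<longleftrightarrow> (\<forall>e\<in>V. eval_at x (f u e) = 0)"
  by (auto simp: system_eq)

lemma system_polys: "indiff_system N G k u \<subseteq> polys V"
  by (auto simp: system_eq f_polys)

lemma table_entries_mem: "e \<in> V \<Longrightarrow> \<alpha> \<in> profiles G k (fst e) \<Longrightarrow> (fst e, snd e, \<alpha>) \<in> I \<and> (fst e, 0, \<alpha>) \<in> I"
  by (cases e) (auto simp: table_entries_def strat_vars_def)

text \<open>The solutions are parametrized by the roots of one univariate polynomial: a coordinate of a
  solution is a polynomial in the value of the separating linear form.\<close>

lemma roots_give_solutions:
  assumes inj: "inj_on (\<lambda>\<sigma>. Lf l (sol N k \<sigma>)) S"
    and \<delta>: "polyfun I \<delta>" and p: "\<forall>j<card S. polyfun I (p j)"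
    and r: "\<forall>v\<in>V. \<forall>j<card S. polyfun I (r v j)"
    and chi: "\<And>u x. (\<forall>e\<in>V. eval_at x (f u e) = 0) \<Longrightarrow>
       \<delta> u * Lf l x ^ card S = (\<Sum>j<card S. p j u * Lf l x ^ j)"
    and coord: "\<And>u x v. (\<forall>e\<in>V. eval_at x (f u e) = 0) \<Longrightarrow> v \<in> V \<Longrightarrow>
       \<delta> u * x v = (\<Sum>j<card S. r v j u * Lf l x ^ j)"
    and nz: "\<delta> u \<noteq> 0" and root: "\<delta> u * z ^ card S = (\<Sum>j<card S. p j u * z ^ j)"
    and x: "\<And>v. v \<in> V \<Longrightarrow> \<delta> u * x v = (\<Sum>j<card S. r v j u * z ^ j)"
  shows "(\<forall>e\<in>V. eval_at x (f u e) = 0) \<and> Lf l x = z"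
proof -
  \<comment> \<open>An identity in the table and the form value that holds on all solutions of all
    tables passes to every root for the given table: the coefficients of its remainder vanish
    identically by \<open>incidence_independent\<close>.\<close>
  have transfer: "\<Phi> u z = 0"
    if up: "upolyfun I \<Phi>" and inc: "\<And>u x. (\<forall>e\<in>V. eval_at x (f u e) = 0) \<Longrightarrow> \<Phi> u (Lf l x) = 0" for \<Phi>
  proof -
    obtain M s where s: "\<forall>j<card S. polyfun I (s j)"
      "\<forall>u z. \<delta> u * z ^ card S = (\<Sum>j<card S. p j u * z ^ j) \<longrightarrow> \<delta> u ^ M * \<Phi> u z = (\<Sum>j<card S. s j u * z ^ j)"
      using upolyfun_reducible[OF \<delta> p up] unfolding reducible_mod_def by (elim exE conjE)
    have "s j u = 0" if j: "j < card S" for j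
    proof (rule incidence_independent[where P = s, OF inj _ _ j])
      show "polyfun I (s j)" if "j < card S" for j using s(1) that by blast
      fix u x assume sol: "\<forall>e\<in>V. eval_at x (f u e) = 0"
      have "\<delta> u ^ M * \<Phi> u (Lf l x) = (\<Sum>j<card S. s j u * Lf l x ^ j)"
        using s(2) chi[OF sol] by blast
      then show "(\<Sum>j<card S. s j u * Lf l x ^ j) = 0" using inc[OF sol] by simp
    qed
    then have "\<delta> u ^ M * \<Phi> u z = 0" using s(2) root by simp
    then show ?thesis using nz by simp
  qed
  define \<rho> where "\<rho> v u z = (\<Sum>j<card S. r v j u * z ^ j)" for v u z
  have up_\<rho>: "upolyfun I (\<rho> v)" if "v \<in> V" for v
    unfolding \<rho>_def[abs_def] using r that
    by (intro upolyfun_sum upolyfun_mult upolyfun_power upolyfun_var upolyfun_coeff) auto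
  \<comment> \<open>\<open>\<delta> u\<close> times the probability of strategy \<open>t\<close>;
    the coordinates are polynomial in the root only up to this factor.\<close>
  define Y where "Y q t u z = (if t = 0 then \<delta> u - (\<Sum>r = 1..k q. \<rho> (q, r) u z) else \<rho> (q, t) u z)" for q t u z
  have up_Y: "upolyfun I (Y q t)" if "q \<in> {1..N}" "t \<le> k q" for q t
    unfolding Y_def[abs_def] using that
    by (cases "t = 0")
       (auto intro!: upolyfun_sum upolyfun_diff upolyfun_coeff[OF \<delta>] up_\<rho> simp: strat_vars_def)
  have Y: "Y q t u z = \<delta> u * y x q t"
    if "\<And>v. v \<in> V \<Longrightarrow> \<delta> u * x v = \<rho> v u z" "q \<in> {1..N}" "t \<le> k q" for q t u z x
    using that by (auto simp: Y_def y_def strat_vars_def right_diff_distrib sum_distrib_left)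
  define \<Phi> where "\<Phi> e u z = (\<Sum>\<alpha>\<in>profiles G k (fst e).
      (u (fst e, snd e, \<alpha>) - u (fst e, 0, \<alpha>)) * (\<Prod>q\<in>in_nbrs G (fst e). Y q (\<alpha> q) u z))" for e u z
  have prof: "q \<in> {1..N} \<and> \<alpha> q \<le> k q" if "\<alpha> \<in> profiles G k (fst e)" "q \<in> in_nbrs G (fst e)" for \<alpha> q and e :: "nat \<times> nat"
    using that B_subset[of e] by (auto simp: profiles_def B_def dest: PiE_mem)
  have up_\<Phi>: "upolyfun I (\<Phi> e)" if e: "e \<in> V" for e
    unfolding \<Phi>_def[abs_def] using table_entries_mem[OF e] prof
    by (intro upolyfun_sum upolyfun_mult upolyfun_prod upolyfun_coeff polyfun_diff polyfun_coord up_Y) auto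
  have \<Phi>: "\<Phi> e u z = \<delta> u ^ card (in_nbrs G (fst e)) * eval_at x (f u e)"
    if "\<And>v. v \<in> V \<Longrightarrow> \<delta> u * x v = \<rho> v u z" for e u z x
  proof -
    have "(\<Prod>q\<in>in_nbrs G (fst e). Y q (\<alpha> q) u z) =
        \<delta> u ^ card (in_nbrs G (fst e)) * (\<Prod>q\<in>in_nbrs G (fst e). y x q (\<alpha> q))"
      if \<alpha>: "\<alpha> \<in> profiles G k (fst e)" for \<alpha>
    proof -
      have "(\<Prod>q\<in>in_nbrs G (fst e). Y q (\<alpha> q) u z) = (\<Prod>q\<in>in_nbrs G (fst e). \<delta> u * y x q (\<alpha> q))"
        by (intro prod.cong refl Y) (use prof[OF \<alpha>] \<open>\<And>v. v \<in> V \<Longrightarrow> \<delta> u * x v = \<rho> v u z\<close> in auto)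
      then show ?thesis by (simp add: prod.distrib)
    qed
    then show ?thesis
      by (cases e) (simp add: \<Phi>_def eval_f sum_distrib_left mult_ac)
  qed
  have "eval_at x (f u e) = 0" if e: "e \<in> V" for e
  proof -
    have "\<Phi> e u z = 0"
    proof (rule transfer[OF up_\<Phi>[OF e]])
      fix u x assume sol: "\<forall>e\<in>V. eval_at x (f u e) = 0"
      show "\<Phi> e u (Lf l x) = 0"
        by (subst \<Phi>[of u x]) (use coord[OF sol] sol e in \<open>auto simp: \<rho>_def\<close>)
    qed
    moreover have "\<Phi> e u z = \<delta> u ^ card (in_nbrs G (fst e)) * eval_at x (f u e)"
      by (rule \<Phi>) (simp add: x \<rho>_def)
    ultimately show ?thesis using nz by simp
  qed
  moreover have "Lf l x = z"
  proof -
    \<comment> \<open>Consistency of the parametrization: the separating form at the point built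
      from a root returns that root.\<close>
    let ?\<Psi> = "\<lambda>u z. (\<Sum>v\<in>V. l v * \<rho> v u z) - \<delta> u * z"
    have \<Psi>: "?\<Psi> u z = \<delta> u * (Lf l x - z)" if "\<And>v. v \<in> V \<Longrightarrow> \<delta> u * x v = \<rho> v u z" for u z x
      by (simp add: Lf_def right_diff_distrib sum_distrib_left mult.left_commute flip: that)
    have "?\<Psi> u z = 0"
    proof (rule transfer[where \<Phi> = ?\<Psi>])
      show "upolyfun I ?\<Psi>"
        by (intro upolyfun_diff upolyfun_sum upolyfun_mult up_\<rho> upolyfun_coeff polyfun_const \<delta> upolyfun_var)
      fix u x assume sol: "\<forall>e\<in>V. eval_at x (f u e) = 0"
      show "?\<Psi> u (Lf l x) = 0"
        by (subst \<Psi>[of u x]) (use coord[OF sol] in \<open>auto simp: \<rho>_def\<close>)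
    qed
    then show ?thesis using \<Psi>[of u x z] x nz by (simp add: \<rho>_def)
  qed
  ultimately show ?thesis by blast
qed

end

lemma pderiv_sum: "pderiv (sum p A) = (\<Sum>a\<in>A. pderiv (p a))"
  by (induction A rule: infinite_finite_induct) (auto simp: pderiv_add)

section \<open>The number of solutions for a generic table\<close>

context network
begin

text \<open>\<open>spanning\<close> is applied in three ways. \<open>H = 1\<close> yields the
  eliminant and the coordinates, hence an upper bound; the derivative of the eliminant makes its
  roots simple; a variable keeps the solutions in the torus. Nothing is lost because
  \<open>roots_give_solutions\<close> turns every root into a solution.\<close>

lemma generic_count:
  "\<exists>\<Delta>. polyfun I \<Delta> \<and> \<Delta> u0 \<noteq> 0 \<and> (\<forall>u. \<Delta> u \<noteq> 0 \<longrightarrow> has_solution_count N G k u (card S))"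
proof -
  let ?D = "card S"
  let ?id = "\<lambda>u. ideal_gen V (indiff_system N G k u)"
  obtain l where "inj_on (\<lambda>x. \<Sum>v\<in>V. l v * x v) (sol N k ` S)"
  proof (rule separating_functional[of "sol N k ` S" V])
    fix x y assume "x \<in> sol N k ` S" "y \<in> sol N k ` S" "\<forall>v\<in>V. x v = y v"
    then show "x = y" using sol_node_unique by auto
  qed auto
  moreover have "inj_on (sol N k) S" by (rule inj_onI) (metis sol_node_unique)
  ultimately have inj: "inj_on (\<lambda>\<sigma>. Lf l (sol N k \<sigma>)) S"
    by (auto simp: inj_on_def Lf_def)
  \<comment> \<open>Large enough for all uses of \<open>spanning\<close>, where \<open>H\<close> has
    degree bound 0, 1 or \<open>card S\<close>.\<close>
  define d where "d = 3 + (\<Sum>e\<in>V. card (B e)) + 2 * ?D"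
  have ev_id: "eval_at x P = 0" if "P \<in> ?id u" "\<forall>e\<in>V. eval_at x (f u e) = 0" for P u x
    using eval_at_ideal_gen[OF that(1)] that(2) solution_iff by blast
  have upto_d: "Lp l ^ ?D \<in> polys_upto V (\<lambda>_. d)" "1 \<in> polys_upto V (\<lambda>_. d)"
    "\<And>v. v \<in> V \<Longrightarrow> Var v \<in> polys_upto V (\<lambda>_. d)"
    by (rule polys_upto_mono[OF Lp_power_upto]) (auto simp: d_def intro: polys_upto_one polys_upto_Var)
  have "\<exists>\<delta>. polyfun I \<delta> \<and> \<delta> u0 \<noteq> 0 \<and> (\<forall>P\<in>polys_upto V (\<lambda>_. d). \<exists>c. (\<forall>j<?D. polyfun I (c j)) \<and>
    (\<forall>u. Cst (\<delta> u) * P - (\<Sum>j<?D. Cst (c j u) * (Lp l ^ j * 1)) \<in> ?id u))"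
    by (rule spanning[where H = "\<lambda>_. 1" and h = 0, OF inj])
       (auto intro: polys_upto_one polyfun_const simp: d_def)
  then obtain \<delta> where \<delta>: "polyfun I \<delta>" "\<delta> u0 \<noteq> 0" and
    el: "\<forall>P\<in>polys_upto V (\<lambda>_. d). \<exists>c. (\<forall>j<?D. polyfun I (c j)) \<and>
    (\<forall>u. Cst (\<delta> u) * P - (\<Sum>j<?D. Cst (c j u) * Lp l ^ j) \<in> ?id u)"
    by (elim exE conjE) simp
  obtain p where p: "\<forall>j<?D. polyfun I (p j)"
    "\<forall>u. Cst (\<delta> u) * Lp l ^ ?D - (\<Sum>j<?D. Cst (p j u) * Lp l ^ j) \<in> ?id u"
    using bspec[OF el upto_d(1)] by (elim exE conjE)
  have "\<forall>v\<in>V. \<exists>c. (\<forall>j<?D. polyfun I (c j)) \<and>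
    (\<forall>u. Cst (\<delta> u) * Var v - (\<Sum>j<?D. Cst (c j u) * Lp l ^ j) \<in> ?id u)"
    using el upto_d(3) by blast
  from bchoice[OF this] obtain r where r: "\<forall>v\<in>V. (\<forall>j<?D. polyfun I (r v j)) \<and>
    (\<forall>u. Cst (\<delta> u) * Var v - (\<Sum>j<?D. Cst (r v j u) * Lp l ^ j) \<in> ?id u)"
    by (elim exE)
  have chi: "\<delta> u * Lf l x ^ ?D = (\<Sum>j<?D. p j u * Lf l x ^ j)"
    if "\<forall>e\<in>V. eval_at x (f u e) = 0" for u x
    using ev_id[OF p(2)[rule_format, of u] that] by simp
  have coord: "\<delta> u * x v = (\<Sum>j<?D. r v j u * Lf l x ^ j)"
    if "\<forall>e\<in>V. eval_at x (f u e) = 0" "v \<in> V" for u x v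
    using ev_id[OF _ that(1), of "Cst (\<delta> u) * Var v - (\<Sum>j<?D. Cst (r v j u) * Lp l ^ j)"] r that(2) by simp
  define ch where "ch u = Polynomial.monom (\<delta> u) ?D - (\<Sum>j<?D. Polynomial.monom (p j u) j)" for u
  have poly_ch: "poly (ch u) z = \<delta> u * z ^ ?D - (\<Sum>j<?D. p j u * z ^ j)" for u z
    by (simp add: ch_def poly_monom poly_sum)
  have coeff_ch: "coeff (ch u) ?D = \<delta> u" "\<And>n. n > ?D \<Longrightarrow> coeff (ch u) n = 0"
    "\<And>n. n < ?D \<Longrightarrow> coeff (ch u) n = - p n u" for u
    by (simp_all add: ch_def coeff_sum)
  \<comment> \<open>The derivative of the eliminant at the separating form. Where an exponent is
    truncated, the factor \<open>of_nat 0\<close> removes the term.\<close>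
  define H where "H u = Cst (of_nat ?D * \<delta> u) * Lp l ^ (?D - 1) -
      (\<Sum>j<?D. Cst (of_nat j * p j u) * Lp l ^ (j - 1))" for u
  have eval_H: "eval_at x (H u) = poly (pderiv (ch u)) (Lf l x)" for x u
    by (simp add: H_def ch_def pderiv_diff pderiv_sum pderiv_monom poly_sum poly_monom)
  have H_upto: "H u \<in> polys_upto V (\<lambda>_. ?D)" for u
    unfolding H_def
    by (intro polys_upto_diff polys_upto_sum polys_upto_Cst_mult polys_upto_mono[OF Lp_power_upto]) auto
  have H_pf: "polyfun I (\<lambda>u. Poly_Mapping.lookup (H u) m)" for m
    unfolding H_def lookup_minus lookup_sum lookup_Cst_mult
    using p(1) \<delta>(1) by (intro polyfun_intros) auto
  have H_nz: "eval_at (sol N k \<sigma>) (H u0) \<noteq> 0" if \<sigma>: "\<sigma> \<in> S" for \<sigma>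
    unfolding eval_H
  proof (rule distinct_roots_pderiv)
    let ?Z = "(\<lambda>\<sigma>. Lf l (sol N k \<sigma>)) ` S"
    have cZ: "card ?Z = ?D" by (rule card_image[OF inj])
    show "coeff (ch u0) n = 0" if "n > card ?Z" for n using coeff_ch(2) that cZ by simp
    show "ch u0 \<noteq> 0" using coeff_ch(1)[of u0] \<delta>(2) by auto
    show "poly (ch u0) z = 0" if z: "z \<in> ?Z" for z
    proof -
      obtain \<tau> where \<tau>: "\<tau> \<in> S" "z = Lf l (sol N k \<tau>)" using z by blast
      then have "\<forall>e\<in>V. eval_at (sol N k \<tau>) (f u0 e) = 0" using sol_solution by blast
      from chi[OF this] show ?thesis by (simp add: poly_ch \<tau>(2))
    qed
    show "Lf l (sol N k \<sigma>) \<in> ?Z" using \<sigma> by simp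
    show "finite ?Z" by simp
  qed
  have "\<exists>\<delta>. polyfun I \<delta> \<and> \<delta> u0 \<noteq> 0 \<and> (\<forall>P\<in>polys_upto V (\<lambda>_. d). \<exists>c. (\<forall>j<?D. polyfun I (c j)) \<and>
    (\<forall>u. Cst (\<delta> u) * P - (\<Sum>j<?D. Cst (c j u) * (Lp l ^ j * H u)) \<in> ?id u))"
    by (rule spanning[where H = H and h = ?D, OF inj H_upto H_pf H_nz]) (auto simp: d_def)
  then obtain \<delta>' where \<delta>': "polyfun I \<delta>'" "\<delta>' u0 \<noteq> 0" and
    el': "\<forall>P\<in>polys_upto V (\<lambda>_. d). \<exists>c. (\<forall>j<?D. polyfun I (c j)) \<and>
    (\<forall>u. Cst (\<delta>' u) * P - (\<Sum>j<?D. Cst (c j u) * (Lp l ^ j * H u)) \<in> ?id u)"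
    by (elim exE conjE)
  \<comment> \<open>The polynomial 1 is reduced to a multiple of \<open>H u\<close>: where
    \<open>\<delta>' u\<close> is nonzero, \<open>H u\<close> cannot vanish at a solution.\<close>
  obtain c where c: "\<forall>u. Cst (\<delta>' u) * 1 - (\<Sum>j<?D. Cst (c j u) * (Lp l ^ j * H u)) \<in> ?id u"
    using bspec[OF el' upto_d(2)] by (elim exE conjE)
  have simple: "poly (pderiv (ch u)) (Lf l x) \<noteq> 0"
    if "\<delta>' u \<noteq> 0" "\<forall>e\<in>V. eval_at x (f u e) = 0" for u x
    using ev_id[OF c[rule_format, of u] that(2)] that(1) by (auto simp: eval_H)
  have "\<exists>\<delta>. polyfun I \<delta> \<and> \<delta> u0 \<noteq> 0 \<and>
      (\<forall>u x. \<delta> u \<noteq> 0 \<longrightarrow> (\<forall>e\<in>V. eval_at x (f u e) = 0) \<longrightarrow> x v \<noteq> 0)" if v: "v \<in> V" for v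
  proof -
    have "\<exists>\<delta>. polyfun I \<delta> \<and> \<delta> u0 \<noteq> 0 \<and> (\<forall>P\<in>polys_upto V (\<lambda>_. d). \<exists>c. (\<forall>j<?D. polyfun I (c j)) \<and>
      (\<forall>u. Cst (\<delta> u) * P - (\<Sum>j<?D. Cst (c j u) * (Lp l ^ j * Var v)) \<in> ?id u))"
      by (rule spanning[where H = "\<lambda>_. Var v" and h = 1, OF inj])
         (use v sol_nonzero in \<open>auto simp: d_def intro: polys_upto_Var polyfun_const\<close>)
    then obtain \<epsilon> where \<epsilon>: "polyfun I \<epsilon>" "\<epsilon> u0 \<noteq> 0" and
      el'': "\<forall>P\<in>polys_upto V (\<lambda>_. d). \<exists>c. (\<forall>j<?D. polyfun I (c j)) \<and>
      (\<forall>u. Cst (\<epsilon> u) * P - (\<Sum>j<?D. Cst (c j u) * (Lp l ^ j * Var v)) \<in> ?id u)"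
      by (elim exE conjE)
    obtain c where c: "\<forall>u. Cst (\<epsilon> u) * 1 - (\<Sum>j<?D. Cst (c j u) * (Lp l ^ j * Var v)) \<in> ?id u"
      using bspec[OF el'' upto_d(2)] by (elim exE conjE)
    have "x v \<noteq> 0" if "\<epsilon> u \<noteq> 0" "\<forall>e\<in>V. eval_at x (f u e) = 0" for u x
      using ev_id[OF c[rule_format, of u] that(2)] that(1) by auto
    then show ?thesis using \<epsilon> by blast
  qed
  then have "\<forall>v\<in>V. \<exists>\<delta>. polyfun I \<delta> \<and> \<delta> u0 \<noteq> 0 \<and>
      (\<forall>u x. \<delta> u \<noteq> 0 \<longrightarrow> (\<forall>e\<in>V. eval_at x (f u e) = 0) \<longrightarrow> x v \<noteq> 0)" by blast
  from bchoice[OF this] obtain \<epsilon> where \<epsilon>: "\<forall>v\<in>V. polyfun I (\<epsilon> v) \<and> \<epsilon> v u0 \<noteq> 0 \<and>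
      (\<forall>u x. \<epsilon> v u \<noteq> 0 \<longrightarrow> (\<forall>e\<in>V. eval_at x (f u e) = 0) \<longrightarrow> x v \<noteq> 0)"
    by (elim exE)
  define \<Delta> where "\<Delta> u = \<delta> u * \<delta>' u * (\<Prod>v\<in>V. \<epsilon> v u)" for u
  have "polyfun I \<Delta>"
    unfolding \<Delta>_def[abs_def] using \<delta>(1) \<delta>'(1) \<epsilon> by (intro polyfun_intros) auto
  moreover have "\<Delta> u0 \<noteq> 0" using \<delta>(2) \<delta>'(2) \<epsilon> by (simp add: \<Delta>_def)
  moreover have "has_solution_count N G k u ?D" if u: "\<Delta> u \<noteq> 0" for u
  proof -
    have nz: "\<delta> u \<noteq> 0" "\<delta>' u \<noteq> 0" and nzv: "\<And>v. v \<in> V \<Longrightarrow> \<epsilon> v u \<noteq> 0"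
      using u by (auto simp: \<Delta>_def)
    define M where "M = {z. poly (ch u) z = 0}"
    \<comment> \<open>The point whose coordinates are read off the root; \<open>restrict\<close>
      makes it extensional, like the points of the torus.\<close>
    define X where "X z = restrict (\<lambda>v. (\<Sum>j<?D. r v j u * z ^ j) / \<delta> u) V" for z
    have X: "(\<forall>e\<in>V. eval_at (X z) (f u e) = 0) \<and> Lf l (X z) = z" if "z \<in> M" for z
    proof (rule roots_give_solutions[OF inj \<delta>(1) p(1) _ chi coord nz(1)])
      show "\<forall>v\<in>V. \<forall>j<?D. polyfun I (r v j)" using r by blast
      show "\<delta> u * z ^ ?D = (\<Sum>j<?D. p j u * z ^ j)" using that by (simp add: M_def poly_ch)
      show "\<delta> u * X z v = (\<Sum>j<?D. r v j u * z ^ j)" if "v \<in> V" for v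
        using that nz(1) by (simp add: X_def)
    qed
    have ch0: "ch u \<noteq> 0" using coeff_ch(1)[of u] nz(1) by auto
    have deg: "degree (ch u) = ?D"
    proof (rule antisym)
      show "degree (ch u) \<le> ?D" by (rule degree_le) (use coeff_ch(2) in auto)
      show "?D \<le> degree (ch u)" by (rule le_degree) (use coeff_ch(1) nz(1) in auto)
    qed
    have simple_M: "poly (pderiv (ch u)) z \<noteq> 0" if "poly (ch u) z = 0" for z
      using simple[OF nz(2), of "X z"] X[of z] that by (simp add: M_def)
    have card_M: "card M = ?D"
      unfolding M_def using simple_roots_card[OF simple_M] deg by simp
    have fin_M: "finite M" unfolding M_def by (rule poly_roots_finite[OF ch0])
    have injX: "inj_on X M" using X by (metis inj_onI)
    have torus: "torus_solutions N G k u = X ` M"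
    proof (intro subset_antisym subsetI)
      fix x assume "x \<in> torus_solutions N G k u"
      then have x: "x \<in> V \<rightarrow>\<^sub>E (- {0})" "\<forall>e\<in>V. eval_at x (f u e) = 0"
        by (auto simp: torus_solutions_def ctorus_def solution_iff)
      have "x = X (Lf l x)"
      proof (rule PiE_ext[where s = "\<lambda>_. UNIV"])
        show "x \<in> V \<rightarrow>\<^sub>E UNIV" using x(1) by (auto simp: PiE_def)
        show "X (Lf l x) \<in> V \<rightarrow>\<^sub>E UNIV" by (simp add: X_def)
        show "x v = X (Lf l x) v" if "v \<in> V" for v
          using coord[OF x(2) that] that nz(1) by (simp add: X_def field_simps)
      qed
      moreover have "Lf l x \<in> M" using chi[OF x(2)] by (simp add: M_def poly_ch)
      ultimately show "x \<in> X ` M" by blast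
    next
      fix x assume "x \<in> X ` M"
      then obtain z where z: "z \<in> M" "x = X z" by blast
      have "\<forall>v\<in>V. X z v \<noteq> 0" using \<epsilon> nzv X[OF z(1)] by blast
      then show "x \<in> torus_solutions N G k u"
        using X[OF z(1)] z(2) by (auto simp: torus_solutions_def ctorus_def solution_iff X_def)
    qed
    then have fin_torus: "finite (torus_solutions N G k u)" using fin_M by simp
    have isol: "isolated_solutions N G k u = X ` M"
      using finite_imp_isolated_in[OF fin_torus] torus by (auto simp: isolated_solutions_def)
    have mult: "multiplicity_at V (indiff_system N G k u) (X z) = 1" if z: "z \<in> M" for z
    proof (rule multiplicity_one)
      \<comment> \<open>\<open>h\<close> vanishes at the other solutions but not at this one, so it
        is a unit of the local ring that removes them.\<close>
      define h where "h = (\<Prod>w\<in>M - {z}. (Lp l - Cst w))"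
      define W where "W = (\<Prod>w\<in>M. (Lp l - Cst w))"
      have W_eq: "W = h * (Lp l - Cst z)"
        unfolding W_def h_def using fin_M z by (simp add: prod.remove mult.commute)
      show h: "h \<in> polys V" unfolding h_def by (intro polys_prod polys_diff Lp_polys polys_Cst)
      show "eval_at (X z) h \<noteq> 0" unfolding h_def using fin_M X[OF z] by simp
      have "ch u = smult (lead_coeff (ch u)) (\<Prod>z|poly (ch u) z = 0. [:-z, 1:])"
        by (rule complex_poly_decompose_rsquarefree[symmetric]) (use simple_M in \<open>auto simp: rsquarefree_roots\<close>)
      then have ch_eq: "ch u = smult (\<delta> u) (\<Prod>z\<in>M. [:-z, 1:])"
        unfolding deg coeff_ch(1) M_def .
      have "Cst (\<delta> u) * W = (\<Sum>i\<le>?D. Cst (coeff (ch u) i) * Lp l ^ i)"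
        unfolding W_def ch_eq using sum_coeff_prod_linear[OF fin_M, of ?D "Lp l"] card_M
        by (simp add: Cst_mult mult.assoc flip: sum_distrib_left)
      also have "\<dots> = Cst (\<delta> u) * Lp l ^ ?D - (\<Sum>j<?D. Cst (p j u) * Lp l ^ j)"
        by (subst lessThan_Suc_atMost[symmetric]) (simp add: coeff_ch Cst_uminus sum_negf)
      finally have "Cst (\<delta> u) * W \<in> ?id u" using p(2) by simp
      then have "Cst (1 / \<delta> u) * (Cst (\<delta> u) * W) \<in> ?id u" by (rule ideal_gen_mult) simp
      then have W: "W \<in> ?id u" using nz(1) by (simp add: mult.assoc[symmetric] flip: Cst_mult)
      show "h * (Var v - Cst (X z v)) \<in> ?id u" if v: "v \<in> V" for v
      proof -
        \<comment> \<open>A difference of powers is divisible by the difference of the bases, so its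
          product with \<open>h\<close> is a multiple of \<open>W\<close>, which lies in the
          ideal.\<close>
        have div: "\<exists>Q\<in>polys V. Lp l ^ j - Cst (z ^ j) = (Lp l - Cst z) * Q" for j
        proof (induction j)
          case (Suc j)
          then obtain Q where Q: "Q \<in> polys V" "Lp l ^ j - Cst (z ^ j) = (Lp l - Cst z) * Q" by blast
          have "Lp l ^ Suc j - Cst (z ^ Suc j) = Lp l * (Lp l ^ j - Cst (z ^ j)) + (Lp l - Cst z) * Cst (z ^ j)"
            by (simp add: Cst_mult algebra_simps)
          also have "\<dots> = (Lp l - Cst z) * (Lp l * Q + Cst (z ^ j))"
            unfolding Q(2) by (simp add: algebra_simps)
          finally show ?case using Q(1) by (blast intro: polys_add polys_mult Lp_polys polys_Cst)
        qed (auto intro: bexI[of _ 0])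
        have "h * (Lp l ^ j - Cst (z ^ j)) \<in> ?id u" for j
        proof -
          obtain Q where Q: "Q \<in> polys V" "Lp l ^ j - Cst (z ^ j) = (Lp l - Cst z) * Q" using div by blast
          have "h * (Lp l ^ j - Cst (z ^ j)) = Q * W" unfolding Q(2) W_eq by (simp add: mult_ac)
          then show ?thesis using ideal_gen_mult[OF W Q(1)] by simp
        qed
        then have 1: "(\<Sum>j<?D. Cst (r v j u) * (h * (Lp l ^ j - Cst (z ^ j)))) \<in> ?id u"
          by (rule_tac ideal_gen_sum, rule_tac ideal_gen_mult[OF _ polys_Cst])
        have 2: "h * (Cst (\<delta> u) * Var v - (\<Sum>j<?D. Cst (r v j u) * Lp l ^ j)) \<in> ?id u"
          using r v by (intro ideal_gen_mult h) blast
        have "\<delta> u * X z v = (\<Sum>j<?D. r v j u * z ^ j)"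
          using v nz(1) by (simp add: X_def)
        then have "Cst (\<delta> u) * Cst (X z v) = (\<Sum>j<?D. Cst (r v j u) * Cst (z ^ j))"
          by (simp flip: Cst_mult Cst_sum)
        then have "Cst (\<delta> u) * (h * (Var v - Cst (X z v))) =
          h * (Cst (\<delta> u) * Var v - (\<Sum>j<?D. Cst (r v j u) * Lp l ^ j)) +
          (\<Sum>j<?D. Cst (r v j u) * (h * (Lp l ^ j - Cst (z ^ j))))"
        proof -
          have "(\<Sum>j<?D. Cst (r v j u) * (h * (Lp l ^ j - Cst (z ^ j)))) =
              h * (\<Sum>j<?D. Cst (r v j u) * Lp l ^ j) - h * (\<Sum>j<?D. Cst (r v j u) * Cst (z ^ j))"
            by (simp add: right_diff_distrib sum_subtractf sum_distrib_left mult.left_commute)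
          also have "(\<Sum>j<?D. Cst (r v j u) * Cst (z ^ j)) = Cst (\<delta> u) * Cst (X z v)"
            using \<open>Cst (\<delta> u) * Cst (X z v) = _\<close> by (rule sym)
          finally show ?thesis by (simp add: algebra_simps)
        qed
        then have "Cst (\<delta> u) * (h * (Var v - Cst (X z v))) \<in> ?id u"
          using ideal_gen_add[OF 2 1] by simp
        then have "Cst (1 / \<delta> u) * (Cst (\<delta> u) * (h * (Var v - Cst (X z v)))) \<in> ?id u"
          by (rule ideal_gen_mult) simp
        then show ?thesis using nz(1) by (simp add: mult.assoc[symmetric] flip: Cst_mult)
      qed
    next
      show "finite V" by simp
      show "indiff_system N G k u \<subseteq> polys V" by (rule system_polys)
      show "eval_at (X z) p = 0" if "p \<in> indiff_system N G k u" for p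
        using X[OF z] that solution_iff by blast
    qed
    have "(\<Sum>x\<in>X ` M. multiplicity_at V (indiff_system N G k u) x) = (\<Sum>x\<in>X ` M. 1)"
      by (intro sum.cong refl) (use mult in auto)
    also have "\<dots> = enat ?D"
      using card_image[OF injX] card_M by (simp add: of_nat_eq_enat)
    finally show ?thesis
      unfolding has_solution_count_def isol using fin_M by simp
  qed
  ultimately show ?thesis by (intro exI[of _ \<Delta>] conjI allI impI)
qed

lemma algebraic_degree_eq: "algebraic_degree N G k = card S"
proof -
  obtain \<Delta> where \<Delta>: "polyfun I \<Delta>" "\<Delta> u0 \<noteq> 0" "\<forall>u. \<Delta> u \<noteq> 0 \<longrightarrow> has_solution_count N G k u (card S)"
    using generic_count by (elim exE conjE)
  obtain P where P: "P \<in> polys I" "\<And>u. \<Delta> u = eval_at u P"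
    by (rule polyfun_imp_eval_at[OF \<Delta>(1)]) blast
  let ?U = "{x \<in> I \<rightarrow>\<^sub>E UNIV. \<exists>P\<in>{P}. eval_at x P \<noteq> 0}"
  show ?thesis
    unfolding algebraic_degree_def
  proof (rule the_equality)
    show "\<exists>U. zariski_open I U \<and> U \<noteq> {} \<and> (\<forall>u\<in>U. has_solution_count N G k u (card S))"
    proof (intro exI[of _ ?U] conjI)
      show "zariski_open I ?U" unfolding zariski_open_def using P(1) by (intro exI[of _ "{P}"]) auto
      have "\<Delta> (restrict u0 I) \<noteq> 0" using polyfun_cong[OF \<Delta>(1), of "restrict u0 I" u0] \<Delta>(2) by simp
      then have "restrict u0 I \<in> ?U" using P(2) by simp
      then show "?U \<noteq> {}" by blast
      show "\<forall>u\<in>?U. has_solution_count N G k u (card S)" using \<Delta>(3) P(2) by simp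
    qed
    fix n assume "\<exists>U. zariski_open I U \<and> U \<noteq> {} \<and> (\<forall>u\<in>U. has_solution_count N G k u n)"
    then obtain U where U: "zariski_open I U" "U \<noteq> {}" "\<forall>u\<in>U. has_solution_count N G k u n"
      by (elim exE conjE)
    obtain T where T: "T \<subseteq> polys I" "U = {x \<in> I \<rightarrow>\<^sub>E UNIV. \<exists>P\<in>T. eval_at x P \<noteq> 0}"
      using U(1) unfolding zariski_open_def by (elim exE conjE)
    obtain w where "w \<in> U" using U(2) by blast
    then have "\<exists>Q\<in>T. eval_at w Q \<noteq> 0" unfolding T(2) by simp
    then obtain Q where Q: "Q \<in> T" "eval_at w Q \<noteq> 0" by (elim bexE)
    then have "Q \<in> polys I" using T(1) by (auto dest: subsetD)
    then have pfQ: "polyfun I (\<lambda>u. eval_at u Q)" by (rule polyfun_eval_at)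
    obtain v where v: "\<Delta> v \<noteq> 0" "eval_at v Q \<noteq> 0"
      using polyfun_nonzero_common[where P = \<Delta> and Q = "\<lambda>u. eval_at u Q" and u = u0 and w = w and I = I
        and thesis = thesis, OF \<Delta>(1) pfQ \<Delta>(2) Q(2)] by simp
    \<comment> \<open>Members of a Zariski-open set are extensional, so the common point is cut down
      to the table entries.\<close>
    let ?v = "restrict v I"
    have "\<Delta> ?v \<noteq> 0" using polyfun_cong[OF \<Delta>(1), of ?v v] v by simp
    moreover have "eval_at ?v Q \<noteq> 0" using polyfun_cong[OF pfQ, of ?v v] v by simp
    ultimately have "has_solution_count N G k ?v (card S)" "?v \<in> U"
      using \<Delta>(3) Q(1) unfolding T(2) by auto
    moreover from this have "has_solution_count N G k ?v n" using U(3) by blast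
    ultimately show "n = card S" unfolding has_solution_count_def by simp
  qed
qed

end

section \<open>Gaussian integrals\<close>

text \<open>Completing the square gives a multiple of the normal density with mean
  \<open>- b / a\<close> and variance \<open>1 / a\<close>.\<close>

lemma nn_integral_gaussian_1d:
  fixes a b :: real
  assumes "a > 0"
  shows "(\<integral>\<^sup>+y. ennreal (exp (- (a * y\<^sup>2 + 2 * b * y) / 2)) \<partial>lborel) =
    ennreal (sqrt (2 * pi / a) * exp (b\<^sup>2 / (2 * a)))"
proof -
  let ?d = "normal_density (- b / a) (1 / sqrt a)"
  let ?c = "sqrt (2 * pi / a) * exp (b\<^sup>2 / (2 * a))"
  have "exp (- (a * y\<^sup>2 + 2 * b * y) / 2) = ?c * ?d y" for y
  proof -
    have sq: "(y + b / a)\<^sup>2 / (2 / a) = (a * y\<^sup>2 + 2 * b * y) / 2 + b\<^sup>2 / (2 * a)"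
      using assms by (simp add: power2_eq_square field_simps)
    have "?d y = 1 / sqrt (2 * pi / a) * exp (- ((y + b / a)\<^sup>2 / (2 / a)))"
      using assms by (simp add: normal_density_def power_divide)
    also have "\<dots> = 1 / sqrt (2 * pi / a) * (exp (- (a * y\<^sup>2 + 2 * b * y) / 2) * exp (- (b\<^sup>2 / (2 * a))))"
      unfolding sq minus_add_distrib exp_add minus_divide_left ..
    finally have "?c * ?d y = (sqrt (2 * pi / a) * (1 / sqrt (2 * pi / a))) *
        (exp (b\<^sup>2 / (2 * a)) * exp (- (b\<^sup>2 / (2 * a)))) * exp (- (a * y\<^sup>2 + 2 * b * y) / 2)"
      by (simp only: mult_ac)
    also have "sqrt (2 * pi / a) * (1 / sqrt (2 * pi / a)) = 1" using assms by simp
    also have "exp (b\<^sup>2 / (2 * a)) * exp (- (b\<^sup>2 / (2 * a))) = 1" by (simp flip: exp_add)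
    finally show ?thesis by simp
  qed
  then have "(\<integral>\<^sup>+y. ennreal (exp (- (a * y\<^sup>2 + 2 * b * y) / 2)) \<partial>lborel) =
      (\<integral>\<^sup>+y. ennreal ?c * ennreal (?d y) \<partial>lborel)"
    using assms by (simp add: ennreal_mult)
  also have "\<dots> = ennreal ?c * (\<integral>\<^sup>+y. ennreal (?d y) \<partial>lborel)"
    by (rule nn_integral_cmult) simp
  also have "(\<integral>\<^sup>+y. ennreal (?d y) \<partial>lborel) = 1"
    using assms by (subst nn_integral_eq_integral) auto
  finally show ?thesis by simp
qed

definition qform :: "nat \<Rightarrow> (nat \<Rightarrow> nat \<Rightarrow> real) \<Rightarrow> (nat \<Rightarrow> real) \<Rightarrow> real" where
  "qform n Q x = (\<Sum>i<n. \<Sum>j<n. Q i j * x i * x j)"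

definition pos_def :: "nat \<Rightarrow> (nat \<Rightarrow> nat \<Rightarrow> real) \<Rightarrow> bool" where
  "pos_def n Q \<longleftrightarrow> (\<forall>i<n. \<forall>j<n. Q i j = Q j i) \<and> (\<forall>x. (\<exists>i<n. x i \<noteq> 0) \<longrightarrow> 0 < qform n Q x)"

text \<open>The Schur complement of the last diagonal entry: the form that remains when the last
  variable is minimized over or integrated out.\<close>

definition schur :: "nat \<Rightarrow> (nat \<Rightarrow> nat \<Rightarrow> real) \<Rightarrow> nat \<Rightarrow> nat \<Rightarrow> real" where
  "schur n Q i j = Q i j - Q i n * Q n j / Q n n"

lemma qform_Suc:
  assumes "\<forall>i<Suc n. \<forall>j<Suc n. Q i j = Q j i"
  shows "qform (Suc n) Q (x(n := y)) = qform n Q x + 2 * (\<Sum>j<n. Q n j * x j) * y + Q n n * y\<^sup>2"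
proof -
  have "(\<Sum>i<n. Q i n * x i) = (\<Sum>j<n. Q n j * x j)" using assms by (intro sum.cong) auto
  moreover have "qform (Suc n) Q (x(n := y)) = qform n Q x + (\<Sum>i<n. Q i n * x i) * y +
      (\<Sum>j<n. Q n j * x j) * y + Q n n * y\<^sup>2"
    by (simp add: qform_def sum.distrib sum_distrib_right sum_distrib_left power2_eq_square mult_ac)
  ultimately show ?thesis by simp
qed

lemma qform_schur:
  assumes "\<forall>i<Suc n. \<forall>j<Suc n. Q i j = Q j i"
  shows "qform n (schur n Q) x = qform n Q x - (\<Sum>j<n. Q n j * x j)\<^sup>2 / Q n n"
proof -
  have "(\<Sum>i<n. \<Sum>j<n. Q i n * Q n j / Q n n * x i * x j) = (\<Sum>i<n. Q i n * x i) * (\<Sum>j<n. Q n j * x j) / Q n n"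
    by (simp add: sum_product sum_divide_distrib mult_ac)
  also have "(\<Sum>i<n. Q i n * x i) = (\<Sum>j<n. Q n j * x j)" using assms by (intro sum.cong) auto
  finally show ?thesis
    by (simp add: qform_def schur_def left_diff_distrib sum_subtractf power2_eq_square)
qed

lemma pos_def_schur:
  assumes "pos_def (Suc n) Q"
  shows "Q n n > 0" "pos_def n (schur n Q)"
proof -
  have sym: "\<forall>i<Suc n. \<forall>j<Suc n. Q i j = Q j i" using assms by (simp add: pos_def_def)
  have pos: "0 < qform (Suc n) Q x" if "\<exists>i<Suc n. x i \<noteq> 0" for x
    using assms that by (simp add: pos_def_def)
  have "0 < qform (Suc n) Q ((\<lambda>_. 0)(n := 1))" by (rule pos) (auto intro: exI[of _ n])
  then show a: "Q n n > 0" unfolding qform_Suc[OF sym] by (simp add: qform_def)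
  show "pos_def n (schur n Q)"
    unfolding pos_def_def
  proof (intro conjI allI impI)
    fix i j assume "i < n" "j < n"
    then show "schur n Q i j = schur n Q j i" using sym by (auto simp: schur_def)
  next
    fix x :: "nat \<Rightarrow> real" assume "\<exists>i<n. x i \<noteq> 0"
    then obtain i where i: "i < n" "x i \<noteq> 0" by blast
    let ?b = "\<Sum>j<n. Q n j * x j"
    \<comment> \<open>The chosen last coordinate minimizes the form for given
      \<open>x\<close>.\<close>
    have "0 < qform (Suc n) Q (x(n := - ?b / Q n n))"
      by (rule pos) (use i in \<open>auto intro!: exI[of _ i]\<close>)
    also have "\<dots> = qform n (schur n Q) x"
      unfolding qform_Suc[OF sym] qform_schur[OF sym] using a by (simp add: field_simps power2_eq_square)
    finally show "0 < qform n (schur n Q) x" .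
  qed
qed

text \<open>Elimination of the last column as a block factorization: an upper unitriangular factor
  \<open>?L\<close> times a block lower triangular factor \<open>?M\<close>.\<close>

lemma det_schur:
  fixes Q :: "nat \<Rightarrow> nat \<Rightarrow> real"
  assumes "Q n n \<noteq> 0"
  shows "Determinant.det (mat (Suc n) (Suc n) (\<lambda>(i, j). Q i j)) =
    Determinant.det (mat n n (\<lambda>(i, j). schur n Q i j)) * Q n n"
proof -
  let ?S = "mat n n (\<lambda>(i, j). schur n Q i j)"
  let ?a = "mat 1 1 (\<lambda>_. Q n n)"
  let ?L = "four_block_mat (1\<^sub>m n) (mat n 1 (\<lambda>(i, _). Q i n / Q n n)) (0\<^sub>m 1 n) (1\<^sub>m 1)"
  let ?M = "four_block_mat ?S (0\<^sub>m n 1) (mat 1 n (\<lambda>(_, j). Q n j)) ?a"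
  have "mat (Suc n) (Suc n) (\<lambda>(i, j). Q i j) = ?L * ?M"
    by (subst mult_four_block_mat[where ?nr1.0 = n and ?n1.0 = n and ?n2.0 = 1 and ?nr2.0 = 1 and ?nc1.0 = n and ?nc2.0 = 1])
       (use assms in \<open>auto intro!: eq_matI simp: schur_def scalar_prod_def less_Suc_eq\<close>)
  moreover have "Determinant.det (?L * ?M) = Determinant.det ?L * Determinant.det ?M"
    by (rule det_mult[of _ "Suc n"]) (auto simp: four_block_mat_def Let_def)
  moreover have "Determinant.det ?L = Determinant.det (1\<^sub>m n :: real mat) * Determinant.det (1\<^sub>m 1 :: real mat)"
    by (rule det_four_block_mat_lower_left_zero) auto
  moreover have "Determinant.det ?M = Determinant.det ?S * Determinant.det ?a"
    by (rule det_four_block_mat_upper_right_zero_col) auto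
  moreover have "Determinant.det ?a = Q n n" by (subst det_single) auto
  ultimately show ?thesis by simp
qed

lemma det_pos_def:
  assumes "pos_def n Q"
  shows "0 < Determinant.det (mat n n (\<lambda>(i, j). Q i j))"
  using assms
proof (induction n arbitrary: Q)
  case (Suc n)
  then show ?case using pos_def_schur[OF Suc.prems] by (subst det_schur) auto
qed (simp add: det_dim_zero)

lemma product_sigma_finite_lborel: "product_sigma_finite (\<lambda>_::nat. lborel :: real measure)"
  by standard

text \<open>Integrating out the last coordinate leaves the Schur complement, in step with the
  factorization of the determinant.\<close>

lemma nn_integral_gaussian:
  assumes "pos_def n Q"
  shows "(\<integral>\<^sup>+x. ennreal (exp (- qform n Q x / 2)) \<partial>PiM {..<n} (\<lambda>_. lborel)) =
    ennreal (sqrt ((2 * pi) ^ n / Determinant.det (mat n n (\<lambda>(i, j). Q i j))))"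
  using assms
proof (induction n arbitrary: Q)
  case 0
  have "Determinant.det (mat 0 0 (\<lambda>(i, j). Q i j)) = 1" by (rule det_dim_zero) simp
  then show ?case by (simp add: qform_def PiM_empty nn_integral_count_space_finite)
next
  case (Suc n)
  interpret product_sigma_finite "\<lambda>_::nat. lborel :: real measure" by (rule product_sigma_finite_lborel)
  have sym: "\<forall>i<Suc n. \<forall>j<Suc n. Q i j = Q j i" using Suc.prems by (simp add: pos_def_def)
  note a = pos_def_schur(1)[OF Suc.prems] and S = pos_def_schur(2)[OF Suc.prems]
  let ?dS = "Determinant.det (mat n n (\<lambda>(i, j). schur n Q i j))"
  have meas: "(\<lambda>x. ennreal (exp (- qform (Suc n) Q x / 2))) \<in> borel_measurable (PiM (insert n {..<n}) (\<lambda>_. lborel))"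
    unfolding qform_def lessThan_Suc[symmetric] by measurable
  have measn: "(\<lambda>x. ennreal (exp (- qform n (schur n Q) x / 2))) \<in> borel_measurable (PiM {..<n} (\<lambda>_. lborel))"
    unfolding qform_def by measurable
  have "(\<integral>\<^sup>+x. ennreal (exp (- qform (Suc n) Q x / 2)) \<partial>PiM {..<Suc n} (\<lambda>_. lborel)) =
      (\<integral>\<^sup>+x. (\<integral>\<^sup>+y. ennreal (exp (- qform (Suc n) Q (x(n := y)) / 2)) \<partial>lborel) \<partial>PiM {..<n} (\<lambda>_. lborel))"
    unfolding lessThan_Suc by (rule product_nn_integral_insert[OF _ _ meas]) auto
  also have "\<dots> = (\<integral>\<^sup>+x. ennreal (sqrt (2 * pi / Q n n)) * ennreal (exp (- qform n (schur n Q) x / 2)) \<partial>PiM {..<n} (\<lambda>_. lborel))"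
  proof (rule nn_integral_cong)
    fix x :: "nat \<Rightarrow> real"
    let ?b = "\<Sum>j<n. Q n j * x j"
    have "exp (- qform (Suc n) Q (x(n := y)) / 2) =
        exp (- qform n Q x / 2) * exp (- (Q n n * y\<^sup>2 + 2 * ?b * y) / 2)" for y
      unfolding qform_Suc[OF sym] by (simp add: field_simps flip: exp_add)
    then have "(\<integral>\<^sup>+y. ennreal (exp (- qform (Suc n) Q (x(n := y)) / 2)) \<partial>lborel) =
        (\<integral>\<^sup>+y. ennreal (exp (- qform n Q x / 2)) * ennreal (exp (- (Q n n * y\<^sup>2 + 2 * ?b * y) / 2)) \<partial>lborel)"
      by (simp add: ennreal_mult)
    also have "\<dots> = ennreal (exp (- qform n Q x / 2)) * ennreal (sqrt (2 * pi / Q n n) * exp (?b\<^sup>2 / (2 * Q n n)))"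
      by (subst nn_integral_cmult) (measurable, simp only: nn_integral_gaussian_1d[OF a])
    also have "\<dots> = ennreal (sqrt (2 * pi / Q n n) * (exp (- qform n Q x / 2) * exp (?b\<^sup>2 / (2 * Q n n))))"
      using a by (simp flip: ennreal_mult add: mult_ac)
    also have "exp (- qform n Q x / 2) * exp (?b\<^sup>2 / (2 * Q n n)) = exp (- qform n (schur n Q) x / 2)"
      unfolding qform_schur[OF sym] by (simp add: field_simps flip: exp_add)
    finally show "(\<integral>\<^sup>+y. ennreal (exp (- qform (Suc n) Q (x(n := y)) / 2)) \<partial>lborel) =
        ennreal (sqrt (2 * pi / Q n n)) * ennreal (exp (- qform n (schur n Q) x / 2))"
      using a by (simp add: ennreal_mult del: fun_upd_apply)
  qed
  also have "\<dots> = ennreal (sqrt (2 * pi / Q n n)) * ennreal (sqrt ((2 * pi) ^ n / ?dS))"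
    by (subst nn_integral_cmult[OF measn]) (simp only: Suc.IH[OF S])
  also have "\<dots> = ennreal (sqrt (2 * pi / Q n n) * sqrt ((2 * pi) ^ n / ?dS))"
    using a det_pos_def[OF S] by (simp flip: ennreal_mult)
  also have "sqrt (2 * pi / Q n n) * sqrt ((2 * pi) ^ n / ?dS) =
      sqrt ((2 * pi) ^ Suc n / Determinant.det (mat (Suc n) (Suc n) (\<lambda>(i, j). Q i j)))"
    using a by (subst det_schur) (auto simp: mult_ac simp flip: real_sqrt_mult)
  finally show ?case .
qed

lemma has_bochner_integral_gaussian:
  assumes "pos_def n Q"
  shows "has_bochner_integral (PiM {..<n} (\<lambda>_. lborel)) (\<lambda>x. exp (- qform n Q x / 2))
    (sqrt ((2 * pi) ^ n / Determinant.det (mat n n (\<lambda>(i, j). Q i j))))"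
proof (rule has_bochner_integral_nn_integral)
  show "(\<lambda>x. exp (- qform n Q x / 2)) \<in> borel_measurable (PiM {..<n} (\<lambda>_. lborel))"
    unfolding qform_def by measurable
qed (use nn_integral_gaussian[OF assms] det_pos_def[OF assms] in auto)

section \<open>Components of the bipartite graph\<close>

lemma out_in_nbrs_sum:
  fixes h :: "nat \<Rightarrow> nat \<Rightarrow> 'a::comm_monoid_add"
  assumes "F \<subseteq> {1..N} \<times> {1..N}"
  shows "(\<Sum>i = 1..N. \<Sum>j\<in>in_nbrs F i. h j i) = (\<Sum>j = 1..N. \<Sum>i\<in>out_nbrs F j. h j i)"
proof -
  have finB: "finite (in_nbrs F i)" for i
    by (rule finite_subset[of _ "{1..N}"]) (use assms in \<open>auto simp: in_nbrs_def\<close>)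
  have finO: "finite (out_nbrs F j)" for j
    by (rule finite_subset[of _ "{1..N}"]) (use assms in \<open>auto simp: out_nbrs_def\<close>)
  have "(\<Sum>i = 1..N. \<Sum>j\<in>in_nbrs F i. h j i) = (\<Sum>(i, j)\<in>(SIGMA i:{1..N}. in_nbrs F i). h j i)"
    by (rule sum.Sigma) (use finB in auto)
  also have "\<dots> = (\<Sum>(j, i)\<in>F. h j i)"
    by (rule sum.reindex_bij_witness[of _ "\<lambda>(j, i). (i, j)" "\<lambda>(i, j). (j, i)"])
       (use assms in \<open>auto simp: in_nbrs_def\<close>)
  also have "\<dots> = (\<Sum>(j, i)\<in>(SIGMA j:{1..N}. out_nbrs F j). h j i)"
    by (intro sum.cong) (use assms in \<open>auto simp: out_nbrs_def\<close>)
  also have "\<dots> = (\<Sum>j = 1..N. \<Sum>i\<in>out_nbrs F j. h j i)"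
    by (rule sum.Sigma[symmetric]) (use finO in auto)
  finally show ?thesis .
qed

text \<open>Covers distances of angles as well as distances of the corresponding points on the unit
  circle, so that one path estimate serves both the covariance and the characteristic
  function.\<close>

definition pseudometric :: "(nat \<Rightarrow> nat \<Rightarrow> real) \<Rightarrow> bool" where
  "pseudometric d \<longleftrightarrow> (\<forall>x. d x x = 0) \<and> (\<forall>x y. d x y = d y x) \<and> (\<forall>x y. 0 \<le> d x y) \<and>
     (\<forall>x y z. d x z \<le> d x y + d y z)"

text \<open>\<open>p\<close> is a strictly positive point of the polytope that serves to control the
  potential; the entropy maximizer is constructed separately.\<close>

locale supported =
  fixes N :: nat and k :: "nat \<Rightarrow> nat" and F :: "(nat \<times> nat) set" and p :: "nat \<times> nat \<Rightarrow> real"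
    and R :: "nat set"
  assumes F: "F \<subseteq> {1..N} \<times> {1..N}" and kpos: "\<And>i. i \<in> {1..N} \<Longrightarrow> 0 < k i"
    and p: "p \<in> transport_polytope N k F" and ppos: "\<And>e. e \<in> F \<Longrightarrow> 0 < p e"
    and R: "right_representatives N F R"
begin

abbreviation "B \<equiv> in_nbrs F"

lemma B_sub: "B i \<subseteq> {1..N}"
  using F by (auto simp: in_nbrs_def)

lemma B_finite [simp]: "finite (B i)"
  by (rule finite_subset[OF B_sub]) simp

lemma row: "i \<in> {1..N} \<Longrightarrow> (\<Sum>j\<in>B i. p (j, i)) = real (k i)"
  using p by (simp add: transport_polytope_def)

lemma col: "j \<in> {1..N} \<Longrightarrow> (\<Sum>i\<in>out_nbrs F j. p (j, i)) = real (k j)"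
  using p by (simp add: transport_polytope_def)

lemma B_nonempty: "i \<in> {1..N} \<Longrightarrow> B i \<noteq> {}"
  using row[of i] kpos[of i] by auto

lemma finite_R [simp]: "finite R"
  using R by (auto simp: right_representatives_def intro: finite_subset)

lemma R_sub: "R \<subseteq> {1..N}"
  using R by (auto simp: right_representatives_def)

definition E :: "((nat + nat) \<times> (nat + nat)) set" where
  "E = (bip_edges F \<union> (bip_edges F)\<inverse>)\<^sup>*"

lemma E_refl [simp]: "(v, v) \<in> E" by (simp add: E_def)

lemma E_trans: "(u, v) \<in> E \<Longrightarrow> (v, w) \<in> E \<Longrightarrow> (u, w) \<in> E"
  unfolding E_def by (rule rtrancl_trans)

lemma E_sym: "(u, v) \<in> E \<Longrightarrow> (v, u) \<in> E"
proof -
  have "(bip_edges F \<union> (bip_edges F)\<inverse>)\<inverse> = bip_edges F \<union> (bip_edges F)\<inverse>" by auto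
  then show "(u, v) \<in> E \<Longrightarrow> (v, u) \<in> E" unfolding E_def by (metis rtrancl_converseI)
qed

lemma equiv_E: "equiv (bip_verts N) (E \<inter> bip_verts N \<times> bip_verts N)"
  by (rule equivI) (auto simp: refl_on_def sym_def trans_def intro: E_sym E_trans)

lemma rep_ex1:
  assumes "j \<in> {1..N}"
  shows "\<exists>!r. r \<in> R \<and> (Inr j, Inr r) \<in> E"
proof -
  let ?C = "(E \<inter> bip_verts N \<times> bip_verts N) `` {Inr j}"
  have "?C \<in> bip_components N F"
    using assms unfolding bip_components_def E_def[symmetric] by (intro quotientI) (auto simp: bip_verts_def)
  then have "\<exists>!r. r \<in> R \<and> Inr r \<in> ?C" using R by (auto simp: right_representatives_def)
  moreover have "r \<in> R \<and> Inr r \<in> ?C \<longleftrightarrow> r \<in> R \<and> (Inr j, Inr r) \<in> E" for r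
    using R_sub assms by (auto simp: bip_verts_def)
  ultimately show ?thesis by simp
qed

definition rep :: "nat \<Rightarrow> nat" where
  "rep j = (THE r. r \<in> R \<and> (Inr j, Inr r) \<in> E)"

lemma rep:
  assumes "j \<in> {1..N}"
  shows "rep j \<in> R" "(Inr j, Inr (rep j)) \<in> E"
  using theI'[OF rep_ex1[OF assms]] by (auto simp: rep_def)

lemma rep_unique: "j \<in> {1..N} \<Longrightarrow> r \<in> R \<Longrightarrow> (Inr j, Inr r) \<in> E \<Longrightarrow> rep j = r"
  using rep_ex1 rep by blast

lemma rep_R [simp]: "r \<in> R \<Longrightarrow> rep r = r"
  using R_sub by (intro rep_unique) auto

lemma edge_E: "(j, i) \<in> F \<Longrightarrow> (Inl i, Inr j) \<in> E" "(j, i) \<in> F \<Longrightarrow> (Inr j, Inl i) \<in> E"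
  by (auto simp: E_def bip_edges_def)

lemma rep_edge:
  assumes "j \<in> B i" "j' \<in> B i"
  shows "rep j = rep j'"
proof (rule rep_unique)
  have j: "j \<in> {1..N}" "j' \<in> {1..N}" using assms B_sub[of i] by blast+
  then show "j \<in> {1..N}" "rep j' \<in> R" using rep by auto
  have "(Inr j, Inl i) \<in> E" "(Inl i, Inr j') \<in> E" using assms edge_E by (auto simp: in_nbrs_def)
  then show "(Inr j, Inr (rep j')) \<in> E" using rep(2)[OF j(2)] E_trans by blast
qed

lemma card_R: "card R = num_components N F"
proof -
  let ?Er = "E \<inter> bip_verts N \<times> bip_verts N"
  have "bij_betw (\<lambda>r. ?Er `` {Inr r}) R (bip_components N F)"
    unfolding bij_betw_def
  proof
    show "inj_on (\<lambda>r. ?Er `` {Inr r}) R"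
    proof (rule inj_onI)
      fix r s assume rs: "r \<in> R" "s \<in> R" "?Er `` {Inr r} = ?Er `` {Inr s}"
      have "Inr s \<in> ?Er `` {Inr s}" using rs R_sub by (auto simp: bip_verts_def)
      then have "(Inr r, Inr s) \<in> E" using rs(3) by blast
      then show "r = s" using rep_unique[of r s] rs R_sub by auto
    qed
    show "(\<lambda>r. ?Er `` {Inr r}) ` R = bip_components N F"
    proof (intro subset_antisym subsetI)
      fix C assume "C \<in> (\<lambda>r. ?Er `` {Inr r}) ` R"
      then show "C \<in> bip_components N F"
        using R_sub unfolding bip_components_def E_def[symmetric] by (auto intro!: quotientI simp: bip_verts_def)
    next
      fix C assume C: "C \<in> bip_components N F"
      then obtain r where r: "r \<in> R" "Inr r \<in> C" using R by (auto simp: right_representatives_def)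
      obtain v where v: "v \<in> bip_verts N" "C = ?Er `` {v}"
        using C unfolding bip_components_def E_def[symmetric] by (elim quotientE)
      have "(v, Inr r) \<in> ?Er" using r v by auto
      then have "C = ?Er `` {Inr r}" unfolding v(2) by (rule equiv_class_eq[OF equiv_E])
      then show "C \<in> (\<lambda>r. ?Er `` {Inr r}) ` R" using r by blast
    qed
  qed
  then show ?thesis unfolding num_components_def by (rule bij_betw_same_card)
qed

text \<open>Total distance between right vertices with a common left neighbour, that is, over the
  steps of length two in the bipartite graph.\<close>

definition spread :: "(nat \<Rightarrow> nat \<Rightarrow> real) \<Rightarrow> real" where
  "spread d = (\<Sum>i = 1..N. \<Sum>a\<in>B i. \<Sum>b\<in>B i. d a b)"

lemma spread_nonneg: "pseudometric d \<Longrightarrow> 0 \<le> spread d"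
  unfolding spread_def pseudometric_def by (auto intro!: sum_nonneg)

lemma le_spread:
  assumes "pseudometric d" "a \<in> B i" "b \<in> B i"
  shows "d a b \<le> spread d"
proof -
  have nn: "\<And>x y. 0 \<le> d x y" using assms(1) by (simp add: pseudometric_def)
  have i: "i \<in> {1..N}" using assms(2) F by (auto simp: in_nbrs_def)
  have "d a b \<le> (\<Sum>b\<in>B i. d a b)" using assms nn by (intro member_le_sum) auto
  also have "\<dots> \<le> (\<Sum>a\<in>B i. \<Sum>b\<in>B i. d a b)"
    using assms nn by (intro member_le_sum[of a "B i" "\<lambda>a. \<Sum>b\<in>B i. d a b"]) (auto intro: sum_nonneg)
  also have "\<dots> \<le> spread d"
    unfolding spread_def using i nn
    by (intro member_le_sum[of i "{1..N}" "\<lambda>i. \<Sum>a\<in>B i. \<Sum>b\<in>B i. d a b"]) (auto intro!: sum_nonneg)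
  finally show ?thesis .
qed

text \<open>The constant depends on the path but not on the pseudometric. A left vertex carries no
  point of its own, so the invariant there speaks about all its neighbours.\<close>

lemma path_bound:
  assumes "(Inr j, v) \<in> E"
  shows "\<exists>K\<ge>0. \<forall>d. pseudometric d \<longrightarrow>
    (case v of Inr j' \<Rightarrow> d j j' \<le> K * spread d | Inl i \<Rightarrow> \<forall>j'\<in>B i. d j j' \<le> K * spread d)"
  using assms unfolding E_def
proof (induction rule: rtrancl_induct)
  case base
  show ?case by (intro exI[of _ 0]) (auto simp: pseudometric_def)
next
  case (step v w)
  then obtain K where K: "K \<ge> 0" "\<forall>d. pseudometric d \<longrightarrow>
    (case v of Inr j' \<Rightarrow> d j j' \<le> K * spread d | Inl i \<Rightarrow> \<forall>j'\<in>B i. d j j' \<le> K * spread d)"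
    by blast
  from step(2) consider (1) i j' where "v = Inl i" "w = Inr j'" "j' \<in> B i"
    | (2) i j' where "w = Inl i" "v = Inr j'" "j' \<in> B i"
    by (auto simp: bip_edges_def in_nbrs_def)
  then show ?case
  proof cases
    case 1
    then show ?thesis using K by (intro exI[of _ K]) auto
  next
    case 2
    have "d j b \<le> (K + 1) * spread d" if d: "pseudometric d" and b: "b \<in> B i" for d b
    proof -
      have "d j b \<le> d j j' + d j' b" using d unfolding pseudometric_def by blast
      also have "d j j' \<le> K * spread d" using K(2) d 2 by auto
      also have "d j' b \<le> spread d" by (rule le_spread[OF d 2(3) b])
      finally show ?thesis by (simp add: algebra_simps)
    qed
    then show ?thesis using K(1) 2 by (intro exI[of _ "K + 1"]) auto
  qed
qed

lemma dist_rep_bound: "\<exists>K>0. \<forall>d. pseudometric d \<longrightarrow> (\<forall>j\<in>{1..N}. d j (rep j) \<le> K * spread d)"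
proof -
  have "\<forall>j\<in>{1..N}. \<exists>K\<ge>0. \<forall>d. pseudometric d \<longrightarrow> d j (rep j) \<le> K * spread d"
    using path_bound[OF rep(2)] by simp
  from bchoice[OF this] obtain K where K: "\<forall>j\<in>{1..N}. 0 \<le> K j \<and> (\<forall>d. pseudometric d \<longrightarrow> d j (rep j) \<le> K j * spread d)"
    by (elim exE)
  have "d j (rep j) \<le> (1 + sum K {1..N}) * spread d" if d: "pseudometric d" and j: "j \<in> {1..N}" for d j
  proof -
    have "K j \<le> sum K {1..N}" using K j by (intro member_le_sum) auto
    then have "K j * spread d \<le> (1 + sum K {1..N}) * spread d"
      using spread_nonneg[OF d] by (intro mult_right_mono) auto
    moreover have "d j (rep j) \<le> K j * spread d" using K d j by blast
    ultimately show ?thesis by linarith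
  qed
  moreover have "0 \<le> sum K {1..N}" using K by (intro sum_nonneg) auto
  ultimately show ?thesis by (intro exI[of _ "1 + sum K {1..N}"]) auto
qed

text \<open>The test function is the indicator of a component, which is constant on neighbourhoods;
  within a component only the representative can have a nonzero coefficient.\<close>

lemma zero_at_reps:
  fixes c :: "nat \<Rightarrow> real"
  assumes orth: "\<And>\<phi> :: nat \<Rightarrow> real. (\<And>i a b. a \<in> B i \<Longrightarrow> b \<in> B i \<Longrightarrow> \<phi> a = \<phi> b) \<Longrightarrow> (\<Sum>j = 1..N. c j * \<phi> j) = 0"
    and zero: "\<And>j. j \<in> {1..N} - R \<Longrightarrow> c j = 0" and j: "j \<in> {1..N}"
  shows "c j = 0"
proof (cases "j \<in> R")
  case True
  have "(\<Sum>a = 1..N. c a * (if rep a = j then 1 else 0)) = 0"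
    by (rule orth) (use rep_edge in metis)
  moreover have "(\<Sum>a = 1..N. c a * (if rep a = j then 1 else 0)) = (\<Sum>a\<in>{j}. c a)"
  proof (rule sum.mono_neutral_cong_right)
    show "\<forall>a\<in>{1..N} - {j}. c a * (if rep a = j then 1 else 0) = 0"
      using zero rep_R by (metis Diff_iff insertCI mult_zero_left mult_zero_right)
  qed (use j True in auto)
  ultimately show ?thesis by simp
qed (use zero j in auto)

text \<open>Only the row sums of \<open>w\<close> enter, so \<open>w\<close> may be exchanged for
  \<open>p\<close>, whose column sums are known.\<close>

lemma const_on_nbrs_sum:
  assumes "\<And>i a b. a \<in> B i \<Longrightarrow> b \<in> B i \<Longrightarrow> \<phi> a = \<phi> b"
    and w: "\<And>i. i \<in> {1..N} \<Longrightarrow> (\<Sum>j\<in>B i. w i j) = real (k i)"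
  shows "(\<Sum>i = 1..N. \<Sum>j\<in>B i. w i j * \<phi> j) = (\<Sum>j = 1..N. real (k j) * \<phi> j)"
proof -
  have eq: "(\<Sum>j\<in>B i. w' i j * \<phi> j) = real (k i) * \<phi> (SOME a. a \<in> B i)"
    if i: "i \<in> {1..N}" and w': "\<And>i. i \<in> {1..N} \<Longrightarrow> (\<Sum>j\<in>B i. w' i j) = real (k i)" for i and w' :: "nat \<Rightarrow> nat \<Rightarrow> real"
  proof -
    have "(SOME a. a \<in> B i) \<in> B i" using B_nonempty[OF i] some_in_eq by blast
    then have "(\<Sum>j\<in>B i. w' i j * \<phi> j) = (\<Sum>j\<in>B i. w' i j * \<phi> (SOME a. a \<in> B i))"
      by (intro sum.cong refl) (metis assms(1))
    then show ?thesis by (simp add: w'[OF i] flip: sum_distrib_right)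
  qed
  have "(\<Sum>i = 1..N. \<Sum>j\<in>B i. w i j * \<phi> j) = (\<Sum>i = 1..N. \<Sum>j\<in>B i. p (j, i) * \<phi> j)"
    by (rule sum.cong[OF refl], rule trans[OF eq[where w' = w, OF _ w]
        eq[where w' = "\<lambda>i j. p (j, i)", OF _ row, symmetric]])
  also have "\<dots> = (\<Sum>j = 1..N. \<Sum>i\<in>out_nbrs F j. p (j, i) * \<phi> j)"
    by (rule out_in_nbrs_sum[OF F])
  also have "\<dots> = (\<Sum>j = 1..N. real (k j) * \<phi> j)"
    by (intro sum.cong refl) (simp add: col flip: sum_distrib_right)
  finally show ?thesis .
qed

section \<open>The minimizing potential\<close>

definition Z :: "(nat \<Rightarrow> real) \<Rightarrow> nat \<Rightarrow> real" where
  "Z y i = (\<Sum>j\<in>B i. exp (y j))"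

text \<open>The logarithm of the quotient in \<open>capacity\<close> at \<open>z = exp y\<close>,
  written with the weights \<open>p\<close> so that every summand is nonnegative. By
  \<open>g_alt\<close> its value depends on the marginals of \<open>p\<close> only.\<close>

definition g :: "(nat \<Rightarrow> real) \<Rightarrow> real" where
  "g y = (\<Sum>i = 1..N. \<Sum>j\<in>B i. p (j, i) * (ln (Z y i) - y j))"

lemma Z_ge: "j \<in> B i \<Longrightarrow> exp (y j) \<le> Z y i"
  unfolding Z_def by (rule member_le_sum) auto

lemma Z_pos: "i \<in> {1..N} \<Longrightarrow> 0 < Z y i"
  unfolding Z_def using B_nonempty by (intro sum_pos) auto

lemma ln_Z_ge: "i \<in> {1..N} \<Longrightarrow> j \<in> B i \<Longrightarrow> y j \<le> ln (Z y i)"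
  using Z_ge[of j i y] Z_pos[of i y] by (simp add: ln_ge_iff)

lemma B_index: "j \<in> B i \<Longrightarrow> i \<in> {1..N}" "j \<in> B i \<Longrightarrow> j \<in> {1..N}"
  using F by (auto simp: in_nbrs_def)

lemma g_term_nonneg: "j \<in> B i \<Longrightarrow> 0 \<le> p (j, i) * (ln (Z y i) - y j)"
  using ln_Z_ge[of i j y] ppos[of "(j, i)"] B_index[of j i]
  by (intro mult_nonneg_nonneg) (auto simp: in_nbrs_def)

lemma g_alt: "g y = (\<Sum>i = 1..N. real (k i) * ln (Z y i)) - (\<Sum>j = 1..N. real (k j) * y j)"
proof -
  have "g y = (\<Sum>i = 1..N. \<Sum>j\<in>B i. p (j, i) * ln (Z y i)) - (\<Sum>i = 1..N. \<Sum>j\<in>B i. p (j, i) * y j)"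
    by (simp add: g_def right_diff_distrib sum_subtractf)
  also have "(\<Sum>i = 1..N. \<Sum>j\<in>B i. p (j, i) * ln (Z y i)) = (\<Sum>i = 1..N. real (k i) * ln (Z y i))"
    by (rule sum.cong[OF refl]) (simp add: row flip: sum_distrib_right)
  also have "(\<Sum>i = 1..N. \<Sum>j\<in>B i. p (j, i) * y j) = (\<Sum>j = 1..N. \<Sum>i\<in>out_nbrs F j. p (j, i) * y j)"
    by (rule out_in_nbrs_sum[OF F])
  also have "\<dots> = (\<Sum>j = 1..N. real (k j) * y j)"
    by (rule sum.cong[OF refl]) (simp add: col flip: sum_distrib_right)
  finally show ?thesis .
qed

text \<open>\<open>rep\<close> is constant on each neighbourhood, so the shift is a common constant
  there and cancels between \<open>ln (Z y i)\<close> and \<open>y j\<close>.\<close>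

lemma g_shift: "g (\<lambda>j. y j - y (rep j)) = g y"
  unfolding g_def
proof (intro sum.cong refl)
  fix i j assume i: "i \<in> {1..N}" and j: "j \<in> B i"
  have "Z (\<lambda>j. y j - y (rep j)) i = (\<Sum>a\<in>B i. exp (y a) * exp (- y (rep j)))"
    unfolding Z_def by (intro sum.cong refl) (metis rep_edge j exp_add diff_conv_add_uminus)
  also have "\<dots> = Z y i * exp (- y (rep j))" by (simp add: Z_def sum_distrib_right)
  finally show "p (j, i) * (ln (Z (\<lambda>j. y j - y (rep j)) i) - (y j - y (rep j))) = p (j, i) * (ln (Z y i) - y j)"
    using Z_pos[OF i, of y] by (simp add: ln_mult)
qed

text \<open>All summands of \<open>g\<close> are nonnegative with positive weights, so a bound on
  \<open>g\<close> bounds the differences of \<open>y\<close> within each neighbourhood and, along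
  paths, the distance to the representative.\<close>

lemma g_coercive: "\<exists>C\<ge>0. \<forall>y. g y \<le> g (\<lambda>_. 0) \<longrightarrow> (\<forall>j\<in>{1..N}. \<bar>y j - y (rep j)\<bar> \<le> C)"
proof -
  obtain K where K: "K > 0" "\<forall>d. pseudometric d \<longrightarrow> (\<forall>j\<in>{1..N}. d j (rep j) \<le> K * spread d)"
    using dist_rep_bound by blast
  have finF: "finite F" by (rule finite_subset[OF F]) simp
  define c where "c = (\<Sum>e\<in>F. 1 / p e)"
  have g0: "0 \<le> g y" for y unfolding g_def by (intro sum_nonneg g_term_nonneg) auto
  have osc: "\<bar>y a - y b\<bar> \<le> c * g y" if ab: "a \<in> B i" "b \<in> B i" for y a b i
  proof -
    have *: "y a - y b \<le> c * g y" if ab: "a \<in> B i" "b \<in> B i" for a b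
    proof -
      have i: "i \<in> {1..N}" using B_index ab by auto
      have pb: "0 < p (b, i)" "(b, i) \<in> F" using ppos ab by (auto simp: in_nbrs_def)
      have "p (b, i) * (y a - y b) \<le> p (b, i) * (ln (Z y i) - y b)"
        using pb ln_Z_ge[OF i ab(1), of y] by simp
      also have "\<dots> \<le> (\<Sum>j\<in>B i. p (j, i) * (ln (Z y i) - y j))"
        using ab by (intro member_le_sum[of b "B i" "\<lambda>j. p (j, i) * (ln (Z y i) - y j)"] g_term_nonneg) auto
      also have "\<dots> \<le> g y"
        unfolding g_def using i
        by (intro member_le_sum[of i "{1..N}" "\<lambda>i. \<Sum>j\<in>B i. p (j, i) * (ln (Z y i) - y j)"] sum_nonneg g_term_nonneg) auto
      finally have "y a - y b \<le> 1 / p (b, i) * g y" using pb by (simp add: field_simps)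
      also have "1 / p (b, i) \<le> c"
        unfolding c_def using pb ppos finF by (intro member_le_sum[of "(b, i)" F "\<lambda>e. 1 / p e"]) (auto intro: less_imp_le)
      then have "1 / p (b, i) * g y \<le> c * g y" using g0 by (intro mult_right_mono) auto
      finally show ?thesis .
    qed
    show ?thesis using *[OF ab] *[OF ab(2,1)] by linarith
  qed
  have c0: "0 \<le> c" unfolding c_def by (intro sum_nonneg) (use ppos in \<open>auto intro: less_imp_le\<close>)
  define M where "M = (\<Sum>i = 1..N. \<Sum>a\<in>B i. \<Sum>b\<in>B i. c * g (\<lambda>_. 0))"
  have "\<bar>y j - y (rep j)\<bar> \<le> K * M" if y: "g y \<le> g (\<lambda>_. 0)" and j: "j \<in> {1..N}" for y j
  proof -
    let ?d = "\<lambda>a b. \<bar>y a - y b\<bar>"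
    have "pseudometric ?d" by (auto simp: pseudometric_def)
    then have "?d j (rep j) \<le> K * spread ?d" using K(2) j by blast
    also have "spread ?d \<le> M"
      unfolding spread_def M_def
      by (intro sum_mono order_trans[OF osc]) (use y c0 in \<open>auto intro: mult_left_mono\<close>)
    then have "K * spread ?d \<le> K * M" using K(1) by simp
    finally show ?thesis .
  qed
  moreover have "0 \<le> K * M"
    unfolding M_def using K(1) c0 g0 by (intro mult_nonneg_nonneg sum_nonneg) auto
  ultimately show ?thesis by blast
qed

text \<open>By shift invariance the search may be restricted to potentials that vanish at the
  representatives; by coercivity the relevant ones lie in a compact box.\<close>

lemma minimizer_exists: "\<exists>y. \<forall>y'. g y \<le> g y'"
proof -
  obtain C where C: "C \<ge> 0" "\<forall>y. g y \<le> g (\<lambda>_. 0) \<longrightarrow> (\<forall>j\<in>{1..N}. \<bar>y j - y (rep j)\<bar> \<le> C)"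
    using g_coercive by (elim exE conjE)
  \<comment> \<open>The box has a factor for every natural number and is compact as a product;
    irrelevant coordinates are set to 0 below.\<close>
  define D where "D = (UNIV :: nat set) \<rightarrow>\<^sub>E {-C..C}"
  have "compactin (product_topology (\<lambda>_. euclidean) UNIV) D"
    unfolding D_def by (subst compactin_PiE) auto
  then have "compact D" by (simp add: euclidean_product_topology)
  moreover have "D \<noteq> {}" using C(1) by (auto simp: D_def PiE_eq_empty_iff)
  moreover have "continuous_on D g"
  proof -
    have cc: "continuous_on D (\<lambda>y. y j)" for j
      by (rule continuous_on_subset[OF continuous_on_product_coordinates]) simp
    have cZ: "continuous_on D (\<lambda>y. Z y i)" for i
      unfolding Z_def by (intro continuous_intros cc)
    have "continuous_on D (\<lambda>y. ln (Z y i))" if "i \<in> {1..N}" for i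
    proof (rule continuous_on_ln[OF cZ])
      show "\<forall>y\<in>D. Z y i \<noteq> 0" using Z_pos[OF that] by (metis less_irrefl)
    qed
    then show ?thesis
      unfolding g_def[abs_def] by (intro continuous_on_sum continuous_on_mult continuous_on_const continuous_on_diff cc) auto
  qed
  ultimately obtain y where y: "y \<in> D" "\<forall>w\<in>D. g y \<le> g w"
    using continuous_attains_inf[of D g] by blast
  have "g y \<le> g w" for w
  proof (cases "g w \<le> g (\<lambda>_. 0)")
    case True
    define v where "v j = (if j \<in> {1..N} then w j - w (rep j) else 0)" for j
    have "\<forall>j\<in>{1..N}. \<bar>w j - w (rep j)\<bar> \<le> C" using C(2) True by blast
    then have "\<bar>v j\<bar> \<le> C" for j using C(1) by (cases "j \<in> {1..N}") (auto simp: v_def)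
    then have "v j \<in> {-C..C}" for j by (metis abs_le_D1 abs_le_D2 atLeastAtMost_iff minus_le_iff)
    then have "v \<in> D" by (simp add: D_def PiE_UNIV_domain)
    moreover have "g v = g (\<lambda>j. w j - w (rep j))"
    proof -
      have "v j = w j - w (rep j)" if "j \<in> B i" for i j using B_index(2)[OF that] by (simp add: v_def)
      then show ?thesis unfolding g_def Z_def by (intro sum.cong refl) (simp cong: sum.cong)
    qed
    ultimately show ?thesis using y(2) g_shift[of w] by auto
  next
    case False
    have "(\<lambda>_. 0) \<in> D" using C(1) by (auto simp: D_def)
    then show ?thesis using y(2) False by (meson le_cases order_trans)
  qed
  then show ?thesis by blast
qed

definition y :: "nat \<Rightarrow> real" where
  "y = (SOME y. \<forall>y'. g y \<le> g y')"

lemma g_min: "g y \<le> g w"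
  using someI_ex[OF minimizer_exists] by (simp add: y_def)

definition q :: "nat \<Rightarrow> nat \<Rightarrow> real" where
  "q i j = (if j \<in> B i then exp (y j) / Z y i else 0)"

lemma q_pos: "j \<in> B i \<Longrightarrow> 0 < q i j"
  using Z_pos[of i] B_index[of j i] by (simp add: q_def)

lemma q_nonneg: "0 \<le> q i j"
  using q_pos[of j i] by (cases "j \<in> B i") (auto simp: q_def)

lemma sum_q: "i \<in> {1..N} \<Longrightarrow> (\<Sum>j\<in>B i. q i j) = 1"
  using Z_pos[of i y] by (simp add: q_def Z_def flip: sum_divide_distrib)

text \<open>The first-order condition for the minimum in coordinate \<open>j\<close>. It says that
  independent choices with laws \<open>q i\<close> have mean counts \<open>k\<close>.\<close>

lemma stationary:
  assumes j: "j \<in> {1..N}"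
  shows "(\<Sum>i = 1..N. real (k i) * q i j) = real (k j)"
proof -
  define \<phi> where "\<phi> t = g (y(j := y j + t))" for t
  have Zt: "Z (y(j := y j + t)) i = (if j \<in> B i then Z y i - exp (y j) + exp (y j + t) else Z y i)" for t i
  proof (cases "j \<in> B i")
    case True
    have "Z (y(j := y j + t)) i = exp (y j + t) + (\<Sum>a\<in>B i - {j}. exp (y a))"
      unfolding Z_def by (subst sum.remove[OF _ True]) (auto intro!: sum.cong)
    moreover have "Z y i = exp (y j) + (\<Sum>a\<in>B i - {j}. exp (y a))"
      unfolding Z_def by (subst sum.remove[OF _ True]) auto
    ultimately show ?thesis using True by simp
  qed (auto simp: Z_def intro!: sum.cong)
  have lin: "(\<Sum>a = 1..N. real (k a) * (y(j := y j + t)) a) = (\<Sum>a = 1..N. real (k a) * y a) + real (k j) * t" for t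
  proof -
    have "(\<Sum>a = 1..N. real (k a) * (y(j := y j + t)) a) =
        (\<Sum>a = 1..N. real (k a) * y a + (if a = j then real (k j) * t else 0))"
      by (intro sum.cong) (auto simp: algebra_simps)
    then show ?thesis using j by (simp add: sum.distrib)
  qed
  have "(\<phi> has_real_derivative (\<Sum>i = 1..N. real (k i) * q i j) - real (k j)) (at 0)"
  proof -
    have "((\<lambda>t. ln (Z (y(j := y j + t)) i)) has_real_derivative q i j) (at 0)" if i: "i \<in> {1..N}" for i
      unfolding Zt q_def using Z_pos[OF i, of y]
      by (cases "j \<in> B i") (auto intro!: derivative_eq_intros)
    then have "((\<lambda>t. \<Sum>i = 1..N. real (k i) * ln (Z (y(j := y j + t)) i)) has_real_derivative
        (\<Sum>i = 1..N. real (k i) * q i j)) (at 0)"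
      by (intro DERIV_sum DERIV_cmult)
    moreover have "((\<lambda>t. (\<Sum>a = 1..N. real (k a) * y a) + real (k j) * t) has_real_derivative real (k j)) (at 0)"
      by (auto intro!: derivative_eq_intros)
    ultimately have "((\<lambda>t. (\<Sum>i = 1..N. real (k i) * ln (Z (y(j := y j + t)) i)) -
        ((\<Sum>a = 1..N. real (k a) * y a) + real (k j) * t)) has_real_derivative
        (\<Sum>i = 1..N. real (k i) * q i j) - real (k j)) (at 0)"
      by (rule DERIV_diff)
    then show ?thesis unfolding \<phi>_def[abs_def] g_alt lin .
  qed
  then have "(\<Sum>i = 1..N. real (k i) * q i j) - real (k j) = 0"
    by (rule DERIV_local_min[of _ _ _ 1]) (auto simp: \<phi>_def intro: g_min)
  then show ?thesis by simp
qed

lemma capacity_eq: "capacity N k F = exp (g y)"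
proof -
  let ?A = "{z::nat \<Rightarrow> real. \<forall>i\<in>{1..N}. 0 < z i}"
  let ?h = "\<lambda>z. (\<Prod>i = 1..N. (\<Sum>j\<in>B i. z j) ^ k i) / (\<Prod>j = 1..N. z j ^ k j)"
  have h: "?h z = exp (g (\<lambda>j. ln (z j)))" if z: "z \<in> ?A" for z
  proof -
    have Zz: "Z (\<lambda>j. ln (z j)) i = (\<Sum>j\<in>B i. z j)" for i
      unfolding Z_def by (intro sum.cong refl) (use z B_index in auto)
    have "exp (\<Sum>i = 1..N. real (k i) * ln (Z (\<lambda>j. ln (z j)) i)) = (\<Prod>i = 1..N. (\<Sum>j\<in>B i. z j) ^ k i)"
      unfolding exp_sum[OF finite_atLeastAtMost]
    proof (intro prod.cong refl)
      fix i assume "i \<in> {1..N}"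
      from Z_pos[OF this, of "\<lambda>j. ln (z j)"]
      show "exp (real (k i) * ln (Z (\<lambda>j. ln (z j)) i)) = (\<Sum>j\<in>B i. z j) ^ k i"
        by (simp add: exp_of_nat_mult Zz)
    qed
    moreover have "exp (\<Sum>j = 1..N. real (k j) * ln (z j)) = (\<Prod>j = 1..N. z j ^ k j)"
      unfolding exp_sum[OF finite_atLeastAtMost] using z
      by (intro prod.cong refl) (simp add: exp_of_nat_mult)
    ultimately show ?thesis by (simp add: g_alt exp_diff)
  qed
  show ?thesis
    unfolding capacity_def
  proof (rule antisym)
    have "(INF z\<in>?A. ?h z) \<le> ?h (\<lambda>j. exp (y j))"
    proof (rule cINF_lower)
      show "bdd_below (?h ` ?A)"
        by (rule bdd_belowI2[of _ 0]) (simp only: h exp_ge_zero)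
    qed simp
    also have "\<dots> = exp (g y)" by (subst h) auto
    finally show "(INF z\<in>?A. ?h z) \<le> exp (g y)" .
    show "exp (g y) \<le> (INF z\<in>?A. ?h z)"
    proof (rule cINF_greatest)
      show "?A \<noteq> {}" by (auto intro: exI[of _ "\<lambda>_. 1"])
    qed (simp only: h exp_le_cancel_iff g_min)
  qed
qed

end

section \<open>The entropy maximizer\<close>

text \<open>The inequality \<open>ln t \<le> t - 1\<close> at \<open>t = q / x\<close>, with
  equality only at \<open>t = 1\<close>. For \<open>x = 0\<close> both products on the left are
  0.\<close>

lemma gibbs_term:
  fixes x q :: real
  assumes "0 \<le> x" "0 < q"
  shows "x * ln q - x * ln x \<le> q - x" and "x * ln q - x * ln x = q - x \<Longrightarrow> x = q"
proof -
  have split: "x * ln q - x * ln x = x * ln (q / x)" "q - x = x * (q / x - 1)" "0 < q / x" if "x \<noteq> 0"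
  proof -
    have "ln (q / x) = ln q - ln x" using assms that by (intro ln_divide_pos) auto
    then show "x * ln q - x * ln x = x * ln (q / x)" by (simp add: right_diff_distrib)
    show "q - x = x * (q / x - 1)" using that by (simp add: right_diff_distrib)
    show "0 < q / x" using assms that by simp
  qed
  show "x * ln q - x * ln x \<le> q - x"
  proof (cases "x = 0")
    case False
    have "x * ln (q / x) \<le> x * (q / x - 1)"
      by (rule mult_left_mono[OF ln_le_minus_one[OF split(3)[OF False]] assms(1)])
    then show ?thesis using split(1,2)[OF False] by linarith
  next
    case True
    show ?thesis unfolding True using assms(2) by simp
  qed
  assume eq: "x * ln q - x * ln x = q - x"
  show "x = q"
  proof (cases "x = 0")
    case False
    have "x * ln (q / x) = x * (q / x - 1)" using eq split(1,2)[OF False] by simp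
    then have "ln (q / x) = q / x - 1" by (rule mult_left_cancel[OF False, THEN iffD1])
    then have "q / x = 1" by (rule ln_eq_minus_one[OF split(3)[OF False]])
    then show ?thesis by (metis divide_eq_1_iff)
  next
    case True
    then show ?thesis using eq by auto
  qed
qed

context supported
begin

lemma marginal_sum:
  assumes "p' \<in> transport_polytope N k F"
  shows "(\<Sum>i = 1..N. \<Sum>j\<in>B i. p' (j, i) * (a i - b j)) =
    (\<Sum>i = 1..N. real (k i) * a i) - (\<Sum>j = 1..N. real (k j) * b j)"
proof -
  have rc: "\<And>i. i \<in> {1..N} \<Longrightarrow> (\<Sum>j\<in>B i. p' (j, i)) = real (k i)"
    "\<And>j. j \<in> {1..N} \<Longrightarrow> (\<Sum>i\<in>out_nbrs F j. p' (j, i)) = real (k j)"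
    using assms by (auto simp: transport_polytope_def)
  have "(\<Sum>i = 1..N. \<Sum>j\<in>B i. p' (j, i) * (a i - b j)) =
      (\<Sum>i = 1..N. \<Sum>j\<in>B i. p' (j, i) * a i) - (\<Sum>i = 1..N. \<Sum>j\<in>B i. p' (j, i) * b j)"
    by (simp add: right_diff_distrib sum_subtractf)
  also have "(\<Sum>i = 1..N. \<Sum>j\<in>B i. p' (j, i) * a i) = (\<Sum>i = 1..N. real (k i) * a i)"
    by (rule sum.cong[OF refl]) (simp add: rc flip: sum_distrib_right)
  also have "(\<Sum>i = 1..N. \<Sum>j\<in>B i. p' (j, i) * b j) = (\<Sum>j = 1..N. \<Sum>i\<in>out_nbrs F j. p' (j, i) * b j)"
    by (rule out_in_nbrs_sum[OF F])
  also have "\<dots> = (\<Sum>j = 1..N. real (k j) * b j)"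
    by (rule sum.cong[OF refl]) (simp add: rc flip: sum_distrib_right)
  finally show ?thesis .
qed

definition pstar :: "nat \<times> nat \<Rightarrow> real" where
  "pstar = (\<lambda>(j, i). if (j, i) \<in> F then real (k i) * q i j else 0)"

lemma cond_prob_pstar: "i \<in> {1..N} \<Longrightarrow> Defs.cond_prob k pstar i j = q i j"
  using kpos[of i] by (auto simp: Defs.cond_prob_def pstar_def q_def in_nbrs_def)

lemma q_off: "j \<notin> B i \<Longrightarrow> q i j = 0"
  by (simp add: q_def)

lemma pstar_polytope: "pstar \<in> transport_polytope N k F"
  unfolding transport_polytope_def
proof (intro CollectI conjI ballI allI impI)
  show "0 \<le> pstar e" for e by (cases e) (auto simp: pstar_def q_nonneg)
  show "pstar e = 0" if "e \<notin> F" for e using that by (cases e) (auto simp: pstar_def)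
  fix i assume i: "i \<in> {1..N}"
  have "(\<Sum>j\<in>B i. pstar (j, i)) = (\<Sum>j\<in>B i. real (k i) * q i j)"
    by (intro sum.cong) (auto simp: pstar_def in_nbrs_def)
  then show "(\<Sum>j\<in>B i. pstar (j, i)) = real (k i)" using sum_q[OF i] by (simp flip: sum_distrib_left)
next
  fix j assume j: "j \<in> {1..N}"
  have "(\<Sum>i\<in>out_nbrs F j. pstar (j, i)) = (\<Sum>i\<in>out_nbrs F j. real (k i) * q i j)"
    by (intro sum.cong) (auto simp: pstar_def out_nbrs_def)
  also have "\<dots> = (\<Sum>i = 1..N. real (k i) * q i j)"
    by (rule sum.mono_neutral_left) (use F in \<open>auto simp: out_nbrs_def in_nbrs_def q_def\<close>)
  finally show "(\<Sum>i\<in>out_nbrs F j. pstar (j, i)) = real (k j)" using stationary[OF j] by simp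
qed

lemma ln_q: "j \<in> B i \<Longrightarrow> ln (q i j) = y j - ln (Z y i)"
  using Z_pos[of i y] B_index[of j i] by (simp add: q_def ln_div)

text \<open>Gibbs' inequality against \<open>q\<close>. Because \<open>ln (q i j)\<close> is the
  difference of \<open>y j\<close> and \<open>ln (Z y i)\<close>, its sum weighted by a point of the
  polytope depends on the marginals only and equals \<open>- g y\<close>. Equality in every summand
  forces the point to be \<open>pstar\<close>.\<close>

lemma entropy_le:
  assumes p': "p' \<in> transport_polytope N k F"
  shows "weighted_entropy N k F p' \<le> g y"
    and "weighted_entropy N k F p' = g y \<Longrightarrow> p' = pstar"
proof -
  let ?x = "\<lambda>i j. Defs.cond_prob k p' i j"
  have x: "0 \<le> ?x i j" for i j
    using p' by (cases "(j, i) \<in> F") (auto simp: Defs.cond_prob_def transport_polytope_def)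
  have kx: "real (k i) * ?x i j = p' (j, i)" if "i \<in> {1..N}" for i j
    using kpos[OF that] by (simp add: Defs.cond_prob_def)
  have sx: "(\<Sum>j\<in>B i. ?x i j) = 1" if i: "i \<in> {1..N}" for i
    using p' i kpos[OF i] by (simp add: Defs.cond_prob_def transport_polytope_def flip: sum_divide_distrib)
  define \<delta> where "\<delta> i j = q i j - ?x i j - (?x i j * ln (q i j) - ?x i j * ln (?x i j))" for i j
  have \<delta>: "0 \<le> \<delta> i j" "\<delta> i j = 0 \<Longrightarrow> ?x i j = q i j" if "j \<in> B i" for i j
    using gibbs_term[OF x q_pos[OF that]] unfolding \<delta>_def by auto
  have "(\<Sum>i = 1..N. \<Sum>j\<in>B i. real (k i) * \<delta> i j) = g y - weighted_entropy N k F p'"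
  proof -
    have "(\<Sum>j\<in>B i. real (k i) * \<delta> i j) = (\<Sum>j\<in>B i. p' (j, i) * (ln (Z y i) - y j)) -
        real (k i) * (- (\<Sum>j\<in>B i. ?x i j * ln (?x i j)))" if i: "i \<in> {1..N}" for i
    proof -
      have "(\<Sum>j\<in>B i. real (k i) * \<delta> i j) = real (k i) * (\<Sum>j\<in>B i. q i j - ?x i j) +
          (\<Sum>j\<in>B i. p' (j, i) * (ln (Z y i) - y j)) + real (k i) * (\<Sum>j\<in>B i. ?x i j * ln (?x i j))"
        unfolding sum_distrib_left sum.distrib[symmetric]
        by (intro sum.cong refl) (simp add: \<delta>_def ln_q algebra_simps flip: kx[OF i])
      then show ?thesis using sum_q[OF i] sx[OF i] by (simp add: sum_subtractf)
    qed
    then have "(\<Sum>i = 1..N. \<Sum>j\<in>B i. real (k i) * \<delta> i j) =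
        (\<Sum>i = 1..N. (\<Sum>j\<in>B i. p' (j, i) * (ln (Z y i) - y j)) -
          real (k i) * (- (\<Sum>j\<in>B i. ?x i j * ln (?x i j))))"
      by (rule sum.cong[OF refl])
    then have "(\<Sum>i = 1..N. \<Sum>j\<in>B i. real (k i) * \<delta> i j) =
        (\<Sum>i = 1..N. \<Sum>j\<in>B i. p' (j, i) * (ln (Z y i) - y j)) - weighted_entropy N k F p'"
      by (simp only: weighted_entropy_def sum_subtractf)
    then show ?thesis unfolding marginal_sum[OF p'] g_alt .
  qed
  moreover have nn: "0 \<le> real (k i) * \<delta> i j" if "j \<in> B i" for i j using \<delta>(1)[OF that] by simp
  ultimately show "weighted_entropy N k F p' \<le> g y"
    using sum_nonneg[of "{1..N}" "\<lambda>i. \<Sum>j\<in>B i. real (k i) * \<delta> i j"] by (simp add: sum_nonneg)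
  assume "weighted_entropy N k F p' = g y"
  then have "(\<Sum>i = 1..N. \<Sum>j\<in>B i. real (k i) * \<delta> i j) = 0"
    using \<open>(\<Sum>i = 1..N. \<Sum>j\<in>B i. real (k i) * \<delta> i j) = g y - weighted_entropy N k F p'\<close> by simp
  then have "\<forall>i\<in>{1..N}. (\<Sum>j\<in>B i. real (k i) * \<delta> i j) = 0"
    by (subst (asm) sum_nonneg_eq_0_iff) (auto intro!: sum_nonneg nn)
  then have s0: "\<And>i. i \<in> {1..N} \<Longrightarrow> (\<Sum>j\<in>B i. real (k i) * \<delta> i j) = 0" by blast
  have z: "\<delta> i j = 0" if j: "j \<in> B i" for i j
  proof -
    note i = B_index(1)[OF j]
    have "\<forall>j\<in>B i. real (k i) * \<delta> i j = 0"
      using s0[OF i] sum_nonneg_eq_0_iff[OF B_finite, of i "\<lambda>j. real (k i) * \<delta> i j"] nn by simp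
    then have "real (k i) * \<delta> i j = 0" using j by (rule bspec)
    then show ?thesis using kpos[OF i] by simp
  qed
  show "p' = pstar"
  proof
    fix e :: "nat \<times> nat"
    obtain j i where e: "e = (j, i)" by (cases e)
    show "p' e = pstar e"
    proof (cases "e \<in> F")
      case True
      then have j: "j \<in> B i" by (simp add: e in_nbrs_def)
      have "p' e = real (k i) * ?x i j" using kx B_index(1)[OF j] e by simp
      also have "\<dots> = pstar e" using True \<delta>(2)[OF j z[OF j]] by (simp add: pstar_def e)
      finally show ?thesis .
    next
      case False
      then show ?thesis using p' by (auto simp: transport_polytope_def pstar_def e)
    qed
  qed
qed

lemma entropy_pstar: "weighted_entropy N k F pstar = g y"
proof -
  have "weighted_entropy N k F pstar = (\<Sum>i = 1..N. \<Sum>j\<in>B i. pstar (j, i) * (ln (Z y i) - y j))"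
    unfolding weighted_entropy_def
  proof (rule sum.cong[OF refl])
    fix i assume i: "i \<in> {1..N}"
    have "(\<Sum>j\<in>B i. pstar (j, i) * (ln (Z y i) - y j)) = (\<Sum>j\<in>B i. real (k i) * (- (q i j * ln (q i j))))"
      by (intro sum.cong refl) (simp add: ln_q pstar_def in_nbrs_def algebra_simps)
    then show "real (k i) * (- (\<Sum>j\<in>B i. Defs.cond_prob k pstar i j * ln (Defs.cond_prob k pstar i j))) =
        (\<Sum>j\<in>B i. pstar (j, i) * (ln (Z y i) - y j))"
      by (simp add: cond_prob_pstar[OF i] sum_negf sum_distrib_left)
  qed
  then show ?thesis unfolding marginal_sum[OF pstar_polytope] g_alt .
qed

lemma entropy_maximizer_eq: "entropy_maximizer N k F = pstar"
  unfolding entropy_maximizer_def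
proof (rule the_equality)
  show "pstar \<in> transport_polytope N k F \<and>
    (\<forall>p'\<in>transport_polytope N k F. weighted_entropy N k F p' \<le> weighted_entropy N k F pstar)"
    using pstar_polytope entropy_le(1) entropy_pstar by simp
  fix p' assume p': "p' \<in> transport_polytope N k F \<and>
    (\<forall>q\<in>transport_polytope N k F. weighted_entropy N k F q \<le> weighted_entropy N k F p')"
  then have "g y \<le> weighted_entropy N k F p'" using pstar_polytope entropy_pstar by metis
  then show "p' = pstar" using entropy_le[of p'] p' by auto
qed

section \<open>The reduced covariance\<close>

definition var :: "nat \<Rightarrow> (nat \<Rightarrow> real) \<Rightarrow> real" where
  "var i \<theta> = (\<Sum>j\<in>B i. q i j * (\<theta> j)\<^sup>2) - (\<Sum>j\<in>B i. q i j * \<theta> j)\<^sup>2"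

text \<open>The quadratic analogue of \<open>spread\<close>, weighted by pairs of independent
  choices; for distances of angles it is twice the variance form.\<close>

definition energy :: "(nat \<Rightarrow> nat \<Rightarrow> real) \<Rightarrow> real" where
  "energy d = (\<Sum>i = 1..N. \<Sum>a\<in>B i. \<Sum>b\<in>B i. real (k i) * q i a * q i b * (d a b)\<^sup>2)"

text \<open>The mean square distance of two independent copies is twice the variance.\<close>

lemma var_eq:
  assumes i: "i \<in> {1..N}"
  shows "(\<Sum>a\<in>B i. \<Sum>b\<in>B i. q i a * q i b * (\<theta> a - \<theta> b)\<^sup>2) = 2 * var i \<theta>"
proof -
  have "(\<Sum>a\<in>B i. \<Sum>b\<in>B i. q i a * q i b * (\<theta> a - \<theta> b)\<^sup>2) =
      (\<Sum>a\<in>B i. q i a * (\<theta> a)\<^sup>2) * (\<Sum>b\<in>B i. q i b) + (\<Sum>a\<in>B i. q i a) * (\<Sum>b\<in>B i. q i b * (\<theta> b)\<^sup>2)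
      - 2 * ((\<Sum>a\<in>B i. q i a * \<theta> a) * (\<Sum>b\<in>B i. q i b * \<theta> b))"
  proof -
    have "(\<Sum>a\<in>B i. \<Sum>b\<in>B i. q i a * q i b * (\<theta> a - \<theta> b)\<^sup>2) =
        (\<Sum>a\<in>B i. \<Sum>b\<in>B i. (q i a * (\<theta> a)\<^sup>2) * q i b + q i a * (q i b * (\<theta> b)\<^sup>2)
          - 2 * ((q i a * \<theta> a) * (q i b * \<theta> b)))"
      by (intro sum.cong refl) (simp add: power2_eq_square algebra_simps)
    then show ?thesis by (simp only: sum.distrib sum_subtractf sum_product sum_distrib_left[of 2])
  qed
  then show ?thesis by (simp add: sum_q[OF i] var_def power2_eq_square)
qed

lemma energy_dist: "energy (\<lambda>a b. \<bar>\<theta> a - \<theta> b\<bar>) = 2 * (\<Sum>i = 1..N. real (k i) * var i \<theta>)"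
  unfolding energy_def sum_distrib_left
proof (rule sum.cong[OF refl])
  fix i assume i: "i \<in> {1..N}"
  have "(\<Sum>a\<in>B i. \<Sum>b\<in>B i. real (k i) * q i a * q i b * \<bar>\<theta> a - \<theta> b\<bar>\<^sup>2) =
      real (k i) * (\<Sum>a\<in>B i. \<Sum>b\<in>B i. q i a * q i b * (\<theta> a - \<theta> b)\<^sup>2)"
    by (simp add: sum_distrib_left mult.assoc)
  then show "(\<Sum>a\<in>B i. \<Sum>b\<in>B i. real (k i) * q i a * q i b * \<bar>\<theta> a - \<theta> b\<bar>\<^sup>2) = 2 * (real (k i) * var i \<theta>)"
    by (simp add: var_eq[OF i])
qed

text \<open>Cauchy-Schwarz passes from the sum of distances to the weighted sum of squares; the
  weights are positive because \<open>q\<close> is positive on edges.\<close>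

lemma dist_rep_energy:
  "\<exists>c>0. \<forall>d. pseudometric d \<longrightarrow> (\<forall>j\<in>{1..N}. (d j (rep j))\<^sup>2 \<le> c * energy d)"
proof -
  obtain K where K: "K > 0" "\<forall>d. pseudometric d \<longrightarrow> (\<forall>j\<in>{1..N}. d j (rep j) \<le> K * spread d)"
    using dist_rep_bound by blast
  let ?T = "SIGMA i:{1..N}. B i \<times> B i"
  define w where "w = (\<lambda>(i, a, b). real (k i) * q i a * q i b)"
  have w: "0 < w t" if "t \<in> ?T" for t
    using that q_pos kpos by (auto simp: w_def)
  define W where "W = (\<Sum>t\<in>?T. 1 / w t)"
  have W: "0 \<le> W" unfolding W_def using w by (intro sum_nonneg) (auto intro: less_imp_le)
  have finT: "finite ?T" by simp
  \<comment> \<open>The added 1 makes the constant positive.\<close>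
  have "(d j (rep j))\<^sup>2 \<le> (K\<^sup>2 * W + 1) * energy d" if d: "pseudometric d" and j: "j \<in> {1..N}" for d j
  proof -
    define D where "D = (\<lambda>(i::nat, a, b). d a b)"
    have nn: "0 \<le> d a b" for a b using d by (simp add: pseudometric_def)
    have sp: "spread d = (\<Sum>t\<in>?T. D t)"
      unfolding spread_def D_def by (simp add: sum.cartesian_product sum.Sigma case_prod_unfold)
    have en: "energy d = (\<Sum>t\<in>?T. w t * (D t)\<^sup>2)"
      unfolding energy_def D_def w_def by (simp add: sum.cartesian_product sum.Sigma case_prod_unfold)
    have "(\<Sum>t\<in>?T. D t) = (\<Sum>t\<in>?T. (1 / sqrt (w t)) * (sqrt (w t) * D t))"
      by (rule sum.cong[OF refl]) (use w in \<open>force simp: less_imp_neq[symmetric]\<close>)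
    then have "(spread d)\<^sup>2 \<le> (\<Sum>t\<in>?T. (1 / sqrt (w t))\<^sup>2) * (\<Sum>t\<in>?T. (sqrt (w t) * D t)\<^sup>2)"
      unfolding sp by (simp only: Cauchy_Schwarz_ineq_sum)
    also have "(\<Sum>t\<in>?T. (1 / sqrt (w t))\<^sup>2) = W"
      unfolding W_def using w by (intro sum.cong refl) (simp add: power_divide less_imp_le)
    also have "(\<Sum>t\<in>?T. (sqrt (w t) * D t)\<^sup>2) = energy d"
      unfolding en using w by (intro sum.cong refl) (simp add: power_mult_distrib less_imp_le)
    finally have s2: "(spread d)\<^sup>2 \<le> W * energy d" .
    have e0: "0 \<le> energy d" unfolding en using w by (intro sum_nonneg) (simp add: less_imp_le)
    have "(d j (rep j))\<^sup>2 \<le> (K * spread d)\<^sup>2"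
      using K(2) d j nn by (intro power_mono) auto
    also have "\<dots> \<le> K\<^sup>2 * (W * energy d)" using s2 by (simp add: power_mult_distrib mult_left_mono)
    finally show ?thesis using e0 by (simp add: algebra_simps)
  qed
  moreover have "0 < K\<^sup>2 * W + 1" using W by (simp add: add_nonneg_pos)
  ultimately show ?thesis by blast
qed

definition n :: nat where "n = card ({1..N} - R)"

text \<open>Enumerates the players outside \<open>R\<close> in the order in which
  \<open>submatrix\<close> picks them; \<open>Suc\<close> translates matrix rows into
  players.\<close>

definition w :: "nat \<Rightarrow> nat" where "w a = Suc (pick {a. Suc a \<notin> R} a)"

text \<open>The index set given to \<open>submatrix\<close> is not cut off at \<open>N\<close>, so
  the facts on \<open>pick\<close> for infinite sets apply.\<close>

lemma infinite_I: "infinite {a. Suc a \<notin> R}"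
proof
  assume "finite {a. Suc a \<notin> R}"
  moreover have "finite {a. Suc a \<in> R}"
    using finite_vimageI[OF finite_R, of Suc] by (simp add: vimage_def)
  ultimately have "finite ({a. Suc a \<notin> R} \<union> {a. Suc a \<in> R})" by blast
  moreover have "{a. Suc a \<notin> R} \<union> {a. Suc a \<in> R} = (UNIV :: nat set)" by auto
  ultimately show False by simp
qed

lemma n_eq: "n = card {a. a < N \<and> a \<in> {a. Suc a \<notin> R}}"
proof -
  have "bij_betw Suc {a. a < N \<and> a \<in> {a. Suc a \<notin> R}} ({1..N} - R)"
    unfolding bij_betw_def
  proof
    show "Suc ` {a. a < N \<and> a \<in> {a. Suc a \<notin> R}} = {1..N} - R"
    proof (intro subset_antisym subsetI)
      fix x assume x: "x \<in> {1..N} - R"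
      then obtain a where "x = Suc a" by (cases x) auto
      then show "x \<in> Suc ` {a. a < N \<and> a \<in> {a. Suc a \<notin> R}}" using x by auto
    qed auto
  qed simp
  from bij_betw_same_card[OF this] show ?thesis unfolding n_def by simp
qed

lemma w_bij: "bij_betw w {..<n} ({1..N} - R)"
  unfolding bij_betw_def
proof
  have inj: "inj_on w {..<n}"
  proof (rule inj_onI)
    fix a b assume "w a = w b"
    then have "pick {a. Suc a \<notin> R} a = pick {a. Suc a \<notin> R} b" by (simp add: w_def)
    then show "a = b" using pick_eq_iff_inf[OF infinite_I] by blast
  qed
  then show "inj_on w {..<n}" .
  have sub: "w ` {..<n} \<subseteq> {1..N} - R"
  proof
    fix j assume "j \<in> w ` {..<n}"
    then obtain a where a: "a < n" "j = w a" by blast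
    have "pick {a. Suc a \<notin> R} a < N" by (rule pick_le) (use a n_eq in simp)
    moreover have "pick {a. Suc a \<notin> R} a \<in> {a. Suc a \<notin> R}" by (rule pick_in_set_inf[OF infinite_I])
    ultimately show "j \<in> {1..N} - R" by (simp add: a w_def)
  qed
  show "w ` {..<n} = {1..N} - R"
    by (rule card_subset_eq[OF _ sub]) (use card_image[OF inj] n_def in auto)
qed

lemma n_real: "real N - real (num_components N F) = real n"
  unfolding n_def card_R[symmetric] using R_sub card_mono[of "{1..N}" R]
  by (subst card_Diff_subset) (auto simp: of_nat_diff)

definition Q :: "nat \<Rightarrow> nat \<Rightarrow> real" where
  "Q a b = (\<Sum>i = 1..N. real (k i) * ((if a = b then q i (w a) else 0) - q i (w a) * q i (w b)))"

lemma reduced_covariance_eq: "reduced_covariance N k F R = mat n n (\<lambda>(a, b). Q a b)"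
proof (rule eq_matI)
  let ?I = "{a. Suc a \<notin> R}"
  let ?C = "covariance N k (entropy_maximizer N k F)"
  have dims: "dim_row ?C = N" "dim_col ?C = N" by (auto simp: covariance_def)
  show dimr: "dim_row (reduced_covariance N k F R) = dim_row (mat n n (\<lambda>(a, b). Q a b))"
    "dim_col (reduced_covariance N k F R) = dim_col (mat n n (\<lambda>(a, b). Q a b))"
    unfolding reduced_covariance_def dim_submatrix dims using n_eq by simp_all
  fix a b assume "a < dim_row (mat n n (\<lambda>(a, b). Q a b))" "b < dim_col (mat n n (\<lambda>(a, b). Q a b))"
  then have ab: "a < n" "b < n" by auto
  have pN: "pick ?I a < N" "pick ?I b < N" by (rule pick_le, use ab n_eq in simp)+
  have "reduced_covariance N k F R $$ (a, b) = ?C $$ (pick ?I a, pick ?I b)"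
    unfolding reduced_covariance_def by (rule submatrix_index) (use ab n_eq dims in simp_all)
  also have "\<dots> = (\<Sum>i = 1..N. real (k i) *
     ((if pick ?I a = pick ?I b then Defs.cond_prob k pstar i (w a) else 0) -
      Defs.cond_prob k pstar i (w a) * Defs.cond_prob k pstar i (w b)))"
    unfolding covariance_def entropy_maximizer_eq w_def using pN by simp
  also have "\<dots> = Q a b"
    unfolding Q_def pick_eq_iff_inf[OF infinite_I, symmetric]
    by (rule sum.cong[OF refl]) (simp add: cond_prob_pstar)
  finally show "reduced_covariance N k F R $$ (a, b) = mat n n (\<lambda>(a, b). Q a b) $$ (a, b)"
    using ab by simp
qed

definition ext :: "(nat \<Rightarrow> real) \<Rightarrow> nat \<Rightarrow> real" where
  "ext x j = (if j \<in> {1..N} - R then x (inv_into {..<n} w j) else 0)"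

lemma ext_w: "a < n \<Longrightarrow> ext x (w a) = x a"
  using w_bij by (auto simp: ext_def bij_betw_def inv_into_f_f)

lemma ext_R: "r \<in> R \<Longrightarrow> ext x r = 0"
  by (simp add: ext_def)

lemma sum_ext:
  fixes f :: "nat \<Rightarrow> 'a::real_vector"
  assumes "\<And>j. j \<in> {1..N} \<Longrightarrow> ext x j = 0 \<Longrightarrow> f j = 0"
  shows "(\<Sum>j = 1..N. f j) = (\<Sum>a<n. f (w a))"
proof -
  have "(\<Sum>j = 1..N. f j) = (\<Sum>j\<in>{1..N} - R. f j)"
    by (rule sum.mono_neutral_right) (use assms ext_R in auto)
  also have "\<dots> = (\<Sum>a<n. f (w a))" by (rule sum.reindex_bij_betw[OF w_bij, symmetric])
  finally show ?thesis .
qed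

lemma sum_B_ext:
  fixes h :: "real \<Rightarrow> real"
  assumes "h 0 = 0"
  shows "(\<Sum>j\<in>B i. q i j * h (ext x j)) = (\<Sum>a<n. q i (w a) * h (x a))"
proof -
  have "(\<Sum>j\<in>B i. q i j * h (ext x j)) = (\<Sum>j = 1..N. q i j * h (ext x j))"
    by (rule sum.mono_neutral_left) (use B_sub q_off in auto)
  also have "\<dots> = (\<Sum>a<n. q i (w a) * h (ext x (w a)))" by (rule sum_ext[of x "\<lambda>j. q i j * h (ext x j)"]) (use assms in auto)
  finally show ?thesis by (simp add: ext_w)
qed

lemma qform_Q: "qform n Q x = (\<Sum>i = 1..N. real (k i) * var i (ext x))"
proof -
  have "var i (ext x) = (\<Sum>a<n. q i (w a) * (x a)\<^sup>2) - (\<Sum>a<n. q i (w a) * x a)\<^sup>2" for i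
    unfolding var_def using sum_B_ext[of "\<lambda>t. t\<^sup>2" i x] sum_B_ext[of "\<lambda>t. t" i x] by simp
  also have "\<dots> i = (\<Sum>a<n. \<Sum>b<n. ((if a = b then q i (w a) else 0) - q i (w a) * q i (w b)) * x a * x b)" for i
  proof -
    have "(\<Sum>b<n. ((if a = b then q i (w a) else 0) - q i (w a) * q i (w b)) * x a * x b) =
        q i (w a) * (x a)\<^sup>2 - (q i (w a) * x a) * (\<Sum>b<n. q i (w b) * x b)" if "a < n" for a
    proof -
      have "(\<Sum>b<n. ((if a = b then q i (w a) else 0) - q i (w a) * q i (w b)) * x a * x b) =
          (\<Sum>b<n. (if a = b then q i (w a) * x a * x b else 0) - (q i (w a) * x a) * (q i (w b) * x b))"
        by (intro sum.cong refl) (simp add: algebra_simps)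
      then show ?thesis using that by (simp add: sum_subtractf power2_eq_square flip: sum_distrib_left)
    qed
    then have "(\<Sum>a<n. \<Sum>b<n. ((if a = b then q i (w a) else 0) - q i (w a) * q i (w b)) * x a * x b) =
        (\<Sum>a<n. q i (w a) * (x a)\<^sup>2 - (q i (w a) * x a) * (\<Sum>b<n. q i (w b) * x b))"
      by (intro sum.cong refl) auto
    then show ?thesis by (simp add: sum_subtractf power2_eq_square flip: sum_distrib_right)
  qed
  finally have v: "var i (ext x) = (\<Sum>a<n. \<Sum>b<n. ((if a = b then q i (w a) else 0) - q i (w a) * q i (w b)) * x a * x b)" for i .
  show ?thesis
    unfolding v qform_def Q_def sum_distrib_left sum_distrib_right
    by (subst (2) sum.swap, rule sum.cong[OF refl], subst sum.swap) (simp add: mult.assoc)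
qed

text \<open>By the path estimate the form bounds the distance of every angle from the angle at its
  representative, which \<open>ext\<close> sets to 0.\<close>

lemma pos_def_Q: "pos_def n Q"
  unfolding pos_def_def
proof (intro conjI allI impI)
  show "Q a b = Q b a" for a b
    unfolding Q_def by (intro sum.cong refl) (simp add: mult_ac)
  fix x :: "nat \<Rightarrow> real" assume "\<exists>a<n. x a \<noteq> 0"
  then obtain a where a: "a < n" "x a \<noteq> 0" by blast
  let ?d = "\<lambda>i j. \<bar>ext x i - ext x j\<bar>"
  obtain c where c: "c > 0" "\<forall>d. pseudometric d \<longrightarrow> (\<forall>j\<in>{1..N}. (d j (rep j))\<^sup>2 \<le> c * energy d)"
    using dist_rep_energy by blast
  have w: "w a \<in> {1..N}" using w_bij a(1) by (auto simp: bij_betw_def)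
  have "pseudometric ?d" by (auto simp: pseudometric_def)
  then have "(?d (w a) (rep (w a)))\<^sup>2 \<le> c * energy ?d" using c(2) w by blast
  moreover have "?d (w a) (rep (w a)) = \<bar>x a\<bar>" using ext_w[OF a(1)] ext_R[OF rep(1)[OF w]] by simp
  ultimately have "(x a)\<^sup>2 \<le> c * (2 * qform n Q x)" by (simp add: energy_dist qform_Q)
  moreover have "0 < (x a)\<^sup>2" using a(2) by simp
  ultimately have "0 < c * (2 * qform n Q x)" by linarith
  then show "0 < qform n Q x" using c(1) by (simp add: zero_less_mult_iff)
qed

end

section \<open>The characteristic function\<close>

text \<open>A crude constant is enough for the Gaussian bound. Up to \<open>pi / 3\<close> the
  cosine is at least 1/2; beyond it the sine is at least \<open>sqrt 3 / 2\<close>, while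
  \<open>u\<close> is at most 2.\<close>

lemma sin_ge_third:
  assumes "0 \<le> u" "u \<le> pi / 2"
  shows "u / 3 \<le> sin u"
proof (cases "u \<le> pi / 3")
  case True
  show ?thesis
  proof (cases "u = 0")
    case False
    then have "0 < u" using assms by simp
    then obtain z where z: "0 < z" "z < u" "sin u - sin 0 = (u - 0) * cos z"
      using MVT2[of 0 u sin cos] by auto
    have "cos (pi / 3) \<le> cos z"
      by (rule cos_monotone_0_pi_le) (use z True pi_gt_zero in auto)
    then have "1 / 2 \<le> cos z" by (simp add: cos_60)
    then have "u * (1 / 2) \<le> u * cos z" using assms by (intro mult_left_mono) auto
    then show ?thesis using z assms by simp
  qed simp
next
  case False
  have "sin (pi / 3) \<le> sin u"
    by (rule sin_monotone_2pi_le) (use False assms pi_gt_zero in auto)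
  moreover have "4 / 3 \<le> sqrt 3" by (rule real_le_rsqrt) (simp add: power2_eq_square)
  moreover have "u \<le> 2" using assms pi_less_4 by simp
  ultimately show ?thesis by (simp add: sin_60)
qed

lemma cmod_cis_minus_one: "cmod (cis t - 1) = 2 * \<bar>sin (t / 2)\<bar>"
proof -
  have "(cmod (cis t - 1))\<^sup>2 = (cos t - 1)\<^sup>2 + (sin t)\<^sup>2" by (simp add: cmod_power2)
  also have "\<dots> = 2 - 2 * cos t"
    using sin_cos_squared_add[of t] by (simp add: power2_eq_square algebra_simps)
  also have "\<dots> = (2 * \<bar>sin (t / 2)\<bar>)\<^sup>2"
    using cos_double_sin[of "t / 2"] by (simp add: power_mult_distrib)
  finally show ?thesis by (rule power2_eq_imp_eq) auto
qed

lemma cmod_cis_minus_one_ge: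
  assumes "\<bar>t\<bar> \<le> pi"
  shows "\<bar>t\<bar> / 3 \<le> cmod (cis t - 1)"
proof -
  have "\<bar>t\<bar> / 2 / 3 \<le> sin (\<bar>t\<bar> / 2)" by (rule sin_ge_third) (use assms in auto)
  also have "\<dots> \<le> \<bar>sin (t / 2)\<bar>" by (cases "t \<ge> 0") auto
  finally show ?thesis by (simp add: cmod_cis_minus_one)
qed

lemma cis_sum: "cis (\<Sum>i\<in>A. f i) = (\<Prod>i\<in>A. cis (f i))"
  by (induction A rule: infinite_finite_induct) (auto simp flip: cis_mult)

text \<open>\<open>z m\<close> and \<open>exp (a / m)\<close> both lie in the closed unit disc, so
  their \<open>m\<close>-th powers differ by at most \<open>m\<close> times their difference; this
  tends to 0 because both have the same first-order limit.\<close>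

lemma power_tendsto_exp:
  fixes z :: "nat \<Rightarrow> complex" and a :: real
  assumes "\<And>m. cmod (z m) \<le> 1" "a \<le> 0" "((\<lambda>m. of_nat m * (z m - 1)) \<longlongrightarrow> of_real a) sequentially"
  shows "(\<lambda>m. z m ^ m) \<longlonglongrightarrow> of_real (exp a)"
proof -
  define v where "v m = exp (a / real m)" for m
  have v1: "cmod (of_real (v m)) \<le> 1" for m
    using assms(2) by (simp add: v_def divide_nonpos_nonneg)
  have "(\<lambda>m. real m * (v m - 1)) \<longlonglongrightarrow> a"
  proof -
    have "((\<lambda>x. exp (a * x)) has_real_derivative a) (at 0)"
      by (auto intro!: derivative_eq_intros)
    then have "((\<lambda>x. (exp (a * x) - 1) / x) \<longlongrightarrow> a) (at 0)"
      by (simp add: has_field_derivative_iff)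
    moreover have "filterlim (\<lambda>m. 1 / real m) (at 0) sequentially"
      unfolding filterlim_at
      by (auto intro!: lim_1_over_n eventually_sequentiallyI[of 1])
    ultimately have "(\<lambda>m. (exp (a * (1 / real m)) - 1) / (1 / real m)) \<longlonglongrightarrow> a"
      by (rule filterlim_compose)
    then show ?thesis by (simp add: v_def mult.commute)
  qed
  then have "(\<lambda>m. of_real (real m * (v m - 1))) \<longlonglongrightarrow> complex_of_real a"
    by (rule tendsto_of_real)
  then have "(\<lambda>m. of_nat m * (z m - 1) - of_real (real m * (v m - 1))) \<longlonglongrightarrow> of_real a - of_real a"
    by (intro tendsto_diff assms(3))
  then have lim0: "(\<lambda>m. real m * cmod (z m - of_real (v m))) \<longlonglongrightarrow> 0"
  proof -
    assume "(\<lambda>m. of_nat m * (z m - 1) - of_real (real m * (v m - 1))) \<longlonglongrightarrow> complex_of_real a - of_real a"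
    then have "(\<lambda>m. cmod (of_nat m * (z m - 1) - of_real (real m * (v m - 1)))) \<longlonglongrightarrow> 0"
      by (simp add: tendsto_norm_zero)
    moreover have "cmod (of_nat m * (z m - 1) - of_real (real m * (v m - 1))) = real m * cmod (z m - of_real (v m))" for m
    proof -
      have "of_nat m * (z m - 1) - of_real (real m * (v m - 1)) = of_nat m * (z m - of_real (v m))"
        by (simp add: algebra_simps)
      then show ?thesis by (simp add: norm_mult)
    qed
    ultimately show ?thesis by simp
  qed
  have "(\<lambda>m. z m ^ m - of_real (v m) ^ m) \<longlonglongrightarrow> 0"
    by (rule Lim_null_comparison[OF _ lim0])
       (intro always_eventually allI norm_power_diff assms(1) v1)
  moreover have "(\<lambda>m. complex_of_real (v m) ^ m) \<longlonglongrightarrow> of_real (exp a)"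
  proof (rule tendsto_eventually)
    show "\<forall>\<^sub>F m in sequentially. complex_of_real (v m) ^ m = of_real (exp a)"
      by (rule eventually_sequentiallyI[of 1])
         (simp add: v_def flip: of_real_power exp_of_nat_mult)
  qed
  ultimately have "(\<lambda>m. (z m ^ m - of_real (v m) ^ m) + complex_of_real (v m) ^ m) \<longlonglongrightarrow> 0 + of_real (exp a)"
    by (rule tendsto_add)
  then show ?thesis by simp
qed

context supported
begin

definition \<phi> :: "nat \<Rightarrow> (nat \<Rightarrow> real) \<Rightarrow> complex" where
  "\<phi> i \<theta> = (\<Sum>j\<in>B i. of_real (q i j) * cis (\<theta> j))"

text \<open>The characteristic function of the counts, centred at \<open>k\<close>, when every
  player \<open>i\<close> makes \<open>k i\<close> independent choices; its \<open>m\<close>-th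
  power belongs to \<open>m k\<close>.\<close>

definition \<Psi> :: "(nat \<Rightarrow> real) \<Rightarrow> complex" where
  "\<Psi> \<theta> = (\<Prod>i = 1..N. \<phi> i \<theta> ^ k i) * cis (- (\<Sum>j = 1..N. real (k j) * \<theta> j))"

text \<open>The squared chord splits into squared differences of cosines and of sines, and each part
  is twice a variance.\<close>

lemma cmod_\<phi>:
  assumes i: "i \<in> {1..N}"
  shows "(cmod (\<phi> i \<theta>))\<^sup>2 = 1 - (\<Sum>a\<in>B i. \<Sum>b\<in>B i. q i a * q i b * (cmod (cis (\<theta> a) - cis (\<theta> b)))\<^sup>2) / 2"
proof -
  have "(\<Sum>a\<in>B i. \<Sum>b\<in>B i. q i a * q i b * (cmod (cis (\<theta> a) - cis (\<theta> b)))\<^sup>2) =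
      (\<Sum>a\<in>B i. \<Sum>b\<in>B i. q i a * q i b * (cos (\<theta> a) - cos (\<theta> b))\<^sup>2) +
      (\<Sum>a\<in>B i. \<Sum>b\<in>B i. q i a * q i b * (sin (\<theta> a) - sin (\<theta> b))\<^sup>2)"
    unfolding sum.distrib[symmetric]
    by (intro sum.cong refl) (simp add: cmod_power2 ring_distribs)
  also have "\<dots> = 2 * var i (\<lambda>j. cos (\<theta> j)) + 2 * var i (\<lambda>j. sin (\<theta> j))"
    using var_eq[OF i, of "\<lambda>j. cos (\<theta> j)"] var_eq[OF i, of "\<lambda>j. sin (\<theta> j)"] by simp
  also have "\<dots> = 2 * ((\<Sum>j\<in>B i. q i j * ((cos (\<theta> j))\<^sup>2 + (sin (\<theta> j))\<^sup>2)) -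
      ((\<Sum>j\<in>B i. q i j * cos (\<theta> j))\<^sup>2 + (\<Sum>j\<in>B i. q i j * sin (\<theta> j))\<^sup>2))"
    by (simp only: var_def ring_distribs sum.distrib)
  also have "(\<Sum>j\<in>B i. q i j * ((cos (\<theta> j))\<^sup>2 + (sin (\<theta> j))\<^sup>2)) = 1"
    by (simp add: sum_q[OF i])
  also have "(\<Sum>j\<in>B i. q i j * cos (\<theta> j))\<^sup>2 + (\<Sum>j\<in>B i. q i j * sin (\<theta> j))\<^sup>2 = (cmod (\<phi> i \<theta>))\<^sup>2"
    by (simp add: cmod_power2 \<phi>_def)
  finally have eq: "(\<Sum>a\<in>B i. \<Sum>b\<in>B i. q i a * q i b * (cmod (cis (\<theta> a) - cis (\<theta> b)))\<^sup>2) =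
      2 * (1 - (cmod (\<phi> i \<theta>))\<^sup>2)" .
  show ?thesis unfolding eq by (simp add: field_simps)
qed

lemma cmod_\<phi>_le: "i \<in> {1..N} \<Longrightarrow> cmod (\<phi> i \<theta>) \<le> 1"
  unfolding \<phi>_def using sum_q[of i] q_nonneg
  by (intro order_trans[OF norm_sum]) (simp add: norm_mult)

lemma \<Psi>_bound_energy: "(cmod (\<Psi> \<theta>))\<^sup>2 \<le> exp (- energy (\<lambda>a b. cmod (cis (\<theta> a) - cis (\<theta> b))) / 2)"
proof -
  let ?s = "\<lambda>i. \<Sum>a\<in>B i. \<Sum>b\<in>B i. q i a * q i b * (cmod (cis (\<theta> a) - cis (\<theta> b)))\<^sup>2"
  have "(cmod (\<Psi> \<theta>))\<^sup>2 = (\<Prod>i = 1..N. ((cmod (\<phi> i \<theta>))\<^sup>2) ^ k i)"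
    by (simp add: \<Psi>_def norm_mult norm_power prod_norm[symmetric] prod_power_distrib power_mult[symmetric] mult.commute)
  also have "\<dots> \<le> (\<Prod>i = 1..N. exp (- (real (k i) * ?s i) / 2))"
  proof (intro prod_mono conjI)
    fix i assume i: "i \<in> {1..N}"
    have "(cmod (\<phi> i \<theta>))\<^sup>2 \<le> exp (- ?s i / 2)"
      unfolding cmod_\<phi>[OF i] using exp_ge_add_one_self[of "- ?s i / 2"] by simp
    then have "((cmod (\<phi> i \<theta>))\<^sup>2) ^ k i \<le> exp (- ?s i / 2) ^ k i" by (intro power_mono) auto
    then show "((cmod (\<phi> i \<theta>))\<^sup>2) ^ k i \<le> exp (- (real (k i) * ?s i) / 2)"
      by (simp flip: exp_of_nat_mult)
  qed auto
  also have "\<dots> = exp (\<Sum>i = 1..N. - (real (k i) * ?s i) / 2)"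
    by (simp add: exp_sum)
  also have "(\<Sum>i = 1..N. - (real (k i) * ?s i) / 2) = - energy (\<lambda>a b. cmod (cis (\<theta> a) - cis (\<theta> b))) / 2"
    by (simp add: energy_def sum_distrib_left sum_negf mult.assoc flip: sum_divide_distrib)
  finally show ?thesis .
qed

text \<open>The bound holds on the closed cube, where for \<open>n > 0\<close> Taylor expansion at 0
  alone would not reach. With the angles at the representatives fixed, each \<open>cis (x a)\<close>
  is compared with 1 along paths, so no other point of the cube has modulus 1.\<close>

lemma \<Psi>_bound: "\<exists>c>0. \<forall>x. (\<forall>a<n. \<bar>x a\<bar> \<le> pi) \<longrightarrow> cmod (\<Psi> (ext x)) \<le> exp (- c * (\<Sum>a<n. (x a)\<^sup>2))"
proof -
  obtain C where C: "C > 0" "\<forall>d. pseudometric d \<longrightarrow> (\<forall>j\<in>{1..N}. (d j (rep j))\<^sup>2 \<le> C * energy d)"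
    using dist_rep_energy by (elim exE conjE)
  \<comment> \<open>36 is 4 times 9: 9 from squaring the factor 1/3 in the chord estimate, 4 from
    halving the energy and taking a square root of the bound. \<open>n + 1\<close> bounds the number
    of coordinates and is positive.\<close>
  define c where "c = 1 / (36 * C * (real n + 1))"
  have c: "c > 0" using C(1) by (simp add: c_def)
  have "cmod (\<Psi> (ext x)) \<le> exp (- c * (\<Sum>a<n. (x a)\<^sup>2))" if x: "\<forall>a<n. \<bar>x a\<bar> \<le> pi" for x
  proof -
    let ?d = "\<lambda>a b. cmod (cis (ext x a) - cis (ext x b))"
    have pm: "pseudometric ?d"
      unfolding pseudometric_def
    proof (intro conjI allI)
      show "?d u w \<le> ?d u v + ?d v w" for u v w
        using norm_triangle_ineq[of "cis (ext x u) - cis (ext x v)" "cis (ext x v) - cis (ext x w)"] by simp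
    qed (auto simp: norm_minus_commute)
    have b: "(x a)\<^sup>2 \<le> 9 * C * energy ?d" if a: "a < n" for a
    proof -
      have w: "w a \<in> {1..N}" using w_bij a by (auto simp: bij_betw_def)
      have "\<bar>x a\<bar> / 3 \<le> cmod (cis (x a) - 1)" by (rule cmod_cis_minus_one_ge) (use x a in auto)
      also have "\<dots> = ?d (w a) (rep (w a))"
        using ext_w[OF a] ext_R[OF rep(1)[OF w]] by simp
      finally have "(\<bar>x a\<bar> / 3)\<^sup>2 \<le> (?d (w a) (rep (w a)))\<^sup>2" by (intro power_mono) auto
      also have "\<dots> \<le> C * energy ?d" using C(2) pm w by blast
      finally show ?thesis by (simp add: power_divide)
    qed
    have e0: "0 \<le> energy ?d" unfolding energy_def by (intro sum_nonneg mult_nonneg_nonneg q_nonneg) auto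
    have "(\<Sum>a<n. (x a)\<^sup>2) \<le> (\<Sum>a<n. 9 * C * energy ?d)" by (intro sum_mono b) auto
    also have "\<dots> \<le> (real n + 1) * (9 * C * energy ?d)"
      using C(1) e0 by (simp add: mult_right_mono)
    finally have "4 * c * (\<Sum>a<n. (x a)\<^sup>2) \<le> 4 * c * ((real n + 1) * (9 * C * energy ?d))"
      using c by (intro mult_left_mono) auto
    also have "\<dots> = energy ?d * ((36 * C * (real n + 1)) * c)" by simp
    also have "(36 * C * (real n + 1)) * c = 1" using C(1) by (simp add: c_def)
    finally have "4 * c * (\<Sum>a<n. (x a)\<^sup>2) \<le> energy ?d" by simp
    then have "exp (- energy ?d / 2) \<le> exp (- (2 * c * (\<Sum>a<n. (x a)\<^sup>2)))" by simp
    then have "(cmod (\<Psi> (ext x)))\<^sup>2 \<le> exp (- (2 * c * (\<Sum>a<n. (x a)\<^sup>2)))"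
      using \<Psi>_bound_energy[of "ext x"] by linarith
    also have "\<dots> = (exp (- c * (\<Sum>a<n. (x a)\<^sup>2)))\<^sup>2"
      by (simp flip: exp_double)
    finally show ?thesis by (rule power2_le_imp_le) simp
  qed
  then show ?thesis using c by blast
qed

text \<open>By \<open>stationary\<close> the means of all choices add up to \<open>k\<close>, so the
  phase in \<open>\<Psi>\<close> splits among the factors. Centring then removes the linear Taylor
  term factor by factor.\<close>

lemma \<Psi>_centered:
  "\<Psi> \<theta> = (\<Prod>i = 1..N. (\<Sum>j\<in>B i. of_real (q i j) * cis (\<theta> j - (\<Sum>l\<in>B i. q i l * \<theta> l))) ^ k i)"
proof -
  let ?\<mu> = "\<lambda>i. \<Sum>l\<in>B i. q i l * \<theta> l"
  have "(\<Sum>i = 1..N. real (k i) * ?\<mu> i) = (\<Sum>i = 1..N. \<Sum>j = 1..N. real (k i) * (q i j * \<theta> j))"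
    unfolding sum_distrib_left
    by (intro sum.cong refl sum.mono_neutral_left) (use B_sub q_off in auto)
  also have "\<dots> = (\<Sum>j = 1..N. (\<Sum>i = 1..N. real (k i) * q i j) * \<theta> j)"
    by (subst sum.swap) (simp add: sum_distrib_right mult.assoc)
  also have "\<dots> = (\<Sum>j = 1..N. real (k j) * \<theta> j)" by (intro sum.cong refl) (simp only: stationary)
  finally have mean: "(\<Sum>j = 1..N. real (k j) * \<theta> j) = (\<Sum>i = 1..N. real (k i) * ?\<mu> i)" ..
  have "cis (- (\<Sum>j = 1..N. real (k j) * \<theta> j)) = (\<Prod>i = 1..N. cis (- ?\<mu> i) ^ k i)"
  proof -
    have "cis (- (\<Sum>j = 1..N. real (k j) * \<theta> j)) = cis (\<Sum>i = 1..N. - (real (k i) * ?\<mu> i))"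
      by (simp only: mean sum_negf)
    also have "\<dots> = (\<Prod>i = 1..N. cis (- ?\<mu> i) ^ k i)"
      unfolding cis_sum by (intro prod.cong refl) (simp add: Complex.DeMoivre)
    finally show ?thesis .
  qed
  then have "\<Psi> \<theta> = (\<Prod>i = 1..N. (\<phi> i \<theta> * cis (- ?\<mu> i)) ^ k i)"
    by (simp add: \<Psi>_def power_mult_distrib prod.distrib)
  also have "\<dots> = (\<Prod>i = 1..N. (\<Sum>j\<in>B i. of_real (q i j) * cis (\<theta> j - ?\<mu> i)) ^ k i)"
    by (simp add: \<phi>_def sum_distrib_right mult.assoc cis_mult)
  finally show ?thesis .
qed

text \<open>Second-order Taylor expansion. The cubic remainder is of order
  \<open>m powr (- 3 / 2)\<close> and disappears after multiplication by \<open>m\<close>.\<close>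

lemma centered_second_order:
  assumes i: "i \<in> {1..N}" and c: "(\<Sum>j\<in>B i. q i j * c j) = 0"
  shows "(\<lambda>m. of_nat m * ((\<Sum>j\<in>B i. of_real (q i j) * cis (c j / sqrt (real m))) - 1)) \<longlonglongrightarrow>
    of_real (- (\<Sum>j\<in>B i. q i j * (c j)\<^sup>2) / 2)"
proof -
  let ?v = "\<Sum>j\<in>B i. q i j * (c j)\<^sup>2"
  let ?C = "\<Sum>j\<in>B i. q i j * \<bar>c j\<bar> ^ 3"
  let ?f = "\<lambda>m. of_nat m * ((\<Sum>j\<in>B i. of_real (q i j) * cis (c j / sqrt (real m))) - 1) - complex_of_real (- ?v / 2)"
  have bd: "cmod (?f m) \<le> ?C / sqrt (real m)" if m: "m \<ge> 1" for m
  proof -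
    let ?s = "sqrt (real m)"
    have s: "?s > 0" "?s * ?s = real m" using m by auto
    define r where "r j = cis (c j / ?s) - (1 + \<i> * of_real (c j / ?s) - of_real ((c j / ?s)\<^sup>2 / 2))" for j
    have r: "cmod (r j) \<le> \<bar>c j / ?s\<bar> ^ 3" for j
    proof -
      have taylor: "(\<Sum>k\<le>2. (\<i> * complex_of_real t) ^ k / fact k) = 1 + \<i> * of_real t - of_real (t\<^sup>2 / 2)" for t
        by (simp add: numeral_2_eq_2 power2_eq_square algebra_simps)
      have Suc2: "Suc 2 = 3" by simp
      have "cmod (r j) \<le> \<bar>c j / ?s\<bar> ^ Suc 2 / fact (Suc 2)"
        unfolding r_def cis_conv_exp taylor[symmetric] by (rule iexp_approx1)
      then have "cmod (r j) \<le> \<bar>c j / ?s\<bar> ^ 3 / fact 3" unfolding Suc2 .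
      also have "\<dots> \<le> \<bar>c j / ?s\<bar> ^ 3" by (simp add: fact_numeral divide_le_eq)
      finally show ?thesis .
    qed
    have "(\<Sum>j\<in>B i. of_real (q i j) * cis (c j / ?s)) =
        (\<Sum>j\<in>B i. of_real (q i j) * r j) + (\<Sum>j\<in>B i. complex_of_real (q i j)) +
        \<i> * of_real ((\<Sum>j\<in>B i. q i j * c j) / ?s) - of_real (?v / real m / 2)"
    proof -
      have "of_real (q i j) * cis (c j / ?s) = of_real (q i j) * r j + complex_of_real (q i j) +
          \<i> * of_real (q i j * c j / ?s) - of_real (q i j * (c j)\<^sup>2 / real m / 2)" for j
        using s by (simp add: r_def algebra_simps power_divide)
      then show ?thesis
        by (simp add: sum.distrib sum_subtractf flip: sum_distrib_left sum_divide_distrib)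
    qed
    moreover have "(\<Sum>j\<in>B i. complex_of_real (q i j)) = 1" using sum_q[OF i] by (metis of_real_1 of_real_sum)
    ultimately have A: "(\<Sum>j\<in>B i. of_real (q i j) * cis (c j / ?s)) - 1 =
        (\<Sum>j\<in>B i. of_real (q i j) * r j) - of_real (?v / real m / 2)"
      by (simp add: c)
    have gen: "M * (S - 1) - w = M * U" if "S - 1 = U - x" "M * x = v" "w = - v" for M S U x v w :: complex
      using that by (simp add: right_diff_distrib)
    have B: "of_nat m * complex_of_real (?v / real m / 2) = of_real (?v / 2)"
      using m by simp
    have "?f m = of_nat m * (\<Sum>j\<in>B i. of_real (q i j) * r j)"
      by (rule gen[OF A B]) simp
    then have "cmod (?f m) = real m * cmod (\<Sum>j\<in>B i. of_real (q i j) * r j)" by (simp add: norm_mult)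
    also have "\<dots> \<le> real m * (\<Sum>j\<in>B i. q i j * \<bar>c j / ?s\<bar> ^ 3)"
    proof (intro mult_left_mono order_trans[OF norm_sum] sum_mono)
      show "cmod (of_real (q i j) * r j) \<le> q i j * \<bar>c j / ?s\<bar> ^ 3" for j
        unfolding norm_mult norm_of_real abs_of_nonneg[OF q_nonneg] by (intro mult_left_mono r q_nonneg)
    qed simp
    also have "(\<Sum>j\<in>B i. q i j * \<bar>c j / ?s\<bar> ^ 3) = ?C / ?s ^ 3"
      using s by (simp add: power_divide sum_divide_distrib)
    also have "real m * (?C / ?s ^ 3) = ?C / ?s"
      using s by (simp add: power3_eq_cube field_simps)
    finally show ?thesis .
  qed
  have "(\<lambda>m. ?C / sqrt (real m)) \<longlonglongrightarrow> 0"
    by (intro real_tendsto_divide_at_top[OF tendsto_const] filterlim_compose[OF sqrt_at_top filterlim_real_sequentially])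
  then have "?f \<longlonglongrightarrow> 0"
    by (rule Lim_null_comparison[rotated]) (use bd in \<open>auto intro: eventually_sequentiallyI[of 1]\<close>)
  then show ?thesis by (rule LIM_zero_cancel)
qed

lemma \<Psi>_pointwise:
  "(\<lambda>m. \<Psi> (\<lambda>j. \<theta> j / sqrt (real m)) ^ m) \<longlonglongrightarrow> of_real (exp (- (\<Sum>i = 1..N. real (k i) * var i \<theta>) / 2))"
proof -
  let ?c = "\<lambda>i j. \<theta> j - (\<Sum>l\<in>B i. q i l * \<theta> l)"
  let ?z = "\<lambda>i m. \<Sum>j\<in>B i. of_real (q i j) * cis (?c i j / sqrt (real m))"
  have "\<Psi> (\<lambda>j. \<theta> j / sqrt (real m)) ^ m = (\<Prod>i = 1..N. (?z i m ^ m) ^ k i)" for m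
    unfolding \<Psi>_centered prod_power_distrib power_mult[symmetric] mult.commute[of "k _" m]
    by (simp only: diff_divide_distrib sum_divide_distrib times_divide_eq_right)
  moreover have "(\<lambda>m. \<Prod>i = 1..N. (?z i m ^ m) ^ k i) \<longlonglongrightarrow> (\<Prod>i = 1..N. of_real (exp (- var i \<theta> / 2)) ^ k i)"
  proof (intro tendsto_prod tendsto_power power_tendsto_exp)
    fix i assume i: "i \<in> {1..N}"
    show "cmod (?z i m) \<le> 1" for m
      using cmod_\<phi>_le[OF i, of "\<lambda>j. ?c i j / sqrt (real m)"] by (simp add: \<phi>_def)
    have cen: "(\<Sum>j\<in>B i. q i j * ?c i j) = 0"
      by (simp add: right_diff_distrib sum_subtractf sum_q[OF i] flip: sum_distrib_right)
    have v: "(\<Sum>j\<in>B i. q i j * (?c i j)\<^sup>2) = var i \<theta>"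
    proof -
      let ?\<mu> = "\<Sum>l\<in>B i. q i l * \<theta> l"
      have "(\<Sum>j\<in>B i. q i j * (?c i j)\<^sup>2) =
          (\<Sum>j\<in>B i. q i j * (\<theta> j)\<^sup>2 - 2 * ?\<mu> * (q i j * \<theta> j) + ?\<mu>\<^sup>2 * q i j)"
        by (intro sum.cong refl) (simp add: power2_eq_square algebra_simps)
      also have "\<dots> = (\<Sum>j\<in>B i. q i j * (\<theta> j)\<^sup>2) - 2 * ?\<mu> * ?\<mu> + ?\<mu>\<^sup>2 * 1"
        unfolding sum_q[OF i, symmetric] by (simp only: sum.distrib sum_subtractf sum_distrib_left)
      finally show ?thesis by (simp add: var_def power2_eq_square)
    qed
    have "0 \<le> (\<Sum>j\<in>B i. q i j * (?c i j)\<^sup>2)" by (intro sum_nonneg mult_nonneg_nonneg q_nonneg) auto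
    then show "- var i \<theta> / 2 \<le> 0" using v by simp
    show "(\<lambda>m. of_nat m * (?z i m - 1)) \<longlonglongrightarrow> of_real (- var i \<theta> / 2)"
      using centered_second_order[OF i cen] v by simp
  qed
  moreover have "(\<Prod>i = 1..N. complex_of_real (exp (- var i \<theta> / 2)) ^ k i) =
      of_real (exp (- (\<Sum>i = 1..N. real (k i) * var i \<theta>) / 2))"
  proof -
    have "exp (- (\<Sum>i = 1..N. real (k i) * var i \<theta>) / 2) = exp (\<Sum>i = 1..N. real (k i) * (- var i \<theta> / 2))"
      by (simp add: sum_negf sum_divide_distrib)
    also have "\<dots> = (\<Prod>i = 1..N. exp (- var i \<theta> / 2) ^ k i)"
      unfolding exp_sum[OF finite_atLeastAtMost] by (simp only: exp_of_nat_mult)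
    finally show ?thesis by simp
  qed
  ultimately show ?thesis by simp
qed

end

section \<open>Fourier inversion\<close>

text \<open>Orthogonality of characters on an interval that covers a whole number of periods; the
  scale \<open>s\<close> anticipates the substitution of the local limit theorem.\<close>

lemma has_bochner_integral_cis:
  fixes s :: real and d :: int
  assumes s: "s > 0"
  shows "has_bochner_integral lborel (\<lambda>x. indicator {- pi * s..pi * s} x *\<^sub>R cis (of_int d * x / s))
    (if d = 0 then of_real (2 * pi * s) else 0)"
proof (cases "d = 0")
  case True
  have "has_bochner_integral lborel (\<lambda>x. indicator {- pi * s..pi * s} x *\<^sub>R cis (of_int d * x / s))
      (complex_of_real (pi * s) - complex_of_real (- pi * s))"
  proof (rule has_bochner_integral_FTC_Icc)
    show "(complex_of_real has_vector_derivative cis (of_int d * x / s)) (at x within {- pi * s..pi * s})" for x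
      using True by (auto simp: has_vector_derivative_def scaleR_conv_of_real intro!: derivative_eq_intros)
  qed (use s True in \<open>auto intro!: continuous_intros\<close>)
  then show ?thesis using True by (simp add: mult.assoc)
next
  case False
  define F where "F x = complex_of_real (s / of_int d) * (- \<i>) * cis (of_int d * x / s)" for x
  have "has_bochner_integral lborel (\<lambda>x. indicator {- pi * s..pi * s} x *\<^sub>R cis (of_int d * x / s))
      (F (pi * s) - F (- pi * s))"
  proof (rule has_bochner_integral_FTC_Icc)
    show "(F has_vector_derivative cis (of_int d * x / s)) (at x within {- pi * s..pi * s})" for x
      unfolding F_def has_vector_derivative_def
      by (rule derivative_eq_intros refl ext | use False s in \<open>simp add: fun_eq_iff scaleR_conv_of_real field_simps\<close>)+
  qed (use s in \<open>auto intro!: continuous_intros\<close>)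
  moreover have "F (pi * s) - F (- pi * s) = 0"
  proof -
    have "sin (of_int d * pi) = 0" by (simp add: sin_times_pi_eq_0)
    then have "cis (of_int d * pi) = cis (- (of_int d * pi))" by (simp add: complex_eq_iff)
    then show ?thesis using s by (simp add: F_def)
  qed
  ultimately show ?thesis using False by simp
qed

lemma prod_strat_vars: "(\<Prod>e\<in>strat_vars N K. x (fst e)) = (\<Prod>i = 1..N. x i ^ K i)"
  for x :: "nat \<Rightarrow> 'a :: comm_monoid_mult"
proof -
  have V: "strat_vars N K = (SIGMA i:{1..N}. {1..K i})" by (auto simp: strat_vars_def)
  show ?thesis unfolding V using prod.Sigma[of "{1..N}" "\<lambda>i. {1..K i}" "\<lambda>i _. x i"] by (simp add: case_prod_beta)
qed

lemma sum_strat_vars: "(\<Sum>e\<in>strat_vars N K. x (fst e)) = (\<Sum>i = 1..N. real (K i) * x i)"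
  for x :: "nat \<Rightarrow> real"
proof -
  have V: "strat_vars N K = (SIGMA i:{1..N}. {1..K i})" by (auto simp: strat_vars_def)
  show ?thesis unfolding V using sum.Sigma[of "{1..N}" "\<lambda>i. {1..K i}" "\<lambda>i _. x i"] by (simp add: case_prod_beta)
qed

lemma sum_over_values:
  fixes h :: "nat \<Rightarrow> real"
  assumes "finite V" "\<And>e. e \<in> V \<Longrightarrow> \<sigma> e \<in> {1..N}"
  shows "(\<Sum>e\<in>V. h (\<sigma> e)) = (\<Sum>j = 1..N. real (card {e\<in>V. \<sigma> e = j}) * h j)"
proof -
  have "(\<Sum>e\<in>V. h (\<sigma> e)) = (\<Sum>j = 1..N. \<Sum>e\<in>{e\<in>V. \<sigma> e = j}. h (\<sigma> e))"
    by (rule sum.group[symmetric]) (use assms in auto)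
  also have "\<dots> = (\<Sum>j = 1..N. real (card {e\<in>V. \<sigma> e = j}) * h j)"
    by (intro sum.cong refl) simp
  finally show ?thesis .
qed

context supported
begin

definition cnt :: "nat \<Rightarrow> (nat \<times> nat \<Rightarrow> nat) \<Rightarrow> nat \<Rightarrow> nat" where
  "cnt m \<sigma> j = card {e \<in> strat_vars N (\<lambda>i. m * k i). \<sigma> e = j}"

abbreviation choices :: "nat \<Rightarrow> (nat \<times> nat \<Rightarrow> nat) set" where
  "choices m \<equiv> (\<Pi>\<^sub>E e\<in>strat_vars N (\<lambda>i. m * k i). B (fst e))"

definition bal :: "nat \<Rightarrow> (nat \<times> nat \<Rightarrow> nat) set" where
  "bal m = balanced N (\<lambda>i. m * k i) (\<lambda>e. B (fst e))"

lemma bal_iff: "\<sigma> \<in> bal m \<longleftrightarrow> \<sigma> \<in> choices m \<and> (\<forall>j\<in>{1..N}. cnt m \<sigma> j = m * k j)"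
  by (simp add: bal_def balanced_def cnt_def)

lemma finite_choices [simp]: "finite (choices m)"
  by (intro finite_PiE) auto

lemma choices_range: "\<sigma> \<in> choices m \<Longrightarrow> e \<in> strat_vars N (\<lambda>i. m * k i) \<Longrightarrow> \<sigma> e \<in> {1..N}"
  by (meson B_sub PiE_mem subsetD)

text \<open>Multiplying out gives the law of the counts: each choice function carries its
  probability and the character of its centred counts.\<close>

lemma \<Psi>_power:
  "\<Psi> \<theta> ^ m = (\<Sum>\<sigma>\<in>choices m. of_real (\<Prod>e\<in>strat_vars N (\<lambda>i. m * k i). q (fst e) (\<sigma> e)) *
     cis (\<Sum>j = 1..N. (real (cnt m \<sigma> j) - real (m * k j)) * \<theta> j))"
proof -
  let ?V = "strat_vars N (\<lambda>i. m * k i)"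
  have "\<Psi> \<theta> ^ m = (\<Prod>i = 1..N. \<phi> i \<theta> ^ (m * k i)) * cis (- (\<Sum>j = 1..N. real (m * k j) * \<theta> j))"
    unfolding \<Psi>_def power_mult_distrib prod_power_distrib power_mult[symmetric] Complex.DeMoivre
    by (simp add: mult.commute[of m] sum_distrib_left mult.assoc mult.left_commute[of "real m"])
  also have "(\<Prod>i = 1..N. \<phi> i \<theta> ^ (m * k i)) = (\<Prod>e\<in>?V. \<phi> (fst e) \<theta>)"
    by (rule prod_strat_vars[symmetric])
  also have "\<dots> = (\<Sum>\<sigma>\<in>choices m. \<Prod>e\<in>?V. of_real (q (fst e) (\<sigma> e)) * cis (\<theta> (\<sigma> e)))"
    unfolding \<phi>_def by (rule prod_sum_PiE) auto
  also have "\<dots> = (\<Sum>\<sigma>\<in>choices m. of_real (\<Prod>e\<in>?V. q (fst e) (\<sigma> e)) * cis (\<Sum>j = 1..N. real (cnt m \<sigma> j) * \<theta> j))"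
  proof (rule sum.cong[OF refl])
    fix \<sigma> assume \<sigma>: "\<sigma> \<in> choices m"
    have "(\<Sum>e\<in>?V. \<theta> (\<sigma> e)) = (\<Sum>j = 1..N. real (cnt m \<sigma> j) * \<theta> j)"
      unfolding cnt_def by (rule sum_over_values) (use choices_range[OF \<sigma>] in auto)
    then show "(\<Prod>e\<in>?V. of_real (q (fst e) (\<sigma> e)) * cis (\<theta> (\<sigma> e))) =
        of_real (\<Prod>e\<in>?V. q (fst e) (\<sigma> e)) * cis (\<Sum>j = 1..N. real (cnt m \<sigma> j) * \<theta> j)"
      by (simp only: prod.distrib cis_sum[symmetric] of_real_prod)
  qed
  finally show ?thesis
    by (simp only: sum_distrib_right mult.assoc cis_mult left_diff_distrib sum_subtractf add_uminus_conv_diff)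
qed

text \<open>A choice never leaves its neighbourhood, so against functions constant on neighbourhoods
  the counts always have the right sum. Matching outside \<open>R\<close> therefore forces matching
  on \<open>R\<close>.\<close>

lemma bal_iff_reduced:
  assumes \<sigma>: "\<sigma> \<in> choices m"
  shows "\<sigma> \<in> bal m \<longleftrightarrow> (\<forall>a<n. cnt m \<sigma> (w a) = m * k (w a))"
proof
  assume "\<sigma> \<in> bal m"
  then show "\<forall>a<n. cnt m \<sigma> (w a) = m * k (w a)" using w_bij by (auto simp: bal_iff bij_betw_def)
next
  assume red: "\<forall>a<n. cnt m \<sigma> (w a) = m * k (w a)"
  let ?V = "strat_vars N (\<lambda>i. m * k i)"
  have "real (cnt m \<sigma> j) - real (m * k j) = 0" if "j \<in> {1..N}" for j
  proof (rule zero_at_reps[where c = "\<lambda>j. real (cnt m \<sigma> j) - real (m * k j)"])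
    show "j \<in> {1..N}" by fact
    show "real (cnt m \<sigma> j) - real (m * k j) = 0" if "j \<in> {1..N} - R" for j
    proof -
      have "j \<in> w ` {..<n}" using w_bij that by (simp only: bij_betw_def)
      then obtain a where "a < n" "j = w a" by auto
      then show ?thesis using red by simp
    qed
    fix h :: "nat \<Rightarrow> real"
    assume h: "\<And>i a b. a \<in> B i \<Longrightarrow> b \<in> B i \<Longrightarrow> h a = h b"
    have "(\<Sum>j = 1..N. real (cnt m \<sigma> j) * h j) = (\<Sum>e\<in>?V. h (\<sigma> e))"
      unfolding cnt_def by (rule sum_over_values[symmetric]) (use choices_range[OF \<sigma>] in auto)
    also have "\<dots> = (\<Sum>e\<in>?V. \<Sum>j\<in>B (fst e). q (fst e) j * h j)"
    proof (rule sum.cong[OF refl])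
      fix e assume e: "e \<in> ?V"
      have i: "fst e \<in> {1..N}" and s: "\<sigma> e \<in> B (fst e)" using e \<sigma> by (auto simp: strat_vars_def PiE_iff)
      have "(\<Sum>j\<in>B (fst e). q (fst e) j * h j) = (\<Sum>j\<in>B (fst e). q (fst e) j * h (\<sigma> e))"
        by (intro sum.cong refl) (use h s in metis)
      then show "h (\<sigma> e) = (\<Sum>j\<in>B (fst e). q (fst e) j * h j)"
        by (simp only: sum_distrib_right[symmetric] sum_q[OF i])
    qed
    also have "\<dots> = (\<Sum>i = 1..N. real (m * k i) * (\<Sum>j\<in>B i. q i j * h j))" by (rule sum_strat_vars)
    also have "\<dots> = real m * (\<Sum>i = 1..N. \<Sum>j\<in>B i. (real (k i) * q i j) * h j)"
      by (simp add: sum_distrib_left mult.assoc)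
    also have "(\<Sum>i = 1..N. \<Sum>j\<in>B i. (real (k i) * q i j) * h j) = (\<Sum>j = 1..N. real (k j) * h j)"
      by (rule const_on_nbrs_sum[OF h]) (simp_all only: sum_distrib_left[symmetric] sum_q)
    finally show "(\<Sum>j = 1..N. (real (cnt m \<sigma> j) - real (m * k j)) * h j) = 0"
      by (simp add: left_diff_distrib sum_subtractf sum_distrib_left mult.assoc)
  qed
  then have "\<forall>j\<in>{1..N}. cnt m \<sigma> j = m * k j" by (simp only: right_minus_eq of_nat_eq_iff) blast
  then show "\<sigma> \<in> bal m" using \<sigma> by (simp add: bal_iff)
qed

text \<open>The probability is a product of \<open>exp (y j)\<close> over the chosen neighbours and
  of \<open>1 / Z y i\<close> over the equations; balance fixes how often each occurs.\<close>

lemma prod_q_bal: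
  assumes "\<sigma> \<in> bal m"
  shows "(\<Prod>e\<in>strat_vars N (\<lambda>i. m * k i). q (fst e) (\<sigma> e)) = exp (- real m * g y)"
proof -
  let ?V = "strat_vars N (\<lambda>i. m * k i)"
  have \<sigma>: "\<sigma> \<in> choices m" and c: "\<And>j. j \<in> {1..N} \<Longrightarrow> cnt m \<sigma> j = m * k j"
    using assms by (auto simp: bal_iff)
  have "(\<Prod>e\<in>?V. q (fst e) (\<sigma> e)) = (\<Prod>e\<in>?V. exp (y (\<sigma> e) - ln (Z y (fst e))))"
  proof (rule prod.cong[OF refl])
    fix e assume e: "e \<in> ?V"
    have i: "fst e \<in> {1..N}" and s: "\<sigma> e \<in> B (fst e)" using e \<sigma> by (auto simp: strat_vars_def PiE_iff)
    then show "q (fst e) (\<sigma> e) = exp (y (\<sigma> e) - ln (Z y (fst e)))"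
      using Z_pos[OF i, of y] by (simp add: q_def exp_diff)
  qed
  also have "\<dots> = exp ((\<Sum>e\<in>?V. y (\<sigma> e)) - (\<Sum>e\<in>?V. ln (Z y (fst e))))"
    by (simp only: exp_sum[OF finite_strat_vars, symmetric] sum_subtractf)
  also have "(\<Sum>e\<in>?V. ln (Z y (fst e))) = real m * (\<Sum>i = 1..N. real (k i) * ln (Z y i))"
    by (simp add: sum_strat_vars[of "\<lambda>i. ln (Z y i)"] sum_distrib_left mult.assoc)
  also have "(\<Sum>e\<in>?V. y (\<sigma> e)) = (\<Sum>j = 1..N. real (cnt m \<sigma> j) * y j)"
    unfolding cnt_def by (rule sum_over_values) (use choices_range[OF \<sigma>] in auto)
  also have "\<dots> = (\<Sum>j = 1..N. real m * (real (k j) * y j))"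
    by (intro sum.cong refl) (simp add: c)
  also have "\<dots> = real m * (\<Sum>j = 1..N. real (k j) * y j)" by (simp only: sum_distrib_left)
  finally show ?thesis by (simp add: g_alt right_diff_distrib)
qed

text \<open>Integrated termwise: a choice contributes the volume of the cube if its reduced counts
  match and 0 otherwise, and all balanced choices have the same probability.\<close>

lemma fourier_inversion:
  assumes s: "s > 0"
  shows "has_bochner_integral (PiM {..<n} (\<lambda>_. lborel))
    (\<lambda>x. of_real (\<Prod>a<n. indicator {- pi * s..pi * s} (x a)) * \<Psi> (\<lambda>j. ext x j / s) ^ m)
    (of_real ((2 * pi * s) ^ n * (real (card (bal m)) * exp (- real m * g y))))" (is "has_bochner_integral ?M _ _")
proof -
  interpret product_sigma_finite "\<lambda>_::nat. lborel :: real measure" by (rule product_sigma_finite_lborel)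
  let ?V = "strat_vars N (\<lambda>i. m * k i)"
  let ?q = "\<lambda>\<sigma>. \<Prod>e\<in>?V. q (fst e) (\<sigma> e)"
  let ?d = "\<lambda>\<sigma> a. int (cnt m \<sigma> (w a)) - int (m * k (w a))"
  let ?f = "\<lambda>\<sigma> a x. indicator {- pi * s..pi * s} x *\<^sub>R cis (of_int (?d \<sigma> a) * x / s)"
  have expand: "of_real (\<Prod>a<n. indicator {- pi * s..pi * s} (x a)) * \<Psi> (\<lambda>j. ext x j / s) ^ m =
      (\<Sum>\<sigma>\<in>choices m. of_real (?q \<sigma>) * (\<Prod>a<n. ?f \<sigma> a (x a)))" for x
  proof -
    have "(\<Sum>j = 1..N. (real (cnt m \<sigma> j) - real (m * k j)) * (ext x j / s)) = (\<Sum>a<n. of_int (?d \<sigma> a) * x a / s)" for \<sigma>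
    proof -
      have "(\<Sum>j = 1..N. (real (cnt m \<sigma> j) - real (m * k j)) * (ext x j / s)) =
          (\<Sum>a<n. (real (cnt m \<sigma> (w a)) - real (m * k (w a))) * (ext x (w a) / s))"
        by (rule sum_ext[where x = x]) simp
      then show ?thesis by (simp add: ext_w)
    qed
    then show ?thesis
      unfolding \<Psi>_power
      by (simp add: sum_distrib_left cis_sum scaleR_conv_of_real prod.distrib mult_ac)
  qed
  have int: "integrable lborel (?f \<sigma> a)" for \<sigma> a
    using has_bochner_integral_cis[OF s] by (rule integrable.intros)
  have val: "(\<integral>x. (\<Prod>a<n. ?f \<sigma> a (x a)) \<partial>?M) = (if \<sigma> \<in> bal m then of_real ((2 * pi * s) ^ n) else 0)"
    if \<sigma>: "\<sigma> \<in> choices m" for \<sigma>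
  proof -
    have "(\<integral>x. (\<Prod>a<n. ?f \<sigma> a (x a)) \<partial>?M) = (\<Prod>a<n. integral\<^sup>L lborel (?f \<sigma> a))"
      by (rule product_integral_prod) (use int in auto)
    also have "\<dots> = (\<Prod>a<n. if ?d \<sigma> a = 0 then complex_of_real (2 * pi * s) else 0)"
      by (intro prod.cong refl has_bochner_integral_integral_eq has_bochner_integral_cis s)
    also have "\<dots> = (if \<forall>a<n. ?d \<sigma> a = 0 then of_real ((2 * pi * s) ^ n) else 0)"
    proof (cases "\<forall>a<n. ?d \<sigma> a = 0")
      case True
      then have "(\<Prod>a<n. if ?d \<sigma> a = 0 then complex_of_real (2 * pi * s) else 0) = (\<Prod>a<n. complex_of_real (2 * pi * s))"
        by (intro prod.cong) auto
      then show ?thesis using True by simp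
    next
      case False
      then obtain a where "a \<in> {..<n}" "?d \<sigma> a \<noteq> 0" by auto
      then have "(\<Prod>a<n. if ?d \<sigma> a = 0 then complex_of_real (2 * pi * s) else 0) = 0"
        by (intro prod_zero) auto
      then show ?thesis using False by auto
    qed
    also have "(\<forall>a<n. ?d \<sigma> a = 0) \<longleftrightarrow> \<sigma> \<in> bal m"
      unfolding bal_iff_reduced[OF \<sigma>] by (simp only: right_minus_eq of_nat_eq_iff)
    finally show ?thesis .
  qed
  have intp: "integrable ?M (\<lambda>x. \<Prod>a<n. ?f \<sigma> a (x a))" for \<sigma>
    by (rule product_integrable_prod) (use int in auto)
  have ints: "integrable ?M (\<lambda>x. \<Sum>\<sigma>\<in>choices m. of_real (?q \<sigma>) * (\<Prod>a<n. ?f \<sigma> a (x a)))"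
    by (intro Bochner_Integration.integrable_sum integrable_mult_right intp)
  have "(\<integral>x. (\<Sum>\<sigma>\<in>choices m. of_real (?q \<sigma>) * (\<Prod>a<n. ?f \<sigma> a (x a))) \<partial>?M) =
      (\<Sum>\<sigma>\<in>choices m. of_real (?q \<sigma>) * (\<integral>x. (\<Prod>a<n. ?f \<sigma> a (x a)) \<partial>?M))"
    by (subst Bochner_Integration.integral_sum) (intro integrable_mult_right intp, intro sum.cong refl Bochner_Integration.integral_mult_right intp)
  also have "\<dots> = (\<Sum>\<sigma>\<in>choices m. if \<sigma> \<in> bal m then of_real (exp (- real m * g y) * (2 * pi * s) ^ n) else 0)"
  proof (rule sum.cong[OF refl])
    fix \<sigma> assume \<sigma>: "\<sigma> \<in> choices m"
    show "of_real (?q \<sigma>) * (\<integral>x. (\<Prod>a<n. ?f \<sigma> a (x a)) \<partial>?M) =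
        (if \<sigma> \<in> bal m then complex_of_real (exp (- real m * g y) * (2 * pi * s) ^ n) else 0)"
      unfolding val[OF \<sigma>] using prod_q_bal[of \<sigma> m] by (simp only: of_real_mult mult_zero_right if_True if_False split: if_split) simp
  qed
  also have "\<dots> = (\<Sum>\<sigma>\<in>bal m. of_real (exp (- real m * g y) * (2 * pi * s) ^ n))"
  proof -
    have "{\<sigma>\<in>choices m. \<sigma> \<in> bal m} = bal m" using bal_iff by blast
    then show ?thesis by (simp only: sum.inter_filter[OF finite_choices, symmetric])
  qed
  finally show ?thesis unfolding expand has_bochner_integral_iff using ints by (simp add: mult_ac)
qed

text \<open>With \<open>s = sqrt m\<close> the integrand tends to the Gaussian of the reduced
  covariance, and \<open>\<Psi>_bound\<close> turns into a dominating function that does not depend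
  on \<open>m\<close>.\<close>

lemma fourier_limit:
  "(\<lambda>m. (2 * pi * sqrt (real m)) ^ n * (real (card (bal m)) * exp (- real m * g y)))
    \<longlonglongrightarrow> sqrt ((2 * pi) ^ n / Determinant.det (reduced_covariance N k F R))"
proof -
  let ?M = "PiM {..<n} (\<lambda>_::nat. lborel :: real measure)"
  let ?box = "\<lambda>m x. \<Prod>a<n. indicator {- pi * sqrt (real m)..pi * sqrt (real m)} (x a) :: real"
  let ?h = "\<lambda>m x. complex_of_real (?box m x) * \<Psi> (\<lambda>j. ext x j / sqrt (real m)) ^ m"
  obtain c where c: "c > 0" "\<forall>x. (\<forall>a<n. \<bar>x a\<bar> \<le> pi) \<longrightarrow> cmod (\<Psi> (ext x)) \<le> exp (- c * (\<Sum>a<n. (x a)\<^sup>2))"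
    using \<Psi>_bound by (elim exE conjE)
  \<comment> \<open>The dominating function is written as the Gaussian of a diagonal form, from
    which its integrability follows.\<close>
  let ?D = "\<lambda>a b. if a = b then 2 * c else 0"
  have D: "qform n ?D x = 2 * (c * (\<Sum>a<n. (x a)\<^sup>2))" for x
    by (simp add: qform_def if_distrib[of "\<lambda>z. z * _"] if_distrib[of "\<lambda>z. _ * z"] sum_distrib_left power2_eq_square mult_ac cong: if_cong)
  have pd: "pos_def n ?D"
    unfolding pos_def_def D
  proof (intro conjI allI impI)
    fix x :: "nat \<Rightarrow> real" assume "\<exists>a<n. x a \<noteq> 0"
    then obtain a where a: "a \<in> {..<n}" "x a \<noteq> 0" by auto
    have "0 < (\<Sum>a<n. (x a)\<^sup>2)" by (rule sum_pos2[OF _ a(1)]) (use a in auto)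
    then show "0 < 2 * (c * (\<Sum>a<n. (x a)\<^sup>2))" using c(1) by simp
  qed auto
  have dom: "integrable ?M (\<lambda>x. exp (- (c * (\<Sum>a<n. (x a)\<^sup>2))))"
    using has_bochner_integral_gaussian[OF pd] by (simp add: D has_bochner_integral_iff)
  have gauss: "has_bochner_integral ?M (\<lambda>x. exp (- qform n Q x / 2))
      (sqrt ((2 * pi) ^ n / Determinant.det (reduced_covariance N k F R)))"
    unfolding reduced_covariance_eq by (rule has_bochner_integral_gaussian[OF pos_def_Q])
  have bound: "cmod (?h m x) \<le> exp (- (c * (\<Sum>a<n. (x a)\<^sup>2)))" if m: "m \<ge> 1" for m x
  proof (cases "\<forall>a<n. \<bar>x a\<bar> \<le> pi * sqrt (real m)")
    case True
    have s: "sqrt (real m) > 0" using m by simp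
    have e: "(\<lambda>j. ext x j / sqrt (real m)) = ext (\<lambda>a. x a / sqrt (real m))" by (auto simp: ext_def)
    have "cmod (\<Psi> (ext (\<lambda>a. x a / sqrt (real m)))) \<le> exp (- c * (\<Sum>a<n. (x a / sqrt (real m))\<^sup>2))"
      by (rule c(2)[rule_format]) (use True s in \<open>simp add: field_simps\<close>)
    then have "cmod (\<Psi> (ext (\<lambda>a. x a / sqrt (real m)))) ^ m \<le> exp (- c * (\<Sum>a<n. (x a / sqrt (real m))\<^sup>2)) ^ m"
      by (intro power_mono) auto
    also have "\<dots> = exp (real m * (- c * (\<Sum>a<n. (x a / sqrt (real m))\<^sup>2)))" by (simp only: exp_of_nat_mult)
    also have "real m * (- c * (\<Sum>a<n. (x a / sqrt (real m))\<^sup>2)) = - (c * (\<Sum>a<n. (x a)\<^sup>2))"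
      using m by (simp add: power_divide flip: sum_divide_distrib)
    finally have "cmod (\<Psi> (ext (\<lambda>a. x a / sqrt (real m)))) ^ m \<le> exp (- (c * (\<Sum>a<n. (x a)\<^sup>2)))" .
    moreover have "?box m x = 1" using True by (intro prod.neutral) (auto simp: abs_le_iff)
    ultimately show ?thesis unfolding e by (simp add: norm_power)
  next
    case False
    then obtain a where "a \<in> {..<n}" "\<not> \<bar>x a\<bar> \<le> pi * sqrt (real m)" by auto
    then have box: "?box m x = 0" by (intro prod_zero) (auto simp: abs_le_iff indicator_def intro!: bexI[of _ a])
    show ?thesis unfolding box by simp
  qed
  have pointwise: "(\<lambda>m. ?h m x) \<longlonglongrightarrow> complex_of_real (exp (- qform n Q x / 2))" for x
  proof -
    have "(\<lambda>m. ?box m x) \<longlonglongrightarrow> (\<Prod>a<n. 1)"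
    proof (intro tendsto_prod tendsto_eventually)
      fix a
      have "filterlim (\<lambda>m. pi * sqrt (real m)) at_top sequentially"
        by (intro filterlim_tendsto_pos_mult_at_top[OF tendsto_const pi_gt_zero]
            filterlim_compose[OF sqrt_at_top filterlim_real_sequentially])
      then have "\<forall>\<^sub>F m in sequentially. \<bar>x a\<bar> \<le> pi * sqrt (real m)" by (simp add: filterlim_at_top)
      then show "\<forall>\<^sub>F m in sequentially. indicator {- pi * sqrt (real m)..pi * sqrt (real m)} (x a) = (1::real)"
        by eventually_elim (auto simp: abs_le_iff)
    qed
    then have "(\<lambda>m. complex_of_real (?box m x)) \<longlonglongrightarrow> of_real (\<Prod>a<n. 1)" by (rule tendsto_of_real)
    then have "(\<lambda>m. ?h m x) \<longlonglongrightarrow> of_real (\<Prod>a<n. 1) * of_real (exp (- (\<Sum>i = 1..N. real (k i) * var i (ext x)) / 2))"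
      by (rule tendsto_mult[OF _ \<Psi>_pointwise])
    then show ?thesis by (simp only: qform_Q) simp
  qed
  \<comment> \<open>The sequence is shifted by one because inversion requires a positive
    scale.\<close>
  have meas: "?h (Suc m) \<in> borel_measurable ?M" for m
    using has_bochner_integral_iff fourier_inversion[of "sqrt (real (Suc m))" "Suc m"] by (auto dest: borel_measurable_integrable)
  have lim_meas: "(\<lambda>x. complex_of_real (exp (- qform n Q x / 2))) \<in> borel_measurable ?M"
    using gauss by (intro borel_measurable_of_real borel_measurable_integrable) (simp add: has_bochner_integral_iff)
  have "(\<lambda>m. integral\<^sup>L ?M (?h (Suc m))) \<longlonglongrightarrow> (\<integral>x. complex_of_real (exp (- qform n Q x / 2)) \<partial>?M)"
  proof (rule integral_dominated_convergence[OF lim_meas meas dom]; rule AE_I2)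
    show "(\<lambda>m. ?h (Suc m) x) \<longlonglongrightarrow> complex_of_real (exp (- qform n Q x / 2))" for x
      by (rule LIMSEQ_Suc[OF pointwise])
    show "cmod (?h (Suc m) x) \<le> exp (- (c * (\<Sum>a<n. (x a)\<^sup>2)))" for m x
      by (rule bound) simp
  qed
  also have "(\<lambda>m. integral\<^sup>L ?M (?h (Suc m))) = (\<lambda>m. of_real ((2 * pi * sqrt (real (Suc m))) ^ n * (real (card (bal (Suc m))) * exp (- real (Suc m) * g y))))"
    by (intro ext has_bochner_integral_integral_eq fourier_inversion) simp
  also have "(\<integral>x. complex_of_real (exp (- qform n Q x / 2)) \<partial>?M) =
      of_real (sqrt ((2 * pi) ^ n / Determinant.det (reduced_covariance N k F R)))"
    using gauss by (simp only: integral_complex_of_real has_bochner_integral_iff)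
  finally show ?thesis
    unfolding tendsto_of_real_iff by (rule LIMSEQ_imp_Suc)
qed

lemma card_bal_asymp:
  "(\<lambda>m. real (card (bal m))) \<sim>[at_top]
    (\<lambda>m. capacity N k F ^ m /
      ((2 * pi * real m) powr ((real N - real (num_components N F)) / 2) *
       sqrt (Determinant.det (reduced_covariance N k F R))))"
proof (rule asymp_equivI')
  let ?det = "Determinant.det (reduced_covariance N k F R)"
  let ?T = "\<lambda>m. (2 * pi * sqrt (real m)) ^ n * (real (card (bal m)) * exp (- real m * g y))"
  let ?r = "\<lambda>m. capacity N k F ^ m / ((2 * pi * real m) powr ((real N - real (num_components N F)) / 2) * sqrt ?det)"
  have det: "?det > 0" unfolding reduced_covariance_eq by (rule det_pos_def[OF pos_def_Q])
  let ?a = "sqrt (2 * pi) ^ n"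
  have a: "?a > 0" by simp
  have lim: "sqrt ((2 * pi) ^ n / ?det) = ?a / sqrt ?det" by (simp only: real_sqrt_divide real_sqrt_power)
  have "(\<lambda>m. ?T m * (sqrt ?det / ?a)) \<longlonglongrightarrow> ?a / sqrt ?det * (sqrt ?det / ?a)"
    using fourier_limit unfolding lim by (rule tendsto_mult_right)
  also have "?a / sqrt ?det * (sqrt ?det / ?a) = 1" using det a by simp
  finally have "(\<lambda>m. ?T m * (sqrt ?det / ?a)) \<longlonglongrightarrow> 1" .
  moreover have "\<forall>\<^sub>F m in sequentially. ?T m * (sqrt ?det / ?a) = real (card (bal m)) / ?r m"
  proof (rule eventually_sequentiallyI[of 1])
    fix m :: nat assume m: "1 \<le> m"
    have "(2 * pi * real m) powr (real n / 2) = ((2 * pi * real m) powr (1 / 2)) powr real n"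
      by (simp add: powr_powr)
    also have "\<dots> = (sqrt (2 * pi) * sqrt (real m)) ^ n"
      using m by (subst powr_realpow) (simp_all add: powr_half_sqrt real_sqrt_mult)
    finally have pw: "(2 * pi * real m) powr (real n / 2) = ?a * sqrt (real m) ^ n" by (simp only: power_mult_distrib)
    \<comment> \<open>Of the two factors \<open>sqrt (2 * pi)\<close> per coordinate, one cancels
      against the Gaussian integral and the other joins \<open>sqrt m\<close>.\<close>
    have "2 * pi * sqrt (real m) = sqrt (2 * pi) * (sqrt (2 * pi) * sqrt (real m))" by (simp flip: mult.assoc)
    then have T: "?T m = ?a * (?a * sqrt (real m) ^ n) * (real (card (bal m)) * exp (- real m * g y))"
      by (simp only: power_mult_distrib)
    have cap: "capacity N k F ^ m = exp (real m * g y)" unfolding capacity_eq by (simp only: exp_of_nat_mult)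
    have gen: "u * (u * v) * (t * e') * (d / u) = t / (e / (u * v * d))" if "u \<noteq> 0" "e' = inverse e" for u v t e' d e :: real
      using that by (simp add: divide_simps)
    show "?T m * (sqrt ?det / ?a) = real (card (bal m)) / ?r m"
      unfolding T n_real pw cap
    proof (rule gen)
      show "?a \<noteq> 0" using a by simp
      show "exp (- real m * g y) = inverse (exp (real m * g y))" by (simp only: mult_minus_left exp_minus)
    qed
  qed
  ultimately show "(\<lambda>m. real (card (bal m)) / ?r m) \<longlonglongrightarrow> 1" by (rule Lim_transform_eventually)
qed

end

section \<open>Feasible degree vectors\<close>

lemma finite_nbrs:
  assumes "G \<subseteq> all_edges N"
  shows "finite (in_nbrs G i)" "finite (out_nbrs G i)"
proof -
  have "in_nbrs G i \<subseteq> {1..N}" "out_nbrs G i \<subseteq> {1..N}"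
    using assms by (auto simp: in_nbrs_def out_nbrs_def all_edges_def)
  then show "finite (in_nbrs G i)" "finite (out_nbrs G i)" by (auto intro: finite_subset)
qed

lemma balanced_counts_in_polytope:
  assumes G: "G \<subseteq> all_edges N" and \<sigma>: "\<sigma> \<in> balanced N K (\<lambda>e. in_nbrs G (fst e))"
  shows "(\<lambda>(j, i). real (card {e \<in> strat_vars N K. fst e = i \<and> \<sigma> e = j})) \<in> transport_polytope N K G"
proof -
  let ?V = "strat_vars N K"
  have nbr: "(\<sigma> e, fst e) \<in> G" if "e \<in> ?V" for e
    using \<sigma> that by (auto simp: balanced_def PiE_iff in_nbrs_def)
  have rows: "(\<Sum>j\<in>in_nbrs G i. card {e \<in> ?V. fst e = i \<and> \<sigma> e = j}) = K i" if i: "i \<in> {1..N}" for i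
  proof -
    have "(\<Sum>j\<in>in_nbrs G i. \<Sum>e\<in>{e \<in> {e \<in> ?V. fst e = i}. \<sigma> e = j}. 1 :: nat) = (\<Sum>e\<in>{e \<in> ?V. fst e = i}. 1)"
      by (rule sum.group) (use nbr finite_nbrs[OF G] in \<open>auto simp: in_nbrs_def\<close>)
    moreover have "{e \<in> ?V. fst e = i} = {i} \<times> {1..K i}" using i by (auto simp: strat_vars_def)
    moreover have "{e \<in> {e \<in> ?V. fst e = i}. \<sigma> e = j} = {e \<in> ?V. fst e = i \<and> \<sigma> e = j}" for j by auto
    ultimately show ?thesis by (simp only: card_eq_sum[symmetric]) simp
  qed
  have cols: "(\<Sum>i\<in>out_nbrs G j. card {e \<in> ?V. fst e = i \<and> \<sigma> e = j}) = K j" if j: "j \<in> {1..N}" for j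
  proof -
    have "(\<Sum>i\<in>out_nbrs G j. \<Sum>e\<in>{e \<in> {e \<in> ?V. \<sigma> e = j}. fst e = i}. 1 :: nat) = (\<Sum>e\<in>{e \<in> ?V. \<sigma> e = j}. 1)"
      by (rule sum.group) (use nbr finite_nbrs[OF G] in \<open>auto simp: out_nbrs_def\<close>)
    moreover have "card {e \<in> ?V. \<sigma> e = j} = K j" using \<sigma> j by (auto simp: balanced_def)
    moreover have "{e \<in> {e \<in> ?V. \<sigma> e = j}. fst e = i} = {e \<in> ?V. fst e = i \<and> \<sigma> e = j}" for i by auto
    ultimately show ?thesis by (simp only: card_eq_sum[symmetric])
  qed
  have off: "card {e \<in> ?V. fst e = i \<and> \<sigma> e = j} = 0" if "(j, i) \<notin> G" for i j
  proof -
    have "{e \<in> ?V. fst e = i \<and> \<sigma> e = j} = {}" using that nbr by auto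
    then show ?thesis by (simp only: card.empty)
  qed
  show ?thesis
    unfolding transport_polytope_def
  proof (intro CollectI conjI ballI allI impI)
    fix i assume i: "i \<in> {1..N}"
    show "(\<Sum>j\<in>in_nbrs G i. case (j, i) of (j, i) \<Rightarrow> real (card {e \<in> ?V. fst e = i \<and> \<sigma> e = j})) = real (K i)"
      unfolding prod.case of_nat_sum[symmetric] rows[OF i] ..
    show "(\<Sum>l\<in>out_nbrs G i. case (i, l) of (j, i) \<Rightarrow> real (card {e \<in> ?V. fst e = i \<and> \<sigma> e = j})) = real (K i)"
      unfolding prod.case of_nat_sum[symmetric] cols[OF i] ..
  next
    show "(case e of (j, i) \<Rightarrow> real (card {e \<in> ?V. fst e = i \<and> \<sigma> e = j})) = 0" if "e \<notin> G" for e
      using that off by (cases e) simp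
  qed auto
qed

lemma transport_polytope_scale:
  assumes "a \<in> transport_polytope N (\<lambda>i. m * k i) G" "m \<ge> 1"
  shows "(\<lambda>e. a e / real m) \<in> transport_polytope N k G"
  using assms by (auto simp: transport_polytope_def simp flip: sum_divide_distrib)

lemma transport_polytope_midpoint:
  assumes "a \<in> transport_polytope N k G" "b \<in> transport_polytope N k G"
  shows "(\<lambda>e. (a e + b e) / 2) \<in> transport_polytope N k G"
  using assms by (auto simp: transport_polytope_def sum.distrib simp flip: sum_divide_distrib)

lemma transport_polytope_essential:
  assumes G: "G \<subseteq> all_edges N" and a: "a \<in> transport_polytope N k G"
  shows "a \<in> transport_polytope N k (essential_support N k G)"
proof -
  let ?F = "essential_support N k G"
  have sub: "?F \<subseteq> G" by (auto simp: essential_support_def)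
  have zero: "a e = 0" if e: "e \<notin> ?F" for e
  proof -
    have "\<not> a e > 0" if "e \<in> G" using that e a by (auto simp: essential_support_def)
    then show ?thesis using a by (cases "e \<in> G") (auto simp: transport_polytope_def simp del: split_paired_All)
  qed
  note fin = finite_nbrs[OF G]
  have "(\<Sum>j\<in>in_nbrs ?F i. a (j, i)) = (\<Sum>j\<in>in_nbrs G i. a (j, i))" for i
    by (rule sum.mono_neutral_left) (use fin sub zero in \<open>auto simp: in_nbrs_def\<close>)
  moreover have "(\<Sum>i\<in>out_nbrs ?F j. a (j, i)) = (\<Sum>i\<in>out_nbrs G j. a (j, i))" for j
    by (rule sum.mono_neutral_left) (use fin sub zero in \<open>auto simp: out_nbrs_def\<close>)
  moreover have "\<forall>e\<in>?F. 0 \<le> a e" using a sub by (auto simp: transport_polytope_def)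
  ultimately show ?thesis
    using a zero by (simp add: transport_polytope_def)
qed

text \<open>A midpoint is positive wherever one of its two endpoints is, so the witnesses for single
  edges are merged one at a time.\<close>

lemma positive_on_essential_support:
  assumes G: "G \<subseteq> all_edges N" and a: "a \<in> transport_polytope N k G"
  shows "\<exists>p\<in>transport_polytope N k (essential_support N k G). \<forall>e\<in>essential_support N k G. 0 < p e"
proof -
  have "finite A \<Longrightarrow> A \<subseteq> essential_support N k G \<Longrightarrow> \<exists>p\<in>transport_polytope N k G. \<forall>e\<in>A. 0 < p e" for A
  proof (induction A rule: finite_induct)
    case (insert e A)
    then have "\<exists>p\<in>transport_polytope N k G. \<forall>e\<in>A. 0 < p e" by (intro insert.IH) simp
    then obtain p where p: "p \<in> transport_polytope N k G" "\<forall>e\<in>A. 0 < p e" by (elim bexE)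
    obtain b where b: "b \<in> transport_polytope N k G" "0 < b e" using insert.prems by (auto simp: essential_support_def)
    have nn: "0 \<le> c e'" if "c \<in> transport_polytope N k G" for c e'
      using that by (cases "e' \<in> G") (auto simp: transport_polytope_def simp del: split_paired_All)
    have "0 < (p e' + b e') / 2" if "e' \<in> insert e A" for e'
    proof -
      have "0 < p e' \<or> 0 < b e'" using that p(2) b(2) by blast
      then show ?thesis
        using nn[OF p(1), of e'] nn[OF b(1), of e'] by (auto intro: add_pos_nonneg add_nonneg_pos)
    qed
    then show ?case using transport_polytope_midpoint[OF p(1) b(1)] by (intro bexI ballI)
  qed (use a in auto)
  moreover have "finite (essential_support N k G)"
    by (rule finite_subset[of _ "{1..N} \<times> {1..N}"]) (use G in \<open>auto simp: essential_support_def all_edges_def\<close>)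
  ultimately have "\<exists>p\<in>transport_polytope N k G. \<forall>e\<in>essential_support N k G. 0 < p e" by simp
  then obtain p where "p \<in> transport_polytope N k G" "\<forall>e\<in>essential_support N k G. 0 < p e" by (elim bexE)
  then show ?thesis by (intro bexI[of _ p] transport_polytope_essential[OF G])
qed

text \<open>After division by \<open>m\<close> the edge counts of a balanced assignment form a point
  of the polytope for \<open>k\<close>, so every edge in use is essential already for
  \<open>k\<close>.\<close>

lemma balanced_essential_support:
  assumes G: "G \<subseteq> all_edges N" and m: "m \<ge> 1"
  shows "balanced N (\<lambda>i. m * k i) (\<lambda>e. in_nbrs G (fst e)) =
    balanced N (\<lambda>i. m * k i) (\<lambda>e. in_nbrs (essential_support N k G) (fst e))" (is "?L = ?R")
proof
  let ?V = "strat_vars N (\<lambda>i. m * k i)"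
  have "(\<Pi>\<^sub>E e\<in>?V. in_nbrs (essential_support N k G) (fst e)) \<subseteq> (\<Pi>\<^sub>E e\<in>?V. in_nbrs G (fst e))"
    by (rule PiE_mono) (auto simp: in_nbrs_def essential_support_def)
  then show "?R \<subseteq> ?L" by (auto simp: balanced_def)
  show "?L \<subseteq> ?R"
  proof
    fix \<sigma> assume \<sigma>: "\<sigma> \<in> ?L"
    let ?c = "\<lambda>(j, i). real (card {e \<in> ?V. fst e = i \<and> \<sigma> e = j}) / real m"
    have "(\<lambda>e. (case e of (j, i) \<Rightarrow> real (card {e \<in> ?V. fst e = i \<and> \<sigma> e = j})) / real m) \<in> transport_polytope N k G"
      by (rule transport_polytope_scale[OF balanced_counts_in_polytope[OF G \<sigma>] m])
    then have c: "?c \<in> transport_polytope N k G" by (simp add: case_prod_unfold)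
    have "(\<sigma> e, fst e) \<in> essential_support N k G" if e: "e \<in> ?V" for e
    proof -
      have "{e' \<in> ?V. fst e' = fst e \<and> \<sigma> e' = \<sigma> e} \<noteq> {}" using e by blast
      moreover have "finite {e' \<in> ?V. fst e' = fst e \<and> \<sigma> e' = \<sigma> e}" by simp
      ultimately have "card {e' \<in> ?V. fst e' = fst e \<and> \<sigma> e' = \<sigma> e} > 0"
        unfolding card_gt_0_iff by (rule conjI)
      then have "?c (\<sigma> e, fst e) > 0" using m by simp
      moreover have "(\<sigma> e, fst e) \<in> G" using \<sigma> e by (auto simp: balanced_def PiE_iff in_nbrs_def)
      ultimately show ?thesis unfolding essential_support_def using c by blast
    qed
    then show "\<sigma> \<in> ?R" using \<sigma> by (auto simp: balanced_def PiE_iff in_nbrs_def)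
  qed
qed

theorem theoremB:
  fixes N :: nat and k :: "nat \<Rightarrow> nat" and G F :: "(nat \<times> nat) set" and R :: "nat set"
  assumes "N \<ge> 2"
    and "\<forall>i\<in>{1..N}. 0 < k i"
    and "G \<subseteq> all_edges N"
    and "algebraic_degree N G k > 0"
    and "F = essential_support N k G"
    and "right_representatives N F R"
  shows "(\<lambda>m::nat. real (algebraic_degree N G (\<lambda>i. m * k i))) \<sim>[at_top]
    (\<lambda>m. capacity N k F ^ m /
      ((2 * pi * real m) powr ((real N - real (num_components N F)) / 2) *
       sqrt (Determinant.det (reduced_covariance N k F R))))"
proof -
  \<comment> \<open>For every degree vector, because it is applied at \<open>k\<close> and at its
    multiples.\<close>
  have degree: "algebraic_degree N G K = card (balanced N K (\<lambda>e. in_nbrs G (fst e)))" for K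
  proof -
    interpret network N G K by unfold_locales fact
    have "B = (\<lambda>e. in_nbrs G (fst e))" by (intro ext B_def)
    then show ?thesis using algebraic_degree_eq by simp
  qed
  \<comment> \<open>A positive degree supplies a balanced assignment and with it a point of the
    polytope.\<close>
  obtain \<sigma> where \<sigma>: "\<sigma> \<in> balanced N k (\<lambda>e. in_nbrs G (fst e))"
    using assms(4) unfolding degree by (metis card.empty ex_in_conv less_irrefl)
  obtain p where p: "p \<in> transport_polytope N k F" "\<forall>e\<in>F. 0 < p e"
    using positive_on_essential_support[OF assms(3) balanced_counts_in_polytope[OF assms(3) \<sigma>]]
    unfolding assms(5)[symmetric] by blast
  have F: "F \<subseteq> {1..N} \<times> {1..N}" using assms(3,5) by (auto simp: essential_support_def all_edges_def)
  interpret supported N k F p R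
    by unfold_locales (use F assms(2,6) p in auto)
  have "\<forall>\<^sub>F m in at_top. real (card (bal m)) = real (algebraic_degree N G (\<lambda>i. m * k i))"
    by (rule eventually_at_top_linorderI[of 1])
       (simp only: degree bal_def balanced_essential_support[OF assms(3)] assms(5)[symmetric])
  then show ?thesis using card_bal_asymp by (subst (asm) asymp_equiv_cong) (auto elim: eventually_mono)
qed

end
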